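(* Let $A$ be a selfadjoint operator on a separable Hilbert space with non-negative spectrum such that $0$ is isolated in the spectrum and the positive part of the spectrum consists of isolated eigenvalues with finite multiplicity. Assume that its counting function satisfies, as $\lambda\to\infty$, $$N(A;\lambda)=c\,\lambda^p(\log\lambda)^q\Bigl(1+O\bigl((\log\lambda)^{-\alpha}\bigr)\Bigr),\qquad c>0,\ p>0,\ q\ge0,\ \alpha\ge1 .$$ Put $g(t)=(t+1)^{-1}(\log(t+2))^q$, $t\ge0$. The following hold. (i) If $q=0$ and $\alpha>1$, then $A^{-p}$ is $(t+1)^{-1}$-hypermeasurable. (ii) If $q>0$ and $\alpha=1$, then $A^{-p}$ is not $g$-hypermeasurable, but it is hypermeasurable with respect to (i.e. it is $g_1$-hypermeasurable for) any continuous $\mathrm{RV}_{-1}$-function $g_1:[0,\infty)\to(0,\infty)$ such that, as $t\to\infty$, $$g_1(t)=\frac1t(\log t)^q\left(1-q^2\,\frac{\log\log t}{\log t}+O\bigl((\log t)^{-1}\bigr)\right).$$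
   Context: The positive eigenvalues of $A$, repeated according to multiplicity, are arranged as $\lambda_0(A)\le\lambda_1(A)\le\cdots$, and $N(A;\lambda)=\#\{j:\lambda_j(A)<\lambda\}$. $A^{-p}$ denotes $f(A)$ with $f(t)=\mathbf 1_{(0,\infty)}(t)\,t^{-p}$, i.e. $A^{-p}=0$ on $\ker A$ and $A^{-p}\xi=\lambda_j(A)^{-p}\xi$ if $A\xi=\lambda_j(A)\xi$. A continuous function $g:[0,\infty)\to(0,\infty)$ is $\mathrm{RV}_{-1}$ if it is ultimately monotonic and $\lim_{t\to\infty}g(\lambda t)/g(t)=\lambda^{-1}$ for all $\lambda>0$. The weak Lorentz ideal is $\mathcal L_g=\{T \text{ compact}:\mu_j(T)=O(g(j))\}$, where $\mu_j(T)$ are the singular values; equivalent functions define the same ideal. A trace on $\mathcal L_g$ is a linear functional on $\mathcal L_g$ (no continuity or positivity required) vanishing on all commutators $[B,T]$ with $B$ bounded and $T\in\mathcal L_g$. It is $g$-normalized if it takes the value $1$ on any operator $T_g$ with $T_g\xi_j=g(j)\xi_j$, $j\ge0$, for some orthonormal basis $(\xi_j)_{j\ge0}$. An operator $T\in\mathcal L_g$ is $g$-hypermeasurable if all $g$-normalized traces on $\mathcal L_g$ take the same value on $T$. *)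

theory Defs
  imports "HOL-Analysis.Analysis" "HOL-Library.Landau_Symbols"
begin

section \<open>Complex Hilbert spaces\<close>

text \<open>
  The real inner product of \<^class>\<open>real_inner\<close> is tied to the real part of the
  sesquilinear one, so that norm and topology are those of the complex Hilbert space.
  The sesquilinear form is linear in its first argument.
\<close>

class complex_hilbert = real_inner + complete_space +
  fixes scaleC :: "complex \<Rightarrow> 'a \<Rightarrow> 'a"  (infixr "*\<^sub>C" 75)
    and cinner :: "'a \<Rightarrow> 'a \<Rightarrow> complex"
  assumes scaleC_add_right: "c *\<^sub>C (x + y) = c *\<^sub>C x + c *\<^sub>C y"
    and scaleC_add_left: "(c + d) *\<^sub>C x = c *\<^sub>C x + d *\<^sub>C x"
    and scaleC_scaleC: "c *\<^sub>C (d *\<^sub>C x) = (c * d) *\<^sub>C x"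
    and scaleC_of_real: "complex_of_real r *\<^sub>C x = r *\<^sub>R x"
    and cinner_commute: "cinner x y = cnj (cinner y x)"
    and cinner_add_left: "cinner (x + y) z = cinner x z + cinner y z"
    and cinner_scaleC_left: "cinner (c *\<^sub>C x) y = c * cinner x y"
    and Re_cinner: "Re (cinner x y) = inner x y"

global_interpretation complex_vector:
  vector_space "scaleC :: complex \<Rightarrow> 'a \<Rightarrow> 'a::complex_hilbert"
proof
  show "1 *\<^sub>C x = x" for x :: 'a
    using scaleC_of_real[of 1 x] by simp
qed (simp_all add: scaleC_add_right scaleC_add_left scaleC_scaleC)

definition separable_UNIV :: "'a::topological_space itself \<Rightarrow> bool" where
  "separable_UNIV _ \<longleftrightarrow> (\<exists>S::'a set. countable S \<and> closure S = UNIV)"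

definition orthonormal_basis :: "(nat \<Rightarrow> 'a::complex_hilbert) \<Rightarrow> bool" where
  "orthonormal_basis \<xi> \<longleftrightarrow>
     (\<forall>i j. cinner (\<xi> i) (\<xi> j) = (if i = j then 1 else 0)) \<and>
     closure (complex_vector.span (range \<xi>)) = UNIV"

definition bounded_clinear :: "('a::complex_hilbert \<Rightarrow> 'a) \<Rightarrow> bool" where
  "bounded_clinear T \<longleftrightarrow> bounded_linear T \<and> (\<forall>c x. T (c *\<^sub>C x) = c *\<^sub>C T x)"

definition compact_operator :: "('a::complex_hilbert \<Rightarrow> 'a) \<Rightarrow> bool" where
  "compact_operator T \<longleftrightarrow> bounded_clinear T \<and> compact (closure (T ` cball 0 1))"

section \<open>Unbounded operators\<close>

text \<open>
  An unbounded operator is a domain \<open>D\<close> together with a function \<open>A\<close>; only the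
  values of \<open>A\<close> on \<open>D\<close> matter.
\<close>

definition densely_defined_operator :: "'a::complex_hilbert set \<Rightarrow> ('a \<Rightarrow> 'a) \<Rightarrow> bool" where
  "densely_defined_operator D A \<longleftrightarrow>
     complex_vector.subspace D \<and> closure D = UNIV \<and>
     (\<forall>x\<in>D. \<forall>y\<in>D. A (x + y) = A x + A y) \<and>
     (\<forall>c. \<forall>x\<in>D. A (c *\<^sub>C x) = c *\<^sub>C A x)"

definition adjoint_domain :: "'a::complex_hilbert set \<Rightarrow> ('a \<Rightarrow> 'a) \<Rightarrow> 'a set" where
  "adjoint_domain D A = {y. \<exists>z. \<forall>x\<in>D. cinner (A x) y = cinner x z}"

definition adjoint_op :: "'a::complex_hilbert set \<Rightarrow> ('a \<Rightarrow> 'a) \<Rightarrow> 'a \<Rightarrow> 'a" where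
  "adjoint_op D A y = (THE z. \<forall>x\<in>D. cinner (A x) y = cinner x z)"

definition selfadjoint_operator :: "'a::complex_hilbert set \<Rightarrow> ('a \<Rightarrow> 'a) \<Rightarrow> bool" where
  "selfadjoint_operator D A \<longleftrightarrow>
     densely_defined_operator D A \<and> adjoint_domain D A = D \<and> (\<forall>y\<in>D. adjoint_op D A y = A y)"

definition spectrum :: "'a::complex_hilbert set \<Rightarrow> ('a \<Rightarrow> 'a) \<Rightarrow> complex set" where
  "spectrum D A = {z. \<not> (\<exists>R. bounded_clinear R \<and>
       (\<forall>x. R x \<in> D \<and> A (R x) - z *\<^sub>C R x = x) \<and>
       (\<forall>x\<in>D. R (A x - z *\<^sub>C x) = x))}"

definition eigenspace :: "'a::complex_hilbert set \<Rightarrow> ('a \<Rightarrow> 'a) \<Rightarrow> complex \<Rightarrow> 'a set" where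
  "eigenspace D A z = {x \<in> D. A x = z *\<^sub>C x}"

definition eigenvalue_finite_mult ::
    "'a::complex_hilbert set \<Rightarrow> ('a \<Rightarrow> 'a) \<Rightarrow> complex \<Rightarrow> bool" where
  "eigenvalue_finite_mult D A z \<longleftrightarrow>
     eigenspace D A z \<noteq> {0} \<and>
     (\<exists>B. finite B \<and> eigenspace D A z = complex_vector.span B)"

text \<open>
  The positive eigenvalues of \<open>A\<close> in nondecreasing order, repeated according to
  multiplicity. If there are only finitely many, the sequence continues with \<open>\<infinity>\<close>.
  The sequence exists and is unique whenever the positive eigenvalues have finite
  multiplicity and no accumulation point in \<open>[0,\<infinity>)\<close>.
\<close>

definition pos_eigenvalue :: "'a::complex_hilbert set \<Rightarrow> ('a \<Rightarrow> 'a) \<Rightarrow> nat \<Rightarrow> ereal" where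
  "pos_eigenvalue D A = (THE l. mono l \<and> (\<forall>j. 0 < l j) \<and>
     (\<forall>t>0. finite {j. l j = ereal t} \<and>
            card {j. l j = ereal t} = complex_vector.dim (eigenspace D A (complex_of_real t))))"

definition counting_function :: "'a::complex_hilbert set \<Rightarrow> ('a \<Rightarrow> 'a) \<Rightarrow> real \<Rightarrow> nat" where
  "counting_function D A x = card {j. pos_eigenvalue D A j < ereal x}"

text \<open>
  \<open>A\<^sup>-\<^sup>p\<close>. The description determines a bounded operator when \<open>A\<close> is selfadjoint with
  spectrum in \<open>[0,\<infinity>)\<close>, \<open>0\<close> is not an accumulation point of the spectrum and the
  positive spectrum is discrete, since then the eigenvectors span a dense subspace.
\<close>

definition neg_power ::
    "'a::complex_hilbert set \<Rightarrow> ('a \<Rightarrow> 'a) \<Rightarrow> real \<Rightarrow> 'a \<Rightarrow> 'a" where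
  "neg_power D A p = (THE R. bounded_clinear R \<and>
     (\<forall>x \<in> eigenspace D A 0. R x = 0) \<and>
     (\<forall>t>0. \<forall>x \<in> eigenspace D A (complex_of_real t). R x = (t powr (- p)) *\<^sub>R x))"

section \<open>Weak Lorentz ideals, traces and hypermeasurability\<close>

text \<open>
  Singular values of a compact operator \<open>T\<close>: the square roots of the eigenvalues of
  \<open>T\<^sup>* T\<close> in nonincreasing order, repeated according to multiplicity, and continued
  by \<open>0\<close> if only finitely many of them are positive.
\<close>

definition singular_value :: "('a::complex_hilbert \<Rightarrow> 'a) \<Rightarrow> nat \<Rightarrow> real" where
  "singular_value T = (THE m. decseq m \<and> (\<forall>j. 0 \<le> m j) \<and>
     (\<forall>s>0. finite {j. m j = s} \<and>
            card {j. m j = s} =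
              complex_vector.dim
                (eigenspace UNIV (adjoint_op UNIV T \<circ> T) (complex_of_real (s\<^sup>2)))))"

definition weak_lorentz :: "(real \<Rightarrow> real) \<Rightarrow> ('a::complex_hilbert \<Rightarrow> 'a) set" where
  "weak_lorentz g = {T. compact_operator T \<and> singular_value T \<in> O(\<lambda>j. g (real j))}"

definition trace_on :: "(real \<Rightarrow> real) \<Rightarrow> (('a::complex_hilbert \<Rightarrow> 'a) \<Rightarrow> complex) \<Rightarrow> bool" where
  "trace_on g \<phi> \<longleftrightarrow>
     (\<forall>S \<in> weak_lorentz g. \<forall>T \<in> weak_lorentz g. \<phi> (\<lambda>x. S x + T x) = \<phi> S + \<phi> T) \<and>
     (\<forall>c. \<forall>T \<in> weak_lorentz g. \<phi> (\<lambda>x. c *\<^sub>C T x) = c * \<phi> T) \<and>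
     (\<forall>B. \<forall>T \<in> weak_lorentz g. bounded_clinear B \<longrightarrow> \<phi> (\<lambda>x. B (T x) - T (B x)) = 0)"

definition normalized_trace ::
    "(real \<Rightarrow> real) \<Rightarrow> (('a::complex_hilbert \<Rightarrow> 'a) \<Rightarrow> complex) \<Rightarrow> bool" where
  "normalized_trace g \<phi> \<longleftrightarrow> trace_on g \<phi> \<and>
     (\<forall>T \<xi>. bounded_clinear T \<and> orthonormal_basis \<xi> \<and>
        (\<forall>j. T (\<xi> j) = g (real j) *\<^sub>R \<xi> j) \<longrightarrow> \<phi> T = 1)"

definition hypermeasurable :: "(real \<Rightarrow> real) \<Rightarrow> ('a::complex_hilbert \<Rightarrow> 'a) \<Rightarrow> bool" where
  "hypermeasurable g T \<longleftrightarrow> T \<in> weak_lorentz g \<and>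
     (\<forall>\<phi> \<psi>. normalized_trace g \<phi> \<and> normalized_trace g \<psi> \<longrightarrow> \<phi> T = \<psi> T)"

text \<open>Functions on \<open>[0,\<infinity>)\<close> are given by functions on the reals, whose values on the
  negative reals are irrelevant.\<close>

definition RV_minus_one :: "(real \<Rightarrow> real) \<Rightarrow> bool" where
  "RV_minus_one g \<longleftrightarrow>
     continuous_on {0..} g \<and> (\<forall>t\<ge>0. 0 < g t) \<and>
     (\<exists>a. mono_on {a..} g \<or> antimono_on {a..} g) \<and>
     (\<forall>l>0. ((\<lambda>t. g (l * t) / g t) \<longlongrightarrow> inverse l) at_top)"

end

theory Submission
  imports Defs "HOL-Library.Function_Algebras" "HOL-Real_Asymp.Real_Asymp"
begin

text \<open>
  The eigenvectors of \<open>A\<close> are total (\<open>eigenvectors_total\<close>), so \<open>A\<^sup>-\<^sup>p\<close> is a diagonal operator: it has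
  the entries \<open>a\<^sub>j = \<lambda>\<^sub>j(A)\<^sup>-\<^sup>p\<close> along an orthonormal sequence (\<open>neg_power_diag_op\<close>).  The theorem is then
  a statement about traces of diagonal operators, and it follows from three facts.
  
  \<^emph>\<open>Asymptotics.\<close>  Inverting the counting function gives \<open>j + 1 = c \<lambda>\<^sub>j\<^sup>p (log \<lambda>\<^sub>j)\<^sup>q (1 + O((log \<lambda>\<^sub>j)\<^sup>-\<^sup>\<alpha>))\<close>
  (\<open>counting_inversion\<close>).  Put \<open>y = log(j + 2)\<close>.  If \<open>q = 0\<close>, then
  \<open>a\<^sub>j = c/(j + 1) + O(y\<^sup>-\<^sup>\<alpha>/(j + 1))\<close>.  If \<open>q > 0\<close> and \<open>\<alpha> = 1\<close>, taking logarithms gives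
  \<open>p log \<lambda>\<^sub>j = y - q log y + O(1)\<close>, and therefore
  \<open>a\<^sub>j = c p\<^sup>-\<^sup>q g(j) (1 - q\<^sup>2 (log y)/y + O(1/y))\<close> (\<open>eigenvalue_power_asymptotics_log\<close>).  The factor in
  parentheses is the one that distinguishes \<open>g\<^sub>1\<close> from \<open>g\<close>.
  
  \<^emph>\<open>What every trace annihilates.\<close>  A trace does not see along which orthonormal sequence a
  diagonal operator is placed.  Hence the entries \<open>b\<^sub>j\<close> and the entries \<open>b\<^sub>j\<close> with each one
  repeated on the places \<open>2j, 2j + 1\<close> have traces in the ratio \<open>1 : 2\<close>, and the entries
  \<open>d\<^sub>j = b\<^sub>j - b\<^bsub>j div 2\<^esub>/2\<close> have trace zero whenever \<open>b = O(g)\<close>.  Given \<open>d\<close>, this recursion determines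
  \<open>b\<close>, and \<open>(j + 1) \<bar>b\<^sub>j\<bar>\<close> grows at most like the sum of \<open>(i + 1) \<bar>d\<^sub>i\<bar>\<close> over
  \<open>i = j, j div 2, j div 4, ...\<close> (\<open>trace_diag_op_zero\<close>).  For the difference \<open>d\<close> of \<open>a\<close> and a multiple of
  the comparison sequence these sums are \<open>\<Sum>k\<^sup>-\<^sup>\<alpha>\<close> in case (i), which is bounded for \<open>\<alpha> > 1\<close>, and
  \<open>\<Sum>k\<^sup>q\<^sup>-\<^sup>1\<close> over \<open>k \<le> y\<close>, which is \<open>O(y\<^sup>q)\<close>, for \<open>g\<^sub>1\<close> in case (ii).  So all normalized traces agree.
  
  \<^emph>\<open>Which traces exist.\<close>  An operator \<open>T\<close> of the ideal is, for every \<open>n\<close>, a sum of some \<open>F\<^sub>n\<close> of rank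
  \<open>O(n)\<close> and an operator of norm \<open>O(g(n))\<close>.  Two choices of \<open>F\<^sub>n\<close> differ by an operator of rank
  \<open>O(n)\<close> and norm \<open>O(g(n))\<close>, so the sequence of the traces of the \<open>F\<^sub>n\<close> is well defined modulo
  \<open>O(n g(n))\<close>; it is linear in \<open>T\<close>, and it vanishes on commutators, because the trace of finite rank
  operators does.  Every linear functional on sequences that kills \<open>O(n g(n))\<close> therefore gives a trace
  (\<open>normalized_trace_exists\<close>).  On a diagonal operator the sequence consists of the partial sums of
  the entries.  The partial sums of \<open>g\<close> grow like \<open>(log n)\<^sup>q\<^sup>+\<^sup>1\<close>, those of \<open>c p\<^sup>-\<^sup>q g(j) - a\<^sub>j\<close> like
  \<open>(log n)\<^sup>q log log n\<close>, and \<open>n g(n)\<close> like \<open>(log n)\<^sup>q\<close>; so they are independent modulo \<open>O(n g(n))\<close>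
  (\<open>log_sums_independent\<close>), and the value of a \<open>g\<close>-normalized trace on \<open>A\<^sup>-\<^sup>p\<close> can be prescribed
  arbitrarily.
\<close>

section \<open>Complex inner products and bounded operators\<close>

subclass (in complex_hilbert) banach ..

lemma cinner_add_right: "cinner x (y + z) = cinner x y + cinner x (z::'a::complex_hilbert)"
  by (metis cinner_commute cinner_add_left complex_cnj_add)

lemma cinner_scaleC_right: "cinner x (c *\<^sub>C y) = cnj c * cinner x (y::'a::complex_hilbert)"
  by (metis cinner_commute cinner_scaleC_left complex_cnj_mult)

lemma cinner_zero_left [simp]: "cinner 0 (y::'a::complex_hilbert) = 0"
  using cinner_add_left[of 0 0 y] by simp

lemma cinner_zero_right [simp]: "cinner (y::'a::complex_hilbert) 0 = 0"
  using cinner_add_right[of y 0 0] by simp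

lemma cinner_minus_left: "cinner (- x) (y::'a::complex_hilbert) = - cinner x y"
  using cinner_add_left[of x "-x" y] by (simp add: eq_neg_iff_add_eq_0 add.commute)

lemma cinner_minus_right: "cinner x (- y::'a::complex_hilbert) = - cinner x y"
  using cinner_add_right[of x y "-y"] by (simp add: eq_neg_iff_add_eq_0 add.commute)

lemma cinner_diff_left: "cinner (x - y) (z::'a::complex_hilbert) = cinner x z - cinner y z"
  using cinner_add_left[of x "-y" z] by (simp add: cinner_minus_left)

lemma cinner_diff_right: "cinner x (y - z::'a::complex_hilbert) = cinner x y - cinner x z"
  using cinner_add_right[of x y "-z"] by (simp add: cinner_minus_right)

lemma cinner_scaleR_left: "cinner (r *\<^sub>R x) (y::'a::complex_hilbert) = of_real r * cinner x y"
  by (metis cinner_scaleC_left scaleC_of_real)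

lemma cinner_scaleR_right: "cinner x (r *\<^sub>R y::'a::complex_hilbert) = of_real r * cinner x y"
  by (metis cinner_scaleC_right scaleC_of_real complex_cnj_complex_of_real)

lemma cinner_sum_left: "cinner (sum f I) (y::'a::complex_hilbert) = (\<Sum>i\<in>I. cinner (f i) y)"
  by (induction I rule: infinite_finite_induct) (auto simp: cinner_add_left)

lemma cinner_sum_right: "cinner (y::'a::complex_hilbert) (sum f I) = (\<Sum>i\<in>I. cinner y (f i))"
  by (induction I rule: infinite_finite_induct) (auto simp: cinner_add_right)

lemma cinner_self: "cinner x (x::'a::complex_hilbert) = of_real ((norm x)\<^sup>2)"
proof (rule complex_eqI)
  show "Re (cinner x x) = Re (of_real ((norm x)\<^sup>2))"
    by (simp add: Re_cinner power2_norm_eq_inner)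
  have "cinner x x = cnj (cinner x x)"
    by (rule cinner_commute)
  then show "Im (cinner x x) = Im (of_real ((norm x)\<^sup>2))"
    by (simp add: complex_eq_iff)
qed

lemma Im_cinner: "Im (cinner x (y::'a::complex_hilbert)) = inner x (\<i> *\<^sub>C y)"
  by (simp flip: Re_cinner add: cinner_scaleC_right)

lemma norm_scaleC: "norm (c *\<^sub>C (x::'a::complex_hilbert)) = cmod c * norm x"
proof -
  have "complex_of_real ((norm (c *\<^sub>C x))\<^sup>2) = of_real ((cmod c * norm x)\<^sup>2)"
    unfolding cinner_self[symmetric] power_mult_distrib of_real_mult complex_norm_square
    by (simp add: cinner_scaleC_left cinner_scaleC_right mult_ac)
  then have "(norm (c *\<^sub>C x))\<^sup>2 = (cmod c * norm x)\<^sup>2"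
    using of_real_eq_iff by blast
  then show ?thesis
    by (simp add: power2_eq_iff_nonneg)
qed

lemma cinner_normalized:
  assumes "x \<noteq> (0::'a::complex_hilbert)"
  shows "cinner (inverse (norm x) *\<^sub>R x) (inverse (norm x) *\<^sub>R x) = 1"
  using assms by (simp add: cinner_scaleR_left cinner_scaleR_right cinner_self power2_eq_square field_simps)

lemma norm_cinner: "cmod (cinner x (y::'a::complex_hilbert)) \<le> norm x * norm y"
proof -
  define c where "c = cnj (sgn (cinner x y))"
  have "c * cinner x y = of_real (cmod (cinner x y))"
  proof -
    have "c * cinner x y = cinner x y * cnj (cinner x y) / of_real (cmod (cinner x y))"
      by (simp add: c_def sgn_eq)
    also have "\<dots> = of_real ((cmod (cinner x y))\<^sup>2) / of_real (cmod (cinner x y))"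
      by (simp only: complex_norm_square)
    also have "\<dots> = of_real (cmod (cinner x y))"
      by (simp add: power2_eq_square)
    finally show ?thesis .
  qed
  then have "cmod (cinner x y) = Re (c * cinner x y)" by simp
  also have "\<dots> = inner (c *\<^sub>C x) y"
    by (simp flip: Re_cinner add: cinner_scaleC_left)
  also have "\<dots> \<le> norm (c *\<^sub>C x) * norm y"
    by (rule norm_cauchy_schwarz)
  also have "norm (c *\<^sub>C x) \<le> norm x"
    by (simp add: norm_scaleC c_def norm_sgn)
  finally show ?thesis
    by (simp add: mult_right_mono)
qed

lemma bounded_linear_cinner_left: "bounded_linear (\<lambda>x. cinner x (y::'a::complex_hilbert))"
  by (rule bounded_linear_intro[where K = "norm y"])
    (auto simp: cinner_add_left cinner_scaleR_left norm_cinner scaleR_conv_of_real)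

lemma bounded_linear_cinner_right: "bounded_linear (\<lambda>x. cinner (y::'a::complex_hilbert) x)"
  by (rule bounded_linear_intro[where K = "norm y"])
    (auto simp: cinner_add_right cinner_scaleR_right scaleR_conv_of_real
      intro: order.trans[OF norm_cinner] simp: mult.commute)

lemma bounded_linear_scaleC_right: "bounded_linear (\<lambda>x. c *\<^sub>C (x::'a::complex_hilbert))"
  by (rule bounded_linear_intro[where K = "cmod c"])
    (simp_all add: scaleC_add_right norm_scaleC mult.commute,
      metis scaleC_scaleC scaleC_of_real mult.commute)

lemma bounded_linear_scaleC_left: "bounded_linear (\<lambda>c. c *\<^sub>C (x::'a::complex_hilbert))"
  by (rule bounded_linear_intro[where K = "norm x"])
    (simp_all add: scaleC_add_left norm_scaleC,
      metis scaleC_scaleC scaleC_of_real scaleR_conv_of_real)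

lemma bounded_clinearI:
  fixes T :: "'a::complex_hilbert \<Rightarrow> 'a"
  assumes "\<And>x y. T (x + y) = T x + T y" "\<And>c x. T (c *\<^sub>C x) = c *\<^sub>C T x"
    "\<And>x. norm (T x) \<le> K * norm x"
  shows "bounded_clinear T"
  unfolding bounded_clinear_def
  using assms
  by (auto intro!: bounded_linear_intro[where K = K] simp: mult.commute simp flip: scaleC_of_real)

lemma bounded_clinear_bounded_linear: "bounded_clinear T \<Longrightarrow> bounded_linear T"
  by (simp add: bounded_clinear_def)

lemma bounded_clinear_scaleC: "bounded_clinear T \<Longrightarrow> T (c *\<^sub>C x) = c *\<^sub>C T x"
  by (simp add: bounded_clinear_def)

lemma bounded_clinear_comp:
  "bounded_clinear S \<Longrightarrow> bounded_clinear T \<Longrightarrow> bounded_clinear (\<lambda>x. S (T x))"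
  by (auto simp: bounded_clinear_def intro: bounded_linear_compose)

lemma bounded_clinear_scale:
  "bounded_clinear T \<Longrightarrow> bounded_clinear (\<lambda>x. c *\<^sub>C T x)"
  by (auto simp: bounded_clinear_def scaleC_scaleC mult.commute
      intro: bounded_linear_compose[OF bounded_linear_scaleC_right])

lemma bounded_clinear_diff:
  "bounded_clinear S \<Longrightarrow> bounded_clinear T \<Longrightarrow> bounded_clinear (\<lambda>x. S x - T x)"
  by (auto simp: bounded_clinear_def complex_vector.scale_right_diff_distrib intro: bounded_linear_sub)

lemma bounded_clinear_linear: "bounded_clinear T \<Longrightarrow> linear T"
  by (simp add: bounded_clinear_def bounded_linear.linear)

lemma clinear_sum:
  assumes "bounded_clinear T"
  shows "T (\<Sum>i\<in>I. c i *\<^sub>C u i) = (\<Sum>i\<in>I. c i *\<^sub>C T (u i))"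
  using assms linear_sum[of T "\<lambda>i. c i *\<^sub>C u i" I] bounded_linear.linear[of T]
  by (simp add: bounded_clinear_def)

abbreviation csubspace :: "'a::complex_hilbert set \<Rightarrow> bool" where
  "csubspace \<equiv> complex_vector.subspace"

abbreviation cspan :: "'a::complex_hilbert set \<Rightarrow> 'a set" where
  "cspan \<equiv> complex_vector.span"

abbreviation cdim :: "'a::complex_hilbert set \<Rightarrow> nat" where
  "cdim \<equiv> complex_vector.dim"

lemma cdim_zero: "cdim {0::'a::complex_hilbert} = 0"
  using complex_vector.dim_eq_card[of "{}" "{0::'a}"] complex_vector.independent_empty by simp

lemma csubspace_subspace: "csubspace M \<Longrightarrow> subspace M"
  unfolding complex_vector.subspace_def real_vector.subspace_def
  by (auto simp flip: scaleC_of_real)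

section \<open>Projections and the Riesz representation\<close>

text \<open>
  The representing vector minimises \<open>\<parallel>x\<parallel>\<^sup>2 - 2 f x\<close> over \<open>M\<close>.  A minimising sequence is Cauchy by the
  parallelogram law, and the vanishing first variation at the minimiser is the claim.  The case
  \<open>M = UNIV\<close> is the Riesz representation; the functional \<open>f y = inner y x\<close> gives the orthogonal
  projection of \<open>x\<close> to \<open>M\<close>.
\<close>

lemma riesz_on_subspace:
  fixes M :: "'a::complex_hilbert set"
  assumes M: "subspace M" "closed M" and f: "bounded_linear (f :: 'a \<Rightarrow> real)"
  shows "\<exists>z\<in>M. \<forall>x\<in>M. inner x z = f x"
proof -
  interpret f: bounded_linear f by (fact f)
  obtain K where K: "\<And>x. norm (f x) \<le> norm x * K" "K > 0"
    using f.pos_bounded by blast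
  define J where "J x = (norm x)\<^sup>2 - 2 * f x" for x
  have J_ge: "J x \<ge> - K\<^sup>2" for x
  proof -
    have "(norm x)\<^sup>2 - 2 * (norm x * K) \<le> J x"
      using K(1)[of x] by (auto simp: J_def)
    moreover have "(norm x - K)\<^sup>2 \<ge> 0" by simp
    ultimately show ?thesis by (simp add: power2_diff)
  qed
  define d where "d = Inf (J ` M)"
  have bdd: "bdd_below (J ` M)"
    using J_ge by (intro bdd_belowI2)
  have M0: "0 \<in> M" using M(1) by (simp add: subspace_0)
  have d_le: "d \<le> J x" if "x \<in> M" for x
    unfolding d_def using that bdd by (simp add: cInf_lower)
  have "\<exists>x\<in>M. J x < d + e" if "e > 0" for e
  proof -
    have "Inf (J ` M) < d + e" using that by (simp add: d_def)
    then show ?thesis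
      using M0 by (subst (asm) cInf_less_iff) (auto simp: bdd)
  qed
  then have "\<exists>x. x \<in> M \<and> J x < d + inverse (real (Suc n))" for n
    by (metis inverse_positive_iff_positive of_nat_0_less_iff zero_less_Suc)
  then obtain X where X: "X n \<in> M" "J (X n) < d + inverse (real (Suc n))" for n
    by metis
  have key: "(norm (x - y))\<^sup>2 \<le> 2 * (J x - d) + 2 * (J y - d)" if "x \<in> M" "y \<in> M" for x y
  proof -
    have "(1/2) *\<^sub>R (x + y) \<in> M"
      using that M(1) by (simp add: subspace_add subspace_scale)
    moreover have "(norm ((1/2) *\<^sub>R (x + y)))\<^sup>2 = (norm (x + y))\<^sup>2 / 4"
      by (simp add: power_mult_distrib power_divide del: scaleR_right_distrib)
    ultimately have "d \<le> (norm (x + y))\<^sup>2 / 4 - f x - f y"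
      using d_le[of "(1/2) *\<^sub>R (x + y)"] unfolding J_def f.scaleR f.add
      by (simp add: power_divide add_divide_distrib)
    moreover have "(norm (x - y))\<^sup>2 = 2 * (norm x)\<^sup>2 + 2 * (norm y)\<^sup>2 - (norm (x + y))\<^sup>2"
      by (simp add: power2_norm_eq_inner inner_diff_left inner_diff_right inner_add_left
          inner_add_right inner_commute)
    ultimately show ?thesis by (simp add: J_def)
  qed
  have "Cauchy X"
  proof (rule metric_CauchyI)
    fix e :: real assume e: "e > 0"
    then obtain N where N: "inverse (real (Suc N)) < e\<^sup>2 / 4"
      using reals_Archimedean[of "e\<^sup>2/4"] by auto
    have "dist (X m) (X n) < e" if "m \<ge> N" "n \<ge> N" for m n
    proof -
      have "J (X k) - d < e\<^sup>2 / 4" if "k \<ge> N" for k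
      proof -
        have "inverse (real (Suc k)) \<le> inverse (real (Suc N))" using that by simp
        then show ?thesis using X(2)[of k] N by linarith
      qed
      moreover have quarters: "a < c / 4 \<Longrightarrow> b < c / 4 \<Longrightarrow> s \<le> 2 * a + 2 * b \<Longrightarrow> s < c" for a b c s :: real
        by simp
      ultimately have "(norm (X m - X n))\<^sup>2 < e\<^sup>2"
        using key[OF X(1)[of m] X(1)[of n]]
        that by meson
      then show ?thesis
        using e by (simp add: dist_norm power_less_imp_less_base)
    qed
    then show "\<exists>N. \<forall>m\<ge>N. \<forall>n\<ge>N. dist (X m) (X n) < e" by blast
  qed
  then obtain z where z: "X \<longlonglongrightarrow> z"
    using Cauchy_convergent_iff convergent_def by blast
  have zM: "z \<in> M"
    using M(2) z X(1) closed_sequentially by blast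
  have "(\<lambda>n. J (X n)) \<longlonglongrightarrow> J z"
    unfolding J_def by (intro tendsto_intros f.tendsto z)
  moreover have "(\<lambda>n. d + inverse (real (Suc n))) \<longlonglongrightarrow> d + 0"
    by (intro tendsto_intros LIMSEQ_inverse_real_of_nat)
  ultimately have Jz: "J z \<le> d"
    using X(2) by (intro LIMSEQ_le[where X = "\<lambda>n. J (X n)"]) (auto intro: less_imp_le)
  have "inner x z = f x" if x: "x \<in> M" for x
  proof -
    have q: "2 * t * (inner x z - f x) + t\<^sup>2 * (norm x)\<^sup>2 \<ge> 0" for t
    proof -
      have "z + t *\<^sub>R x \<in> M"
        using zM x M(1) by (simp add: subspace_add subspace_scale)
      from d_le[OF this] Jz have "J z \<le> J (z + t *\<^sub>R x)" by simp
      moreover have "(norm (z + t *\<^sub>R x))\<^sup>2 = (norm z)\<^sup>2 + 2 * t * inner x z + t\<^sup>2 * (norm x)\<^sup>2"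
        unfolding power2_norm_eq_inner
        by (simp add: inner_add_left inner_add_right inner_commute[of z x] power2_eq_square algebra_simps)
      ultimately show ?thesis
        by (simp add: J_def f.add f.scaleR algebra_simps)
    qed
    show ?thesis
    proof (rule ccontr)
      assume "inner x z \<noteq> f x"
      define a where "a = inner x z - f x"
      have a: "a \<noteq> 0" using \<open>inner x z \<noteq> f x\<close> by (simp add: a_def)
      \<comment> \<open>a step against the sign of the first variation, so short that the quadratic term cannot
          compensate the linear one\<close>
      define s where "s = inverse ((norm x)\<^sup>2 + 1)"
      have s: "s > 0" "s * (norm x)\<^sup>2 < 1"
        by (auto simp: s_def field_simps add_pos_nonneg)
      have "0 \<le> 2 * (- a * s) * a + (- a * s)\<^sup>2 * (norm x)\<^sup>2"
        using q[of "- a * s"] by (simp add: a_def)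
      also have "\<dots> = a\<^sup>2 * s * (s * (norm x)\<^sup>2 - 2)"
        by (simp add: power2_eq_square algebra_simps)
      also have "\<dots> < 0"
        using a s by (intro mult_pos_neg) auto
      finally show False by simp
    qed
  qed
  then show ?thesis using zM by blast
qed

lemma orthogonal_projection_exists:
  fixes M :: "'a::complex_hilbert set"
  assumes M: "csubspace M" "closed M"
  shows "\<exists>z\<in>M. \<forall>y\<in>M. cinner (x - z) y = 0"
proof -
  have "bounded_linear (\<lambda>y. inner y x)" by (rule bounded_linear_inner_left)
  from riesz_on_subspace[OF csubspace_subspace[OF M(1)] M(2) this]
  obtain z where z: "z \<in> M" "\<And>y. y \<in> M \<Longrightarrow> inner y z = inner y x" by blast
  have "cinner (x - z) y = 0" if "y \<in> M" for y
  proof -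
    have "\<i> *\<^sub>C y \<in> M" using M(1) that by (simp add: complex_vector.subspace_scale)
    then show ?thesis
      using z(2)[OF that] z(2)[of "\<i> *\<^sub>C y"]
      by (simp add: complex_eq_iff Re_cinner Im_cinner inner_diff_left inner_commute[of _ z] inner_commute[of _ x])
  qed
  with z(1) show ?thesis by blast
qed

lemma riesz_representation:
  fixes f :: "'a::complex_hilbert \<Rightarrow> complex"
  assumes f: "bounded_linear f" "\<And>c x. f (c *\<^sub>C x) = c * f x"
  shows "\<exists>z. \<forall>x. f x = cinner x z"
proof -
  have "bounded_linear (\<lambda>x. Re (f x))"
    by (rule bounded_linear_compose[OF bounded_linear_Re f(1)])
  from riesz_on_subspace[OF subspace_UNIV closed_UNIV this]
  obtain z where z: "\<And>x. inner x z = Re (f x)" by auto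
  have "f x = cinner x z" for x
  proof (rule complex_eqI)
    show "Re (f x) = Re (cinner x z)" by (simp add: z Re_cinner)
    have "Im (cinner x z) = - Re (cinner (\<i> *\<^sub>C x) z)"
      by (simp add: cinner_scaleC_left)
    also have "\<dots> = Im (f x)" by (simp add: Re_cinner z f(2))
    finally show "Im (f x) = Im (cinner x z)" by simp
  qed
  then show ?thesis by blast
qed

lemma csubspace_closure:
  assumes "csubspace (V :: 'a::complex_hilbert set)"
  shows "csubspace (closure V)"
proof (rule complex_vector.subspaceI)
  show "0 \<in> closure V"
    using assms closure_subset complex_vector.subspace_0 by blast
next
  fix x y assume "x \<in> closure V" "y \<in> closure V"
  then obtain X Y where "\<And>n. X n \<in> V" "X \<longlonglongrightarrow> x" "\<And>n. Y n \<in> V" "Y \<longlonglongrightarrow> y"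
    unfolding closure_sequential by blast
  then show "x + y \<in> closure V"
    unfolding closure_sequential using assms
    by (intro exI[of _ "\<lambda>n. X n + Y n"]) (auto intro: tendsto_add complex_vector.subspace_add)
next
  fix c x assume "x \<in> closure V"
  then obtain X where "\<And>n. X n \<in> V" "X \<longlonglongrightarrow> x"
    unfolding closure_sequential by blast
  then show "c *\<^sub>C x \<in> closure V"
    unfolding closure_sequential using assms
    by (intro exI[of _ "\<lambda>n. c *\<^sub>C X n"])
      (auto intro: bounded_linear.tendsto[OF bounded_linear_scaleC_right] complex_vector.subspace_scale)
qed

lemma dense_if_orthogonal_trivial:
  assumes "csubspace (V :: 'a::complex_hilbert set)" "\<And>x. (\<forall>y\<in>V. cinner x y = 0) \<Longrightarrow> x = 0"
  shows "closure V = UNIV"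
proof -
  have "x \<in> closure V" for x
  proof -
    obtain z where z: "z \<in> closure V" "\<forall>y\<in>closure V. cinner (x - z) y = 0"
      using orthogonal_projection_exists[OF csubspace_closure[OF assms(1)], of x] by auto
    have "x - z = 0"
      by (rule assms(2)) (use z(2) closure_subset in blast)
    with z(1) show ?thesis by simp
  qed
  then show ?thesis by blast
qed

lemma closed_orthogonal: "closed {y. cinner x (y::'a::complex_hilbert) = 0}"
  by (intro closed_Collect_eq continuous_intros linear_continuous_on bounded_linear_cinner_right)

lemma orthogonal_dense_zero:
  assumes "closure V = UNIV" "\<And>y. y \<in> V \<Longrightarrow> cinner x (y::'a::complex_hilbert) = 0"
  shows "x = 0"
proof -
  have "closure V \<subseteq> {y. cinner x y = 0}"
    by (rule closure_minimal) (auto simp: assms closed_orthogonal)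
  then have "cinner x x = 0" using assms(1) by blast
  then show ?thesis by (simp add: cinner_self)
qed

lemma csubspace_orthogonal: "csubspace {y::'a::complex_hilbert. \<forall>x\<in>S. cinner y x = 0}"
  by (rule complex_vector.subspaceI) (auto simp: cinner_add_left cinner_scaleC_left)

lemma closed_orthogonal_complement: "closed {y::'a::complex_hilbert. \<forall>x\<in>S. cinner y x = 0}"
proof -
  have "{y::'a. \<forall>x\<in>S. cinner y x = 0} = (\<Inter>x\<in>S. {y. cinner y x = 0})" by auto
  moreover have "closed {y::'a. cinner y x = 0}" for x
    by (intro closed_Collect_eq continuous_intros linear_continuous_on bounded_linear_cinner_left)
  ultimately show ?thesis by auto
qed

lemma orthogonal_span:
  assumes "\<And>x. x \<in> S \<Longrightarrow> cinner (y::'a::complex_hilbert) x = 0" "x \<in> cspan S"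
  shows "cinner y x = 0"
  using assms(2)
proof (induction rule: complex_vector.span_induct_alt)
  case base show ?case by simp
next
  case (step c x z)
  then show ?case using assms(1) by (simp add: cinner_add_right cinner_scaleC_right)
qed

section \<open>Orthonormal families\<close>

definition orthonormal_on :: "'i set \<Rightarrow> ('i \<Rightarrow> 'a::complex_hilbert) \<Rightarrow> bool" where
  "orthonormal_on I u \<longleftrightarrow> (\<forall>i\<in>I. \<forall>j\<in>I. cinner (u i) (u j) = (if i = j then 1 else 0))"

lemma orthonormal_onD:
  "orthonormal_on I u \<Longrightarrow> i \<in> I \<Longrightarrow> j \<in> I \<Longrightarrow> cinner (u i) (u j) = (if i = j then 1 else 0)"
  by (simp add: orthonormal_on_def)

lemma orthonormal_on_subset: "orthonormal_on I u \<Longrightarrow> J \<subseteq> I \<Longrightarrow> orthonormal_on J u"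
  unfolding orthonormal_on_def by blast

lemma orthonormal_on_norm:
  assumes "orthonormal_on I u" "i \<in> I" shows "norm (u i) = 1"
proof -
  have "complex_of_real ((norm (u i))\<^sup>2) = of_real 1"
    using orthonormal_onD[OF assms(1) assms(2) assms(2)] by (simp add: cinner_self)
  then have "(norm (u i))\<^sup>2 = 1" using of_real_eq_iff by blast
  then show ?thesis by (simp add: power2_eq_1_iff) (smt (verit) norm_ge_zero)
qed

lemma cinner_orthonormal_sum:
  assumes "orthonormal_on I u" "finite J" "J \<subseteq> I" "k \<in> I"
  shows "cinner (\<Sum>j\<in>J. c j *\<^sub>C u j) (u k) = (if k \<in> J then c k else 0)"
proof -
  have "cinner (\<Sum>j\<in>J. c j *\<^sub>C u j) (u k) = (\<Sum>j\<in>J. if j = k then c k else 0)"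
    unfolding cinner_sum_left
    using assms by (intro sum.cong refl) (auto simp: cinner_scaleC_left orthonormal_onD)
  also have "\<dots> = (if k \<in> J then c k else 0)"
    using assms(2) by (simp add: sum.delta)
  finally show ?thesis .
qed

lemma norm_orthonormal_sum:
  assumes "orthonormal_on I u" "finite J" "J \<subseteq> I"
  shows "(norm (\<Sum>j\<in>J. c j *\<^sub>C u j))\<^sup>2 = (\<Sum>j\<in>J. (cmod (c j))\<^sup>2)"
proof -
  have "complex_of_real ((norm (\<Sum>j\<in>J. c j *\<^sub>C u j))\<^sup>2) =
      (\<Sum>k\<in>J. cnj (c k) * cinner (\<Sum>j\<in>J. c j *\<^sub>C u j) (u k))"
    unfolding cinner_self[symmetric]
    by (simp only: cinner_sum_right cinner_scaleC_right)
  also have "\<dots> = (\<Sum>k\<in>J. cnj (c k) * c k)"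
    using assms by (intro sum.cong refl) (subst cinner_orthonormal_sum[OF assms]; auto)
  also have "\<dots> = of_real (\<Sum>k\<in>J. (cmod (c k))\<^sup>2)"
    by (simp add: complex_norm_square mult.commute del: of_real_power)
  finally show ?thesis using of_real_eq_iff by blast
qed

lemma bessel_inequality:
  assumes "orthonormal_on I u" "finite J" "J \<subseteq> I"
  shows "(\<Sum>j\<in>J. (cmod (cinner x (u j)))\<^sup>2) \<le> (norm x)\<^sup>2"
proof -
  define y where "y = (\<Sum>j\<in>J. cinner x (u j) *\<^sub>C u j)"
  have ny: "(norm y)\<^sup>2 = (\<Sum>j\<in>J. (cmod (cinner x (u j)))\<^sup>2)"
    unfolding y_def by (rule norm_orthonormal_sum[OF assms])
  have "cinner x y = (\<Sum>j\<in>J. cnj (cinner x (u j)) * cinner x (u j))"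
    unfolding y_def by (simp add: cinner_sum_right cinner_scaleC_right)
  also have "\<dots> = of_real ((norm y)\<^sup>2)"
    unfolding ny by (simp add: complex_norm_square mult.commute del: of_real_power)
  finally have "inner x y = (norm y)\<^sup>2" by (metis Re_cinner Re_complex_of_real)
  then have "(norm (x - y))\<^sup>2 = (norm x)\<^sup>2 - (norm y)\<^sup>2"
    by (simp add: power2_norm_eq_inner inner_diff_left inner_diff_right inner_commute)
  then show ?thesis using ny by (smt (verit) zero_le_power2)
qed

lemma orthonormal_on_independent:
  assumes "orthonormal_on B (\<lambda>x. x)"
  shows "complex_vector.independent B"
  unfolding complex_vector.independent_explicit_module
proof safe
  fix t u v assume t: "finite t" "t \<subseteq> B" "(\<Sum>w\<in>t. u w *\<^sub>C w) = 0" "v \<in> t"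
  have "cinner (\<Sum>w\<in>t. u w *\<^sub>C w) v = u v"
    using cinner_orthonormal_sum[OF assms t(1,2), of v u] t by auto
  then show "u v = 0" using t by simp
qed

text \<open>
  Gram--Schmidt.  The bound on the cardinality makes it possible to estimate the trace of a finite
  rank operator by its rank.
\<close>

lemma orthonormal_finite_basis:
  fixes U :: "'a::complex_hilbert set"
  assumes "finite U"
  shows "\<exists>B. finite B \<and> card B \<le> card U \<and> orthonormal_on B (\<lambda>x. x) \<and>
     cspan B = cspan U"
  using assms
proof (induction U)
  case empty
  then show ?case by (intro exI[of _ "{}"]) (simp add: orthonormal_on_def)
next
  case (insert v U)
  then obtain B where B: "finite B" "card B \<le> card U" "orthonormal_on B (\<lambda>x. x)"
    "cspan B = cspan U" by blast
  define s where "s = (\<Sum>b\<in>B. cinner v b *\<^sub>C b)"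
  define w where "w = v - s"
  have s: "s \<in> cspan B"
    unfolding s_def by (intro complex_vector.span_sum complex_vector.span_scale complex_vector.span_base)
  have span: "cspan (insert w B) = cspan (insert v U)"
  proof -
    have "cspan (insert w B) = cspan (insert v B)"
      using complex_vector.eq_span_insert_eq[of w v B] s
      by (simp add: w_def complex_vector.span_neg)
    then show ?thesis using B(4) by (simp add: complex_vector.span_insert)
  qed
  have wB: "cinner w b = 0" if "b \<in> B" for b
    using cinner_orthonormal_sum[OF B(3) B(1), of b "cinner v"] that
    by (simp add: w_def s_def cinner_diff_left)
  show ?case
  proof (cases "w = 0")
    case True
    then have "cspan B = cspan (insert v U)"
      using span by simp
    then show ?thesis using B insert by (intro exI[of _ B]) auto
  next
    case False
    define z where "z = inverse (norm w) *\<^sub>R w"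
    have zz: "cinner z z = 1"
      unfolding z_def by (rule cinner_normalized[OF False])
    have zB: "cinner z b = 0" "cinner b z = 0" if "b \<in> B" for b
      using wB[OF that] by (auto simp: z_def cinner_scaleR_left cinner_scaleR_right
          intro: trans[OF cinner_commute])
    have "cspan (insert z B) = cspan (insert w B)"
    proof -
      have "z = of_real (inverse (norm w)) *\<^sub>C w" "w = of_real (norm w) *\<^sub>C z"
        using False by (simp_all only: z_def scaleC_of_real) simp
      then have "z \<in> cspan (insert w B)" "w \<in> cspan (insert z B)"
        by (metis complex_vector.span_scale complex_vector.span_base insertI1)+
      then show ?thesis
        by (intro equalityI complex_vector.span_minimal)
          (auto intro: complex_vector.span_base)
    qed
    then show ?thesis
      using B insert span zz zB
      by (intro exI[of _ "insert z B"]) (auto simp: orthonormal_on_def card_insert_if)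
  qed
qed

lemma orthonormal_expansion_finite:
  assumes "finite B" "orthonormal_on B (\<lambda>x. x)" "x \<in> cspan B"
  shows "x = (\<Sum>b\<in>B. cinner x b *\<^sub>C b)"
proof -
  define y where "y = x - (\<Sum>b\<in>B. cinner x b *\<^sub>C b)"
  have "y \<in> cspan B" unfolding y_def
    by (intro complex_vector.span_diff assms complex_vector.span_sum complex_vector.span_scale
        complex_vector.span_base)
  moreover have "cinner y b = 0" if "b \<in> B" for b
    using cinner_orthonormal_sum[OF assms(2,1), of b "cinner x"] that
    by (simp add: y_def cinner_diff_left)
  ultimately have "cinner y y = 0" by (metis orthogonal_span)
  then show ?thesis by (simp add: cinner_self y_def)
qed

lemma summable_orthonormal:
  assumes u: "orthonormal_on UNIV (u :: nat \<Rightarrow> 'a::complex_hilbert)"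
    and c: "summable (\<lambda>j. (cmod (c j))\<^sup>2)"
  shows "summable (\<lambda>j. c j *\<^sub>C u j)"
  unfolding summable_Cauchy
proof (intro allI impI)
  fix e :: real assume e: "e > 0"
  then have "e\<^sup>2 > 0" by simp
  then obtain N where N: "\<And>m n. m \<ge> N \<Longrightarrow> norm (\<Sum>j=m..<n. (cmod (c j))\<^sup>2) < e\<^sup>2"
    using c unfolding summable_Cauchy by blast
  have "norm (\<Sum>j=m..<n. c j *\<^sub>C u j) < e" if "m \<ge> N" for m n
  proof -
    have "(norm (\<Sum>j=m..<n. c j *\<^sub>C u j))\<^sup>2 < e\<^sup>2"
      using N[OF that, of n] norm_orthonormal_sum[OF u, of "{m..<n}" c] by auto
    then show ?thesis using e by (simp add: power_less_imp_less_base)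
  qed
  then show "\<exists>N. \<forall>m\<ge>N. \<forall>n. norm (\<Sum>j=m..<n. c j *\<^sub>C u j) < e" by blast
qed

lemma summable_bessel:
  assumes "orthonormal_on UNIV (u :: nat \<Rightarrow> 'a::complex_hilbert)"
  shows "summable (\<lambda>j. (cmod (cinner x (u j)))\<^sup>2)"
    "(\<Sum>j. (cmod (cinner x (u j)))\<^sup>2) \<le> (norm x)\<^sup>2"
proof -
  have b: "(\<Sum>j<n. (cmod (cinner x (u j)))\<^sup>2) \<le> (norm x)\<^sup>2" for n
    by (rule bessel_inequality[OF assms]) auto
  show 1: "summable (\<lambda>j. (cmod (cinner x (u j)))\<^sup>2)"
    by (rule summableI_nonneg_bounded[OF _ b]) auto
  show "(\<Sum>j. (cmod (cinner x (u j)))\<^sup>2) \<le> (norm x)\<^sup>2"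
    by (rule suminf_le_const[OF 1 b])
qed

section \<open>Diagonal operators between orthonormal sequences\<close>

text \<open>
  All operators to which traces are applied have this form.  For \<open>u = v\<close> it is a diagonal operator,
  for \<open>a = 1\<close> the partial isometry that carries \<open>u\<close> to \<open>v\<close>.
\<close>

definition diag_op :: "(nat \<Rightarrow> complex) \<Rightarrow> (nat \<Rightarrow> 'a::complex_hilbert) \<Rightarrow> (nat \<Rightarrow> 'a) \<Rightarrow> 'a \<Rightarrow> 'a" where
  "diag_op a u v x = (\<Sum>j. (a j * cinner x (u j)) *\<^sub>C v j)"

context
  fixes a :: "nat \<Rightarrow> complex" and u v :: "nat \<Rightarrow> 'a::complex_hilbert" and C :: real
  assumes u: "orthonormal_on UNIV u" and v: "orthonormal_on UNIV v" and a: "\<And>j. cmod (a j) \<le> C"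
begin

lemma diag_op_coeff:
  "summable (\<lambda>j. (cmod (a j * cinner x (u j)))\<^sup>2)"
  "(\<Sum>j. (cmod (a j * cinner x (u j)))\<^sup>2) \<le> C\<^sup>2 * (norm x)\<^sup>2"
proof -
  have le: "(cmod (a j * cinner x (u j)))\<^sup>2 \<le> C\<^sup>2 * (cmod (cinner x (u j)))\<^sup>2" for j
    using a[of j] by (auto simp: norm_mult power_mult_distrib intro!: mult_right_mono power_mono)
  have s: "summable (\<lambda>j. C\<^sup>2 * (cmod (cinner x (u j)))\<^sup>2)"
    by (intro summable_mult summable_bessel u)
  show 1: "summable (\<lambda>j. (cmod (a j * cinner x (u j)))\<^sup>2)"
    by (rule summable_comparison_test'[OF s, of 0]) (use le in auto)
  have "(\<Sum>j. (cmod (a j * cinner x (u j)))\<^sup>2) \<le> (\<Sum>j. C\<^sup>2 * (cmod (cinner x (u j)))\<^sup>2)"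
    by (rule suminf_le[OF le 1 s])
  also have "\<dots> = C\<^sup>2 * (\<Sum>j. (cmod (cinner x (u j)))\<^sup>2)"
    by (intro suminf_mult summable_bessel u)
  also have "\<dots> \<le> C\<^sup>2 * (norm x)\<^sup>2"
    by (intro mult_left_mono summable_bessel u) auto
  finally show "(\<Sum>j. (cmod (a j * cinner x (u j)))\<^sup>2) \<le> C\<^sup>2 * (norm x)\<^sup>2" .
qed

lemma diag_op_sums: "(\<lambda>j. (a j * cinner x (u j)) *\<^sub>C v j) sums diag_op a u v x"
  unfolding diag_op_def
  by (intro summable_sums summable_orthonormal[OF v] diag_op_coeff)

lemma cinner_diag_op: "cinner (diag_op a u v x) (v k) = a k * cinner x (u k)"
proof -
  have "(\<lambda>j. cinner ((a j * cinner x (u j)) *\<^sub>C v j) (v k)) sums cinner (diag_op a u v x) (v k)"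
    by (rule bounded_linear.sums[OF bounded_linear_cinner_left diag_op_sums])
  moreover have "(\<lambda>j. cinner ((a j * cinner x (u j)) *\<^sub>C v j) (v k)) =
      (\<lambda>j. if j = k then a k * cinner x (u k) else 0)"
    using v by (auto simp: cinner_scaleC_left orthonormal_on_def)
  ultimately have "(\<lambda>j. if j = k then a k * cinner x (u k) else 0) sums cinner (diag_op a u v x) (v k)"
    by simp
  then show ?thesis
    using sums_single[of k "\<lambda>j. a k * cinner x (u k)"] by (rule sums_unique2)
qed

lemma diag_op_basis: "diag_op a u v (u k) = a k *\<^sub>C v k"
proof -
  have "(\<lambda>j. (a j * cinner (u k) (u j)) *\<^sub>C v j) = (\<lambda>j. if j = k then a k *\<^sub>C v k else 0)"
    using u by (auto simp: orthonormal_on_def)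
  then show ?thesis
    using sums_unique2[OF diag_op_sums[of "u k"]] sums_single[of k "\<lambda>j. a k *\<^sub>C v k"] by simp
qed

lemma diag_op_norm: "norm (diag_op a u v x) \<le> C * norm x"
proof -
  have C: "C \<ge> 0" using a[of 0] by (rule order.trans[OF norm_ge_zero])
  have "(\<lambda>n. norm (\<Sum>j<n. (a j * cinner x (u j)) *\<^sub>C v j)) \<longlonglongrightarrow> norm (diag_op a u v x)"
    using diag_op_sums[of x] unfolding sums_def by (rule tendsto_norm)
  moreover have "norm (\<Sum>j<n. (a j * cinner x (u j)) *\<^sub>C v j) \<le> C * norm x" for n
  proof -
    have "(norm (\<Sum>j<n. (a j * cinner x (u j)) *\<^sub>C v j))\<^sup>2 = (\<Sum>j<n. (cmod (a j * cinner x (u j)))\<^sup>2)"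
      by (rule norm_orthonormal_sum[OF v]) auto
    also have "\<dots> \<le> (\<Sum>j. (cmod (a j * cinner x (u j)))\<^sup>2)"
      by (rule sum_le_suminf[OF diag_op_coeff(1)]) auto
    also have "\<dots> \<le> (C * norm x)\<^sup>2" using diag_op_coeff(2) by (simp add: power_mult_distrib)
    finally show ?thesis
      using C by (meson mult_nonneg_nonneg norm_ge_zero power2_le_imp_le)
  qed
  ultimately show ?thesis by (intro LIMSEQ_le_const2) auto
qed

lemma bounded_clinear_diag_op: "bounded_clinear (diag_op a u v)"
proof (rule bounded_clinearI[where K = C])
  fix x y c
  have "(\<lambda>j. (a j * cinner x (u j)) *\<^sub>C v j + (a j * cinner y (u j)) *\<^sub>C v j) sums
      (diag_op a u v x + diag_op a u v y)"
    by (intro sums_add diag_op_sums)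
  then show "diag_op a u v (x + y) = diag_op a u v x + diag_op a u v y"
    by (intro sums_unique2[OF diag_op_sums[of "x + y"]])
      (simp add: cinner_add_left ring_distribs scaleC_add_left)
  have "(\<lambda>j. c *\<^sub>C ((a j * cinner x (u j)) *\<^sub>C v j)) sums (c *\<^sub>C diag_op a u v x)"
    by (rule bounded_linear.sums[OF bounded_linear_scaleC_right diag_op_sums])
  then show "diag_op a u v (c *\<^sub>C x) = c *\<^sub>C diag_op a u v x"
    by (intro sums_unique2[OF diag_op_sums[of "c *\<^sub>C x"]])
      (simp add: cinner_scaleC_left scaleC_scaleC mult_ac)
qed (rule diag_op_norm)

end

lemma diag_op_comp:
  assumes "orthonormal_on UNIV u" "orthonormal_on UNIV w" "\<And>j. cmod (b j) \<le> C"
  shows "diag_op a u v (diag_op b w u x) = diag_op (\<lambda>j. a j * b j) w v x"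
  unfolding diag_op_def[of a] diag_op_def[of "\<lambda>j. a j * b j"]
  by (subst cinner_diag_op[OF assms(2,1,3)]) (simp add: mult_ac)

lemma orthonormal_basis_orthonormal: "orthonormal_basis \<xi> \<Longrightarrow> orthonormal_on UNIV \<xi>"
  by (simp add: orthonormal_basis_def orthonormal_on_def)

lemma orthonormal_basis_diag_op:
  assumes "orthonormal_basis \<xi>"
  shows "diag_op (\<lambda>_. 1) \<xi> \<xi> x = x"
proof -
  note o = orthonormal_basis_orthonormal[OF assms]
  define y where "y = x - diag_op (\<lambda>_. 1) \<xi> \<xi> x"
  have "cinner y (\<xi> k) = 0" for k
    using cinner_diag_op[OF o o, of "\<lambda>_. 1" 1] by (simp add: y_def cinner_diff_left)
  then have "cinner y z = 0" if "z \<in> cspan (range \<xi>)" for z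
    using that by (intro orthogonal_span[of "range \<xi>" y z]) auto
  then have "y = 0"
    using assms by (intro orthogonal_dense_zero[where x = y]) (auto simp: orthonormal_basis_def)
  then show ?thesis by (simp add: y_def)
qed

lemma orthonormal_basis_sums:
  assumes "orthonormal_basis \<xi>"
  shows "(\<lambda>j. cinner x (\<xi> j) *\<^sub>C \<xi> j) sums x"
proof -
  note o = orthonormal_basis_orthonormal[OF assms]
  show ?thesis
    using diag_op_sums[OF o o, of "\<lambda>_. 1" 1 x] orthonormal_basis_diag_op[OF assms, of x] by simp
qed

text \<open>
  Distinct elements of an orthonormal set have distance \<open>\<surd>2\<close>, so points of a dense set within \<open>1/2\<close>
  of them are distinct as well.
\<close>

lemma orthonormal_set_countable:
  assumes sep: "separable_UNIV TYPE('a::complex_hilbert)"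
    and B: "orthonormal_on (B::'a set) (\<lambda>x. x)"
  shows "countable B"
proof -
  obtain S :: "'a set" where S: "countable S" "closure S = UNIV"
    using sep by (auto simp: separable_UNIV_def)
  have "\<exists>s\<in>S. dist s b < 1/2" for b
    using S(2) closure_approachable[of b S] by (metis UNIV_I half_gt_zero zero_less_one)
  then obtain h where h: "h b \<in> S" "dist (h b) b < 1/2" for b
    by metis
  have "inj_on h B"
  proof (rule inj_onI, rule ccontr)
    fix b b' assume b: "b \<in> B" "b' \<in> B" "h b = h b'" "b \<noteq> b'"
    have "dist b b' < 1"
      using h(2)[of b] h(2)[of b'] b(3) by (metis dist_commute dist_triangle_half_r)
    moreover have "(norm (b - b'))\<^sup>2 = 2"
    proof -
      have "complex_of_real ((norm (b - b'))\<^sup>2) = 2"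
        using b B unfolding cinner_self[symmetric]
        by (simp add: cinner_diff_left cinner_diff_right orthonormal_on_def)
      then show ?thesis by (metis of_real_eq_iff of_real_numeral)
    qed
    ultimately show False
      by (smt (verit) dist_norm norm_ge_zero one_power2 power_mono)
  qed
  then show ?thesis
    using S(1) h(1) by (meson countable_image_inj_on countable_subset image_subsetI)
qed

text \<open>
  A maximal orthonormal set is total.  It is chosen above the range of \<open>e\<close> to make it infinite, so that
  it can be enumerated by all natural numbers.
\<close>

lemma orthonormal_basis_exists:
  assumes sep: "separable_UNIV TYPE('a::complex_hilbert)"
    and e: "orthonormal_on UNIV (e :: nat \<Rightarrow> 'a)"
  shows "\<exists>\<xi> :: nat \<Rightarrow> 'a. orthonormal_basis \<xi>"
proof -
  define \<A> where "\<A> = {B :: 'a set. range e \<subseteq> B \<and> orthonormal_on B (\<lambda>x. x)}"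
  have "range e \<in> \<A>"
  proof -
    have "cinner (e i) (e j) = (if e i = e j then 1 else 0)" for i j
      using orthonormal_onD[OF e, of i j] orthonormal_onD[OF e, of j j] by (cases "i = j") auto
    then show ?thesis by (auto simp: \<A>_def orthonormal_on_def)
  qed
  moreover have "\<Union>\<C> \<in> \<A>" if "\<C> \<noteq> {}" "subset.chain \<A> \<C>" for \<C>
  proof -
    have sub: "\<C> \<subseteq> \<A>" and ch: "\<And>X Y. X \<in> \<C> \<Longrightarrow> Y \<in> \<C> \<Longrightarrow> X \<subseteq> Y \<or> Y \<subseteq> X"
      using that(2) by (auto simp: subset_chain_def)
    have "orthonormal_on (\<Union>\<C>) (\<lambda>x. x)"
      unfolding orthonormal_on_def
    proof (intro ballI)
      fix x y assume "x \<in> \<Union>\<C>" "y \<in> \<Union>\<C>"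
      then obtain Z where Z: "Z \<in> \<C>" "x \<in> Z" "y \<in> Z" using ch by blast
      then have "orthonormal_on Z (\<lambda>x. x)" using sub by (auto simp: \<A>_def)
      then show "cinner x y = (if x = y then 1 else 0)" using Z by (simp add: orthonormal_on_def)
    qed
    then show ?thesis using that(1) sub by (auto simp: \<A>_def)
  qed
  ultimately obtain B where B: "B \<in> \<A>" and max: "\<And>X. X \<in> \<A> \<Longrightarrow> B \<subseteq> X \<Longrightarrow> X = B"
    using subset_Zorn_nonempty[of \<A>] by blast
  have oB: "orthonormal_on B (\<lambda>x. x)" and eB: "range e \<subseteq> B" using B by (auto simp: \<A>_def)
  have "inj e"
  proof (rule injI, rule ccontr)
    fix i j assume "e i = e j" "i \<noteq> j"
    then show False using orthonormal_onD[OF e, of i j] orthonormal_onD[OF e, of j j] by simp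
  qed
  then have "infinite B" using eB by (meson infinite_super range_inj_infinite)
  moreover have "countable B" by (rule orthonormal_set_countable[OF sep oB])
  ultimately have bij: "bij_betw (from_nat_into B) UNIV B"
    using bij_betw_from_nat_into by blast
  have "closure (cspan B) = UNIV"
  proof (rule dense_if_orthogonal_trivial[OF complex_vector.subspace_span], rule ccontr)
    fix x assume x: "\<forall>y\<in>cspan B. cinner x y = 0" "x \<noteq> 0"
    define z where "z = inverse (norm x) *\<^sub>R x"
    have zz: "cinner z z = 1"
      unfolding z_def by (rule cinner_normalized[OF x(2)])
    have zB: "cinner z b = 0" "cinner b z = 0" if "b \<in> B" for b
      using x(1) complex_vector.span_base[OF that]
      by (auto simp: z_def cinner_scaleR_left cinner_scaleR_right intro: trans[OF cinner_commute])
    have "insert z B \<in> \<A>"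
      using eB oB zz zB by (auto simp: \<A>_def orthonormal_on_def)
    then have "z \<in> B" using max by blast
    then show False using zB(1) zz by force
  qed
  moreover have "range (from_nat_into B) = B" using bij by (simp add: bij_betw_def)
  moreover have "cinner (from_nat_into B i) (from_nat_into B j) = (if i = j then 1 else 0)" for i j
  proof -
    have "from_nat_into B k \<in> B" for k using bij by (auto simp: bij_betw_def)
    moreover have "from_nat_into B i = from_nat_into B j \<longleftrightarrow> i = j"
      using bij by (auto simp: bij_betw_def inj_eq)
    ultimately show ?thesis using oB by (simp add: orthonormal_on_def)
  qed
  ultimately have "orthonormal_basis (from_nat_into B)"
    by (simp add: orthonormal_basis_def)
  then show ?thesis by blast
qed

section \<open>Positive symmetric operators\<close>

lemma discriminant_le:
  fixes a b c :: real
  assumes "\<And>t. c + 2 * b * t + a * t\<^sup>2 \<ge> 0" "a \<ge> 0"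
  shows "b\<^sup>2 \<le> a * c"
proof (cases "a = 0")
  case True
  have "b = 0"
  proof (rule ccontr)
    assume "b \<noteq> 0"
    then show False using assms(1)[of "- (c + 1) / (2 * b)"] True by (simp add: field_simps)
  qed
  then show ?thesis using True by simp
next
  case False
  then have "a > 0" using assms(2) by simp
  then show ?thesis using assms(1)[of "- b / a"] by (simp add: field_simps power2_eq_square)
qed

definition positive_on :: "'a::real_inner set \<Rightarrow> ('a \<Rightarrow> 'a) \<Rightarrow> bool" where
  "positive_on M P \<longleftrightarrow> (\<forall>x\<in>M. P x \<in> M) \<and> (\<forall>x\<in>M. \<forall>y\<in>M. inner (P x) y = inner x (P y)) \<and>
     (\<forall>x\<in>M. inner (P x) x \<ge> 0)"

lemma positive_onD: "positive_on M P \<Longrightarrow> x \<in> M \<Longrightarrow> inner (P x) x \<ge> 0"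
  unfolding positive_on_def by blast

lemma positive_form_cauchy_schwarz:
  assumes "subspace M" "linear S" "positive_on M S" "x \<in> M" "y \<in> M"
  shows "(inner (S x) y)\<^sup>2 \<le> inner (S y) y * inner (S x) x"
proof (rule discriminant_le)
  interpret S: linear S by (fact assms(2))
  show "inner (S y) y \<ge> 0" using assms(3,5) unfolding positive_on_def by blast
  fix t
  have "x + t *\<^sub>R y \<in> M" using assms by (simp add: subspace_add subspace_scale)
  then have "inner (S (x + t *\<^sub>R y)) (x + t *\<^sub>R y) \<ge> 0" by (rule positive_onD[OF assms(3)])
  moreover have "inner (S y) x = inner (S x) y"
    using assms by (simp add: positive_on_def inner_commute)
  ultimately show "inner (S x) x + 2 * inner (S x) y * t + inner (S y) y * t\<^sup>2 \<ge> 0"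
    by (simp add: S.add S.scale inner_add_left inner_add_right power2_eq_square algebra_simps)
qed

text \<open>
  The Cauchy--Schwarz inequality of the form \<open>inner (S x) y\<close>, applied to \<open>y = S x\<close>.
\<close>

lemma positive_norm_le_form:
  assumes "subspace M" "linear S" "positive_on M S" "x \<in> M" "\<And>x. norm (S x) \<le> C * norm x"
  shows "(norm (S x))\<^sup>2 \<le> C * inner (S x) x"
proof (cases "S x = 0")
  case False
  have SM: "S x \<in> M" using assms by (simp add: positive_on_def)
  have "inner (S (S x)) (S x) \<le> norm (S (S x)) * norm (S x)" by (rule norm_cauchy_schwarz)
  also have "\<dots> \<le> C * (norm (S x))\<^sup>2"
    using assms(5)[of "S x"] by (simp add: power2_eq_square mult_right_mono flip: mult.assoc)
  finally have 1: "inner (S (S x)) (S x) \<le> C * (norm (S x))\<^sup>2" .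
  have "((norm (S x))\<^sup>2)\<^sup>2 \<le> inner (S (S x)) (S x) * inner (S x) x"
    using positive_form_cauchy_schwarz[OF assms(1-4) SM] by (simp add: power2_norm_eq_inner)
  also have "\<dots> \<le> C * (norm (S x))\<^sup>2 * inner (S x) x"
    using 1 assms(3,4) by (intro mult_right_mono) (auto simp: positive_on_def)
  finally show ?thesis using False by (simp add: power2_eq_square mult_ac)
qed (simp)

text \<open>
  The number \<open>r\<close> is the supremum of the quadratic form over the unit sphere of \<open>M\<close>.  The operator
  \<open>r - P\<close> is positive on \<open>M\<close>, so \<open>positive_norm_le_form\<close> makes it small on every vector whose form is
  close to the supremum.
\<close>

lemma approximate_top_eigenvector:
  fixes P :: "'a::real_inner \<Rightarrow> 'a"
  assumes M: "subspace M" and P: "bounded_linear P" and pos: "positive_on M P" and x0: "x0 \<in> M" "x0 \<noteq> 0"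
  shows "\<exists>r\<ge>0. (\<forall>x\<in>M. inner (P x) x \<le> r * (norm x)\<^sup>2) \<and>
     positive_on M (\<lambda>x. r *\<^sub>R x - P x) \<and>
     (\<forall>e>0. \<exists>x\<in>M. norm x = 1 \<and> norm (r *\<^sub>R x - P x) < e)"
proof -
  interpret P: bounded_linear P by (fact P)
  obtain K where K: "\<And>x. norm (P x) \<le> norm x * K" "K > 0" using P.pos_bounded by blast
  define Q where "Q = {inner (P x) x | x. x \<in> M \<and> norm x = 1}"
  define r where "r = Sup Q"
  have "inner (P x) x \<le> K" if "norm x = 1" for x
    using norm_cauchy_schwarz[of "P x" x] K(1)[of x] that by simp
  then have bdd: "bdd_above Q" by (auto simp: Q_def bdd_above_def)
  define x1 where "x1 = inverse (norm x0) *\<^sub>R x0"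
  have x1: "x1 \<in> M" "norm x1 = 1" using x0 M by (auto simp: x1_def subspace_scale)
  then have ne: "Q \<noteq> {}" by (auto simp: Q_def)
  have r0: "r \<ge> 0"
  proof -
    have "0 \<le> inner (P x1) x1" using pos x1(1) by (rule positive_onD)
    also have "\<dots> \<le> r" unfolding r_def using x1 by (intro cSup_upper bdd) (auto simp: Q_def)
    finally show ?thesis .
  qed
  have le: "inner (P x) x \<le> r * (norm x)\<^sup>2" if "x \<in> M" for x
  proof (cases "x = 0")
    case False
    define y where "y = inverse (norm x) *\<^sub>R x"
    have "y \<in> M" "norm y = 1" using that False M by (auto simp: y_def subspace_scale)
    then have "inner (P y) y \<le> r" unfolding r_def by (intro cSup_upper bdd) (auto simp: Q_def)
    then show ?thesis using False by (simp add: y_def P.scaleR field_simps power2_eq_square)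
  qed (simp add: P.zero)
  define S where "S x = r *\<^sub>R x - P x" for x
  have S: "bounded_linear S" unfolding S_def
    by (intro bounded_linear_sub bounded_linear_scaleR_right P)
  have linS: "linear S" by (rule bounded_linear.linear[OF S])
  have posS: "positive_on M S"
    using pos M le by (auto simp: positive_on_def S_def subspace_diff subspace_scale inner_diff_left
        inner_diff_right power2_norm_eq_inner)
  have bS: "norm (S x) \<le> (r + K) * norm x" for x
  proof -
    have "norm (S x) \<le> norm (r *\<^sub>R x) + norm (P x)" unfolding S_def by (rule norm_triangle_ineq4)
    also have "\<dots> \<le> (r + K) * norm x" using K(1)[of x] r0 by (simp add: algebra_simps)
    finally show ?thesis .
  qed
  have "\<exists>x\<in>M. norm x = 1 \<and> norm (S x) < e" if e: "e > 0" for e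
  proof -
    have "r - e\<^sup>2 / (r + K) < Sup Q" using e r0 K(2) by (simp add: r_def)
    then obtain x where x: "x \<in> M" "norm x = 1" "r - e\<^sup>2 / (r + K) < inner (P x) x"
      using less_cSup_iff[OF ne bdd] by (auto simp: Q_def)
    have "inner (S x) x = r - inner (P x) x"
      using x(2) by (simp add: S_def inner_diff_left flip: power2_norm_eq_inner)
    then have "inner (S x) x < e\<^sup>2 / (r + K)" using x(3) by simp
    then have "(r + K) * inner (S x) x < e\<^sup>2" using r0 K(2) by (simp add: field_simps)
    then have "(norm (S x))\<^sup>2 < e\<^sup>2"
      using positive_norm_le_form[OF M linS posS x(1) bS] by simp
    then show ?thesis using x e by (auto intro!: bexI[of _ x] simp: power_less_imp_less_base)
  qed
  then show ?thesis using r0 le posS unfolding S_def[abs_def] by blast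
qed

section \<open>Selfadjoint operators with discrete spectrum\<close>

locale selfadjoint =
  fixes D :: "'a::complex_hilbert set" and A :: "'a \<Rightarrow> 'a"
  assumes selfadjoint: "selfadjoint_operator D A"
begin

lemma domain: "csubspace D" "closure D = UNIV"
  and A_add: "x \<in> D \<Longrightarrow> y \<in> D \<Longrightarrow> A (x + y) = A x + A y"
  and A_scaleC: "x \<in> D \<Longrightarrow> A (c *\<^sub>C x) = c *\<^sub>C A x"
  using selfadjoint by (auto simp: selfadjoint_operator_def densely_defined_operator_def)

lemma A_scaleR: "x \<in> D \<Longrightarrow> A (r *\<^sub>R x) = r *\<^sub>R A x"
  using A_scaleC[of x "of_real r"] by (simp add: scaleC_of_real)

lemma A_zero: "A 0 = 0"
  using A_scaleR[of 0 0] domain(1) by (simp add: complex_vector.subspace_0)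

lemma symmetric:
  assumes "x \<in> D" "y \<in> D"
  shows "cinner (A x) y = cinner x (A y)"
proof -
  have "y \<in> adjoint_domain D A" "adjoint_op D A y = A y"
    using selfadjoint assms by (auto simp: selfadjoint_operator_def)
  then obtain z where z: "\<forall>x\<in>D. cinner (A x) y = cinner x z" by (auto simp: adjoint_domain_def)
  have "z' = z" if "\<forall>x\<in>D. cinner (A x) y = cinner x z'" for z'
  proof -
    have "cinner (z' - z) x = 0" if "x \<in> D" for x
    proof -
      have "cinner x z' = cinner x z" using z that \<open>\<forall>x\<in>D. cinner (A x) y = cinner x z'\<close> by simp
      then show ?thesis by (metis cinner_commute cinner_diff_left right_minus_eq)
    qed
    then have "z' - z = 0" by (rule orthogonal_dense_zero[OF domain(2)])
    then show ?thesis by simp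
  qed
  then have "adjoint_op D A y = z" unfolding adjoint_op_def using z by (intro the_equality) auto
  then show ?thesis using z assms \<open>adjoint_op D A y = A y\<close> by simp
qed

lemma resolvent:
  assumes "complex_of_real m \<notin> spectrum D A"
  obtains R where "bounded_clinear R" "\<And>x. R x \<in> D" "\<And>x. A (R x) = x + m *\<^sub>R R x"
    "\<And>x. x \<in> D \<Longrightarrow> R (A x - m *\<^sub>R x) = x" "\<And>x y. cinner (R x) y = cinner x (R y)"
proof -
  obtain R where R: "bounded_clinear R" "\<And>x. R x \<in> D" "\<And>x. A (R x) - m *\<^sub>R R x = x"
    "\<And>x. x \<in> D \<Longrightarrow> R (A x - m *\<^sub>R x) = x"
    using assms by (auto simp: spectrum_def scaleC_of_real)
  have 3: "A (R x) = x + m *\<^sub>R R x" for x using R(3)[of x] by (simp add: algebra_simps)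
  have "cinner (R x) y = cinner x (R y)" for x y
    using symmetric[OF R(2)[of x] R(2)[of y]]
    by (simp add: 3 cinner_add_left cinner_add_right cinner_scaleR_left cinner_scaleR_right)
  with R 3 show ?thesis using that by blast
qed

lemma bounded_below:
  assumes "complex_of_real m \<notin> spectrum D A"
  obtains c where "c > 0" "\<And>x. x \<in> D \<Longrightarrow> norm (A x - m *\<^sub>R x) \<ge> c * norm x"
proof -
  obtain R where R: "bounded_clinear R" "\<And>x. x \<in> D \<Longrightarrow> R (A x - m *\<^sub>R x) = x"
    using resolvent[OF assms] by metis
  obtain K where K: "\<And>x. norm (R x) \<le> norm x * K" "K > 0"
    using bounded_linear.pos_bounded[OF bounded_clinear_bounded_linear[OF R(1)]] by blast
  have "norm (A x - m *\<^sub>R x) \<ge> inverse K * norm x" if "x \<in> D" for x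
    using K(1)[of "A x - m *\<^sub>R x"] R(2)[OF that] K(2) by (simp add: field_simps)
  then show ?thesis using that[of "inverse K"] K(2) by simp
qed

text \<open>
  The inverse \<open>R\<close> of \<open>A - m\<close> is symmetric, so \<open>\<parallel>R\<parallel>\<^sup>2\<close> is an approximate eigenvalue of \<open>R\<^sup>2\<close>, and one of
  \<open>\<parallel>R\<parallel>\<close>, \<open>- \<parallel>R\<parallel>\<close> is an approximate eigenvalue of \<open>R\<close>.  Hence one of \<open>m + 1/\<parallel>R\<parallel>\<close>, \<open>m - 1/\<parallel>R\<parallel>\<close> is in the
  spectrum of \<open>A\<close>, and \<open>1/\<parallel>R\<parallel> \<ge> h\<close>.
\<close>

lemma spectral_gap:
  assumes h: "h > 0" and gap: "\<And>t. \<bar>t - m\<bar> < h \<Longrightarrow> complex_of_real t \<notin> spectrum D A" and x: "x \<in> D"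
  shows "norm (A x - m *\<^sub>R x) \<ge> h * norm x"
proof (cases "x = 0")
  case x0: False
  have "complex_of_real m \<notin> spectrum D A" using gap[of m] h by simp
  from resolvent[OF this] obtain R where R: "bounded_clinear R" "\<And>x. R x \<in> D" "\<And>x. A (R x) = x + m *\<^sub>R R x"
    "\<And>x. x \<in> D \<Longrightarrow> R (A x - m *\<^sub>R x) = x" "\<And>x y. cinner (R x) y = cinner x (R y)" by metis
  note bl = bounded_clinear_bounded_linear[OF R(1)]
  interpret R: bounded_linear R by (fact bl)
  have Rs: "inner (R x) y = inner x (R y)" for x y using R(5)[of x y] by (metis Re_cinner)
  have pos: "positive_on UNIV (\<lambda>x. R (R x))"
  proof -
    have "inner (R (R x)) x \<ge> 0" for x unfolding Rs[of "R x" x] by (rule inner_ge_zero)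
    moreover have "inner (R (R x)) y = inner x (R (R y))" for x y by (simp only: Rs)
    ultimately show ?thesis unfolding positive_on_def by blast
  qed
  have bl2: "bounded_linear (\<lambda>x. R (R x))" by (rule bounded_linear_compose[OF bl bl])
  obtain r where r: "r \<ge> 0" "\<And>x. inner (R (R x)) x \<le> r * (norm x)\<^sup>2"
    "\<And>e. e > 0 \<Longrightarrow> \<exists>x. norm x = 1 \<and> norm (r *\<^sub>R x - R (R x)) < e"
    using approximate_top_eigenvector[OF subspace_UNIV bl2 pos _ x0] by auto
  have Rr: "(norm (R y))\<^sup>2 \<le> r * (norm y)\<^sup>2" for y
    using r(2)[of y] Rs[of "R y" y] by (simp add: power2_norm_eq_inner)
  define y where "y = A x - m *\<^sub>R x"
  have y: "R y = x" using R(4)[OF x] by (simp add: y_def)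
  then have "r \<noteq> 0" using Rr[of y] x0 by auto
  with r(1) have "r > 0" by simp
  define N where "N = sqrt r"
  have N: "N > 0" "N * N = r" using \<open>r > 0\<close> by (auto simp: N_def)
  have "1 / N \<ge> h"
  proof (rule ccontr)
    assume "\<not> 1 / N \<ge> h"
    then have lt: "1 / N < h" by simp
    have key: "\<exists>k>0. \<forall>y. norm (y - s *\<^sub>R R y) \<ge> k * norm y" if s: "\<bar>s\<bar> = 1 / N" for s
    proof -
      have "complex_of_real (m + s) \<notin> spectrum D A" using gap[of "m + s"] s lt by simp
      from bounded_below[OF this] obtain c where c: "c > 0"
        "\<And>x. x \<in> D \<Longrightarrow> norm (A x - (m + s) *\<^sub>R x) \<ge> c * norm x" by blast
      have "norm (y - s *\<^sub>R R y) \<ge> inverse (1 + \<bar>s\<bar> / c) * norm y" for y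
      proof -
        have "norm (y - s *\<^sub>R R y) \<ge> c * norm (R y)"
          using c(2)[OF R(2)[of y]] by (simp add: R(3) algebra_simps)
        then have "norm (R y) \<le> norm (y - s *\<^sub>R R y) / c" using c(1) by (simp add: field_simps)
        then have "\<bar>s\<bar> * norm (R y) \<le> \<bar>s\<bar> * (norm (y - s *\<^sub>R R y) / c)" by (rule mult_left_mono) simp
        moreover have "norm y \<le> norm (y - s *\<^sub>R R y) + norm (s *\<^sub>R R y)"
          using norm_triangle_ineq[of "y - s *\<^sub>R R y" "s *\<^sub>R R y"] by simp
        ultimately have "norm y \<le> (1 + \<bar>s\<bar> / c) * norm (y - s *\<^sub>R R y)" by (simp add: algebra_simps)
        moreover have "1 + \<bar>s\<bar> / c > 0" using c(1) by (simp add: add_pos_nonneg)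
        ultimately show ?thesis by (simp add: field_simps)
      qed
      moreover have "inverse (1 + \<bar>s\<bar> / c) > 0" using c(1) by (simp add: add_pos_nonneg)
      ultimately show ?thesis by blast
    qed
    from key[of "1/N"] obtain k1 where k1: "k1 > 0" "\<And>y. norm (y - (1/N) *\<^sub>R R y) \<ge> k1 * norm y"
      using N(1) by auto
    from key[of "-(1/N)"] obtain k2 where k2: "k2 > 0" "\<And>y. norm (y - (-(1/N)) *\<^sub>R R y) \<ge> k2 * norm y"
      using N(1) by auto
    \<comment> \<open>the operator \<open>r - R\<^sup>2 = r (1 - R/N) (1 + R/N)\<close> would be bounded below by \<open>r k1 k2\<close>\<close>
    obtain z where z: "norm z = 1" "norm (r *\<^sub>R z - R (R z)) < r * k1 * k2"
      using r(3)[of "r * k1 * k2"] k1(1) k2(1) \<open>r > 0\<close> by auto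
    define w where "w = z + (1/N) *\<^sub>R R z"
    have "norm w \<ge> k2" using k2(2)[of z] z(1) by (simp add: w_def)
    moreover have "w - (1/N) *\<^sub>R R w = inverse r *\<^sub>R (r *\<^sub>R z - R (R z))"
      using N \<open>r > 0\<close> by (simp add: w_def R.add R.scaleR algebra_simps inverse_eq_divide)
    ultimately have "k1 * k2 \<le> norm (inverse r *\<^sub>R (r *\<^sub>R z - R (R z)))"
      using k1(2)[of w] k1(1) by (metis (no_types, opaque_lifting) mult_left_mono order_trans less_imp_le)
    also have "\<dots> = norm (r *\<^sub>R z - R (R z)) / r"
      using \<open>r > 0\<close> unfolding norm_scaleR by (simp add: divide_inverse)
    also have "\<dots> < k1 * k2" using z(2) \<open>r > 0\<close> by (simp add: field_simps)
    finally show False by simp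
  qed
  then have "h * N \<le> 1" using N(1) by (simp add: field_simps)
  have "(norm x)\<^sup>2 \<le> (N * norm y)\<^sup>2" using Rr[of y] unfolding N(2)[symmetric] y by (simp add: power2_eq_square mult_ac)
  then have "norm x \<le> N * norm y" using N(1) by (simp add: power2_le_iff_abs_le)
  then have "h * norm x \<le> h * N * norm y" using h by (simp add: mult.assoc)
  also have "\<dots> \<le> 1 * norm y" using \<open>h * N \<le> 1\<close> by (intro mult_right_mono) auto
  finally show ?thesis by (simp add: y_def)
qed simp

lemma eigenvalue_in_spectrum:
  assumes "x \<in> eigenspace D A (of_real t)" "x \<noteq> 0"
  shows "complex_of_real t \<in> spectrum D A"
proof (rule ccontr)
  assume "complex_of_real t \<notin> spectrum D A"
  from bounded_below[OF this] obtain c where c: "c > 0" "\<And>x. x \<in> D \<Longrightarrow> norm (A x - t *\<^sub>R x) \<ge> c * norm x"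
    by blast
  then show False using assms c(2)[of x] by (simp add: eigenspace_def scaleC_of_real mult_le_0_iff)
qed

lemma csubspace_eigenspace: "csubspace (eigenspace D A z)"
proof (rule complex_vector.subspaceI)
  show "0 \<in> eigenspace D A z"
    using domain(1) by (simp add: eigenspace_def A_zero complex_vector.subspace_0)
  show "x + y \<in> eigenspace D A z" if "x \<in> eigenspace D A z" "y \<in> eigenspace D A z" for x y
    using that domain(1) by (simp add: eigenspace_def A_add complex_vector.subspace_add scaleC_add_right)
  show "c *\<^sub>C x \<in> eigenspace D A z" if "x \<in> eigenspace D A z" for x c
    using that domain(1)
    by (simp add: eigenspace_def A_scaleC complex_vector.subspace_scale scaleC_scaleC mult.commute)
qed

lemma eigenspaces_orthogonal:
  assumes "x \<in> eigenspace D A (of_real s)" "y \<in> eigenspace D A (of_real t)" "s \<noteq> t"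
  shows "cinner x y = 0"
proof -
  have "of_real s * cinner x y = of_real t * cinner x y"
    using symmetric[of x y] assms
    by (simp add: eigenspace_def cinner_scaleC_left cinner_scaleC_right)
  then show ?thesis using assms(3) by simp
qed

end

locale discrete_selfadjoint = selfadjoint +
  assumes nonneg: "spectrum D A \<subseteq> \<real>\<^sub>\<ge>\<^sub>0"
    and discrete: "\<And>t. t = 0 \<or> complex_of_real t \<in> spectrum D A \<Longrightarrow>
      \<exists>\<delta>>0. \<forall>s. 0 < \<bar>s - t\<bar> \<and> \<bar>s - t\<bar> < \<delta> \<longrightarrow> complex_of_real s \<notin> spectrum D A"
begin

lemma negative_notin_spectrum: "t < 0 \<Longrightarrow> complex_of_real t \<notin> spectrum D A"
  using nonneg by auto

text \<open>
  By \<open>spectral_gap\<close> at \<open>- a\<close>, \<open>\<parallel>A x\<parallel>\<^sup>2 + 2 a (A x, x) \<ge> 0\<close> for all \<open>a > 0\<close>; the claim is the limit of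
  large \<open>a\<close>.
\<close>

lemma A_nonneg:
  assumes "x \<in> D" shows "inner (A x) x \<ge> 0"
proof (rule ccontr)
  assume "\<not> inner (A x) x \<ge> 0"
  then have neg: "inner (A x) x < 0" by simp
  have "(norm (A x))\<^sup>2 + 2 * a * inner (A x) x \<ge> 0" if a: "a > 0" for a
  proof -
    have "norm (A x - (-a) *\<^sub>R x) \<ge> a * norm x"
      using a assms by (intro spectral_gap negative_notin_spectrum) auto
    then have "(a * norm x)\<^sup>2 \<le> (norm (A x - (-a) *\<^sub>R x))\<^sup>2"
      using a by (intro power_mono) auto
    then show ?thesis
      unfolding power_mult_distrib power2_norm_eq_inner
      by (simp add: inner_add_left inner_add_right inner_commute power2_eq_square algebra_simps)
  qed
  from this[of "((norm (A x))\<^sup>2 + 1) / (- 2 * inner (A x) x)"] show False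
    using neg by (simp add: zero_less_divide_iff field_simps add_pos_nonneg)
qed

text \<open>
  Suppose that the orthogonal complement \<open>M\<close> of all eigenvectors is not zero.  The positive operator
  \<open>R = (A + 1)\<^sup>-\<^sup>1\<close> preserves \<open>M\<close>.  Let \<open>r\<close> be the supremum of its form on the unit sphere of \<open>M\<close>, and
  \<open>S = r - R\<close>.  The number \<open>l = 1/r - 1\<close> is in the spectrum of \<open>A\<close>, so a gap \<open>(l, l + \<delta>)\<close> follows it.
  By \<open>spectral_gap\<close> at the midpoint, the form of \<open>(A - l)(A - l - \<delta>)\<close> is nonnegative; in terms of \<open>S\<close>
  this is \<open>\<parallel>S y\<parallel>\<^sup>2 \<ge> \<delta>' (S y, y)\<close>.  With the Cauchy--Schwarz inequality
  \<open>\<parallel>S y\<parallel>\<^sup>4 \<le> (S (S y), S y) (S y, y)\<close> one obtains \<open>S \<ge> \<delta>'\<close> on the range of \<open>S\<close> in \<open>M\<close>.  This range is dense in \<open>M\<close>,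
  because a vector of \<open>M\<close> in the kernel of \<open>S\<close> would be an eigenvector of \<open>A\<close>.  So \<open>S \<ge> \<delta>'\<close> on \<open>M\<close>, and \<open>r\<close>
  was not the supremum.
\<close>

lemma eigenvectors_total:
  assumes orth: "\<And>t y. t \<ge> 0 \<Longrightarrow> y \<in> eigenspace D A (of_real t) \<Longrightarrow> cinner x y = 0"
  shows "x = 0"
proof (rule ccontr)
  assume x0: "x \<noteq> 0"
  define M where "M = {y. \<forall>z\<in>(\<Union>t\<in>{0..}. eigenspace D A (of_real t)). cinner y z = 0}"
  have xM: "x \<in> M" using orth by (auto simp: M_def)
  have M: "csubspace M" "closed M"
    unfolding M_def by (rule csubspace_orthogonal, rule closed_orthogonal_complement)
  note sM = csubspace_subspace[OF M(1)]
  obtain R where R: "bounded_clinear R" "\<And>x. R x \<in> D" "\<And>x. A (R x) = x - R x"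
    "\<And>x. x \<in> D \<Longrightarrow> R (A x + x) = x" "\<And>x y. cinner (R x) y = cinner x (R y)"
    using resolvent[OF negative_notin_spectrum[of "-1"]] by (metis diff_minus_eq_add scaleR_minus1_left
        uminus_add_conv_diff add.commute neg_less_0_iff_less zero_less_one)
  note bl = bounded_clinear_bounded_linear[OF R(1)]
  interpret R: bounded_linear R by (fact bl)
  have Rs: "inner (R x) y = inner x (R y)" for x y using R(5)[of x y] by (metis Re_cinner)
  have RM: "R y \<in> M" if y: "y \<in> M" for y
    unfolding M_def
  proof safe
    fix t :: real and z assume t: "t \<ge> 0" and z: "z \<in> eigenspace D A (of_real t)"
    then have "A z + z = (t + 1) *\<^sub>R z" by (simp add: eigenspace_def scaleC_of_real scaleR_left_distrib)
    then have "(t + 1) *\<^sub>R R z = z"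
      using R(4)[of z] z by (simp add: eigenspace_def R.scaleR)
    then have "R z = inverse (t + 1) *\<^sub>R z" using t by (metis add_nonneg_pos less_irrefl scaleR_scaleR
          left_inverse scaleR_one zero_less_one)
    moreover have "cinner y z = 0" using y t z by (auto simp: M_def)
    ultimately show "cinner (R y) z = 0" by (simp add: R(5) cinner_scaleR_right)
  qed
  have Rpos: "inner (R y) y \<ge> 0" for y
  proof -
    have "inner (R y) y = inner (R y) (A (R y)) + inner (R y) (R y)"
      by (simp add: R(3) inner_diff_right)
    then show ?thesis using A_nonneg[OF R(2)[of y]] by (simp add: inner_commute)
  qed
  have pos: "positive_on M R" using RM Rs Rpos by (simp add: positive_on_def)
  obtain r where r: "r \<ge> 0" "\<And>x. x \<in> M \<Longrightarrow> inner (R x) x \<le> r * (norm x)\<^sup>2"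
    "positive_on M (\<lambda>x. r *\<^sub>R x - R x)"
    "\<And>e. e > 0 \<Longrightarrow> \<exists>x\<in>M. norm x = 1 \<and> norm (r *\<^sub>R x - R x) < e"
    using approximate_top_eigenvector[OF sM bl pos xM x0] by blast
  have norm_R: "norm (R y) \<le> norm y" for y
  proof -
    have "norm (A (R y) - (-1) *\<^sub>R R y) \<ge> 1 * norm (R y)"
      by (rule spectral_gap[OF _ negative_notin_spectrum R(2)]) auto
    then show ?thesis by (simp add: R(3))
  qed
  have "r \<noteq> 0"
  proof
    assume "r = 0"
    then have "inner (R x) x = 0" using r(2)[OF xM] Rpos[of x] by simp
    then have "R x = 0"
      using positive_norm_le_form[OF sM R.linear pos xM, of 1] norm_R by simp
    then show False using R(3)[of x] x0 by (simp add: A_zero)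
  qed
  with r(1) have r0: "r > 0" by simp
  have "r \<le> 1 + e" if e: "e > 0" for e
  proof -
    obtain y where y: "norm y = 1" "norm (r *\<^sub>R y - R y) < e" using r(4)[OF e] by blast
    have "norm (r *\<^sub>R y) \<le> norm (r *\<^sub>R y - R y) + norm (R y)"
      using norm_triangle_ineq[of "r *\<^sub>R y - R y" "R y"] by simp
    then show ?thesis using y norm_R[of y] r0 by simp
  qed
  then have r1: "r \<le> 1" by (rule field_le_epsilon)
  define l where "l = 1 / r - 1"
  have l: "l \<ge> 0" using r0 r1 by (simp add: l_def)
  define S where "S y = r *\<^sub>R y - R y" for y
  have Al: "A (R y) - l *\<^sub>R R y = (1 / r) *\<^sub>R S y" for y
    using r0 by (simp add: R(3) l_def S_def algebra_simps)
  have S: "bounded_clinear S" unfolding S_def scaleC_of_real[symmetric]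
    by (intro bounded_clinear_diff R bounded_clinear_scale) (auto simp: bounded_clinear_def)
  note blS = bounded_clinear_bounded_linear[OF S]
  interpret S: bounded_linear S by (fact blS)
  have posS: "positive_on M S" using r(3) by (simp add: S_def[abs_def])
  have Sapprox: "\<exists>x\<in>M. norm x = 1 \<and> norm (S x) < e" if "e > 0" for e
    using r(4)[OF that] by (simp add: S_def)
  have lspec: "complex_of_real l \<in> spectrum D A"
  proof (rule ccontr)
    assume "complex_of_real l \<notin> spectrum D A"
    from bounded_below[OF this] obtain c where c: "c > 0"
      "\<And>x. x \<in> D \<Longrightarrow> norm (A x - l *\<^sub>R x) \<ge> c * norm x" by blast
    define e where "e = c * r / (1 / r + c)"
    have e: "e > 0" using c(1) r0 by (simp add: e_def add_pos_pos)
    then obtain y where y: "norm y = 1" "norm (S y) < e" using Sapprox by blast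
    have "c * norm (R y) \<le> norm (S y) / r" using c(2)[OF R(2)[of y]] r0 by (simp add: Al)
    moreover have "r - norm (S y) \<le> norm (R y)"
    proof -
      have "norm (r *\<^sub>R y) \<le> norm (S y) + norm (R y)"
        using norm_triangle_ineq[of "S y" "R y"] by (simp add: S_def)
      then show ?thesis using y(1) r0 by simp
    qed
    then have "c * (r - norm (S y)) \<le> c * norm (R y)" using c(1) by simp
    ultimately have "c * r \<le> norm (S y) * (1 / r + c)" by (simp add: algebra_simps)
    also have "\<dots> < e * (1 / r + c)" using y(2) c(1) r0 by (intro mult_strict_right_mono add_pos_pos) auto
    also have "\<dots> = c * r" using c(1) r0 by (simp add: e_def add_pos_pos less_imp_neq[symmetric])
    finally show False by simp
  qed
  obtain \<delta> where \<delta>: "\<delta> > 0" "\<And>s. 0 < \<bar>s - l\<bar> \<Longrightarrow> \<bar>s - l\<bar> < \<delta> \<Longrightarrow> complex_of_real s \<notin> spectrum D A"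
    using discrete[of l] lspec by blast
  define \<delta>' where "\<delta>' = \<delta> / (1 / r\<^sup>2 + \<delta> / r)"
  have \<delta>': "\<delta>' > 0" using \<delta>(1) r0 by (simp add: \<delta>'_def add_pos_pos)
  have gapS: "(norm (S y))\<^sup>2 \<ge> \<delta>' * inner (S y) y" for y
  proof -
    define h where "h = \<delta> / 2"
    have h: "h > 0" "\<delta> = 2 * h" using \<delta>(1) by (auto simp: h_def)
    define w where "w = (1 / r) *\<^sub>R S y"
    have "norm (A (R y) - (l + h) *\<^sub>R R y) \<ge> h * norm (R y)"
      using h by (intro spectral_gap R(2) \<delta>(2)) auto
    moreover have "A (R y) - (l + h) *\<^sub>R R y = w - h *\<^sub>R R y"
      using Al[of y] by (simp add: w_def algebra_simps)
    ultimately have "(h * norm (R y))\<^sup>2 \<le> (norm (w - h *\<^sub>R R y))\<^sup>2"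
      using h by (intro power_mono) auto
    then have "\<delta> * inner w (R y) \<le> (norm w)\<^sup>2"
      unfolding power_mult_distrib power2_norm_eq_inner h(2)
      by (simp add: inner_diff_left inner_diff_right inner_commute power2_eq_square algebra_simps)
    moreover have "inner w (R y) = inner (S y) y - (norm (S y))\<^sup>2 / r"
    proof -
      have "R y = r *\<^sub>R y - S y" by (simp add: S_def)
      then have "inner (S y) (R y) = r * inner (S y) y - (norm (S y))\<^sup>2"
        by (simp add: inner_diff_right power2_norm_eq_inner)
      then show ?thesis using r0 by (simp add: w_def field_simps)
    qed
    moreover have "(norm w)\<^sup>2 = (norm (S y))\<^sup>2 / r\<^sup>2"
      by (simp add: w_def power_mult_distrib power_divide)
    ultimately have "\<delta> * inner (S y) y \<le> (1 / r\<^sup>2 + \<delta> / r) * (norm (S y))\<^sup>2"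
      by (simp add: algebra_simps)
    moreover have "1 / r\<^sup>2 + \<delta> / r > 0" using \<delta>(1) r0 by (simp add: add_pos_pos)
    ultimately show ?thesis by (simp add: \<delta>'_def field_simps)
  qed
  have range_ge: "\<delta>' * (norm (S y))\<^sup>2 \<le> inner (S (S y)) (S y)" if y: "y \<in> M" for y
  proof -
    have "S y \<in> M" using posS y by (simp add: positive_on_def)
    from positive_form_cauchy_schwarz[OF sM S.linear posS y this]
    have cs: "((norm (S y))\<^sup>2)\<^sup>2 \<le> inner (S (S y)) (S y) * inner (S y) y"
      by (simp add: power2_norm_eq_inner)
    have a1: "inner (S y) y \<ge> 0" using posS y by (rule positive_onD)
    show ?thesis
    proof (cases "inner (S y) y = 0")
      case True
      then have "S y = 0" using cs by simp
      then show ?thesis by (simp add: S.zero)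
    next
      case False
      then have a1: "inner (S y) y > 0" using a1 by simp
      have "\<delta>' * inner (S y) y * (norm (S y))\<^sup>2 \<le> (norm (S y))\<^sup>2 * (norm (S y))\<^sup>2"
        by (intro mult_right_mono gapS) auto
      also have "\<dots> \<le> inner (S (S y)) (S y) * inner (S y) y" using cs by (simp add: power2_eq_square)
      finally have "inner (S y) y * (\<delta>' * (norm (S y))\<^sup>2) \<le> inner (S y) y * inner (S (S y)) (S y)"
        by (simp add: mult_ac)
      then show ?thesis using a1 by (simp only: mult_le_cancel_left_pos)
    qed
  qed
  have MS: "M \<subseteq> closure (S ` M)"
  proof
    fix y assume y: "y \<in> M"
    have sSM: "csubspace (S ` M)"
    proof (rule complex_vector.subspaceI)
      show "0 \<in> S ` M" using M(1) S.zero complex_vector.subspace_0 by force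
      show "a + b \<in> S ` M" if "a \<in> S ` M" "b \<in> S ` M" for a b
        using that complex_vector.subspace_add[OF M(1)] by (force simp flip: S.add)
      show "c *\<^sub>C a \<in> S ` M" if "a \<in> S ` M" for a c
        using that complex_vector.subspace_scale[OF M(1)]
        by (force simp flip: bounded_clinear_scaleC[OF S])
    qed
    have SMM: "closure (S ` M) \<subseteq> M"
      using posS M(2) by (intro closure_minimal) (auto simp: positive_on_def)
    obtain z where z: "z \<in> closure (S ` M)" "\<forall>v\<in>closure (S ` M). cinner (y - z) v = 0"
      using orthogonal_projection_exists[OF csubspace_closure[OF sSM], of y] by auto
    define u where "u = y - z"
    have uM: "u \<in> M" unfolding u_def using y z(1) SMM M(1)
      by (intro complex_vector.subspace_diff) auto
    have "inner u (S v) = 0" if "v \<in> M" for v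
    proof -
      have "S v \<in> closure (S ` M)" using that by (intro subsetD[OF closure_subset] imageI)
      then show ?thesis using z(2) by (simp add: u_def flip: Re_cinner)
    qed
    then have "inner (S u) v = 0" if "v \<in> M" for v
      using posS uM that unfolding positive_on_def by metis
    moreover have "S u \<in> M" using posS uM unfolding positive_on_def by blast
    ultimately have "S u = 0" using inner_eq_zero_iff by blast
    then have Ru: "R u = r *\<^sub>R u" by (simp add: S_def)
    then have u: "u = (1/r) *\<^sub>R R u" using r0 by simp
    have "u \<in> D" by (subst u) (rule subspace_scale[OF csubspace_subspace[OF domain(1)] R(2)])
    moreover have "A u = l *\<^sub>R u"
    proof -
      have "A u = (1/r) *\<^sub>R (u - R u)" by (subst u) (simp add: A_scaleR R)
      then show ?thesis using r0 by (simp add: Ru l_def algebra_simps)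
    qed
    ultimately have "u \<in> eigenspace D A (of_real l)" by (simp add: eigenspace_def scaleC_of_real)
    then have "cinner u u = 0" using uM l by (auto simp: M_def)
    then have "u = 0" by (simp add: cinner_self)
    then show "y \<in> closure (S ` M)" using z(1) by (simp add: u_def)
  qed
  have cl: "closed {v. \<delta>' * (norm v)\<^sup>2 \<le> inner (S v) v}"
    by (intro closed_Collect_le continuous_intros linear_continuous_on blS)
  have "closure (S ` M) \<subseteq> {v. \<delta>' * (norm v)\<^sup>2 \<le> inner (S v) v}"
    using range_ge by (intro closure_minimal cl) auto
  then have ge: "\<delta>' * (norm v)\<^sup>2 \<le> inner (S v) v" if "v \<in> M" for v
    using that MS by blast
  obtain v where v: "v \<in> M" "norm v = 1" "norm (S v) < \<delta>'" using Sapprox[OF \<delta>'] by blast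
  have "\<delta>' \<le> norm (S v)" using ge[OF v(1)] v(2) norm_cauchy_schwarz[of "S v" v] by simp
  with v(3) show False by simp
qed

text \<open>
  Eigenvectors make \<open>A - l\<close> small if \<open>l\<close> is an accumulation point of eigenvalues.  So \<open>l\<close> would be in the
  spectrum without being isolated.
\<close>

lemma finitely_many_eigenvalues:
  "finite {t. 0 \<le> t \<and> t \<le> b \<and> eigenspace D A (complex_of_real t) \<noteq> {0}}" (is "finite ?E")
proof (rule ccontr)
  assume "infinite ?E"
  moreover have "?E \<subseteq> {0..b}" by auto
  ultimately obtain l where l: "l islimpt ?E"
    using compact_eq_Bolzano_Weierstrass[of "{0..b}"] by (metis (lifting) compact_Icc)
  have eig: "\<exists>t\<in>?E. t \<noteq> l \<and> \<bar>t - l\<bar> < e" if "e > 0" for e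
    using l that unfolding islimpt_approachable dist_real_def by blast
  have ev: "\<exists>x\<in>eigenspace D A (of_real t). x \<noteq> 0" if "t \<in> ?E" for t
    using that csubspace_eigenspace[of "of_real t"] complex_vector.subspace_0 by fastforce
  have "l = 0 \<or> complex_of_real l \<in> spectrum D A"
  proof (rule disjI2, rule ccontr)
    assume "complex_of_real l \<notin> spectrum D A"
    from bounded_below[OF this] obtain c where c: "c > 0"
      "\<And>x. x \<in> D \<Longrightarrow> norm (A x - l *\<^sub>R x) \<ge> c * norm x" by blast
    obtain t where t: "t \<in> ?E" "\<bar>t - l\<bar> < c" using eig[OF c(1)] by blast
    obtain x where x: "x \<in> eigenspace D A (of_real t)" "x \<noteq> 0" using ev[OF t(1)] by blast
    have "A x - l *\<^sub>R x = (t - l) *\<^sub>R x" using x by (simp add: eigenspace_def scaleC_of_real algebra_simps)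
    then have "c * norm x \<le> \<bar>t - l\<bar> * norm x" using c(2)[of x] x(1) by (simp add: eigenspace_def)
    then show False using t(2) x(2) by simp
  qed
  from discrete[OF this] obtain \<delta> where \<delta>: "\<delta> > 0"
    "\<And>s. 0 < \<bar>s - l\<bar> \<Longrightarrow> \<bar>s - l\<bar> < \<delta> \<Longrightarrow> complex_of_real s \<notin> spectrum D A" by blast
  obtain t where t: "t \<in> ?E" "t \<noteq> l" "\<bar>t - l\<bar> < \<delta>" using eig[OF \<delta>(1)] by blast
  then show False using \<delta>(2)[of t] ev[OF t(1)] eigenvalue_in_spectrum by auto
qed

end

section \<open>Sequences with prescribed multiplicities\<close>

text \<open>
  The condition by which the singular values are defined.  The reciprocals of the positive eigenvalues
  of \<open>A\<close> satisfy it as well, which allows both to be treated together.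
\<close>

definition enumerates :: "(nat \<Rightarrow> real) \<Rightarrow> (real \<Rightarrow> nat) \<Rightarrow> bool" where
  "enumerates m f \<longleftrightarrow> decseq m \<and> (\<forall>j. 0 \<le> m j) \<and>
     (\<forall>s>0. finite {j. m j = s} \<and> card {j. m j = s} = f s)"

lemma downward_closed_nat_eq:
  fixes S :: "nat set"
  assumes "finite S" "\<And>i j. j \<in> S \<Longrightarrow> i \<le> j \<Longrightarrow> i \<in> S"
  shows "S = {..<card S}"
proof -
  define k where "k = (LEAST k. k \<notin> S)"
  have "\<exists>k. k \<notin> S" using assms(1) infinite_UNIV_nat by (metis UNIV_eq_I)
  then have "k \<notin> S" unfolding k_def by (rule LeastI_ex)
  moreover have "i \<in> S" if "i < k" for i using that not_less_Least unfolding k_def by blast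
  ultimately have "S = {..<k}" using assms(2) by (metis leI lessThan_iff subsetI subset_antisym)
  then show ?thesis by simp
qed

text \<open>
  The places with value at least \<open>s\<close> form an initial segment, whose length is the number of
  multiplicities at or above \<open>s\<close>.  This determines the sequence.
\<close>

lemma enumerates_ge_iff:
  assumes m: "enumerates m f" and fin: "\<And>e. e > 0 \<Longrightarrow> finite {s. s \<ge> e \<and> f s \<noteq> 0}" and s: "s > 0"
  shows "m j \<ge> s \<longleftrightarrow> j < sum f {t. t \<ge> s \<and> f t \<noteq> 0}"
proof -
  let ?T = "{t. t \<ge> s \<and> f t \<noteq> 0}"
  have fc: "finite {j. m j = t}" "card {j. m j = t} = f t" if "t \<ge> s" for t
    using m that s by (auto simp: enumerates_def)
  have eq: "{j. m j \<ge> s} = (\<Union>t\<in>?T. {j. m j = t})"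
  proof safe
    fix j assume "m j \<ge> s"
    then have "f (m j) \<noteq> 0" using fc[of "m j"] by (metis (mono_tags, lifting) card_0_eq empty_iff mem_Collect_eq)
    then show "j \<in> (\<Union>t\<in>?T. {j. m j = t})" using \<open>m j \<ge> s\<close> by auto
  qed
  have finS: "finite {j. m j \<ge> s}" unfolding eq using fin[OF s] fc by (intro finite_UN_I) auto
  have card: "card {j. m j \<ge> s} = sum f ?T"
  proof -
    have "card (\<Union>t\<in>?T. {j. m j = t}) = (\<Sum>t\<in>?T. card {j. m j = t})"
      using fin[OF s] fc by (intro card_UN_disjoint) auto
    also have "\<dots> = sum f ?T" using fc by (intro sum.cong) auto
    finally show ?thesis unfolding eq .
  qed
  have "{j. m j \<ge> s} = {..<card {j. m j \<ge> s}}"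
    using m by (intro downward_closed_nat_eq finS)
      (auto simp: enumerates_def decseq_def intro: order.trans)
  then show ?thesis unfolding card by blast
qed

lemma enumerates_unique:
  assumes fin: "\<And>e. e > 0 \<Longrightarrow> finite {s. s \<ge> e \<and> f s \<noteq> 0}"
    and "enumerates m f" "enumerates m' f"
  shows "m = m'"
proof
  fix j
  have iff: "m j \<ge> s \<longleftrightarrow> m' j \<ge> s" if "s > 0" for s
    using enumerates_ge_iff[OF assms(2) fin that] enumerates_ge_iff[OF assms(3) fin that] by simp
  have "0 \<le> m j" "0 \<le> m' j" using assms by (auto simp: enumerates_def)
  then show "m j = m' j" using iff[of "m j"] iff[of "m' j"]
    by (metis antisym order_le_less order_refl)
qed

lemma enumerates_exists:
  assumes fin: "\<And>e. e > 0 \<Longrightarrow> finite {s::real. s \<ge> e \<and> f s \<noteq> (0::nat)}"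
  shows "\<exists>m. enumerates m f"
proof -
  define P where "P s = sum f {t. t > s \<and> f t \<noteq> 0}" for s
  have fin': "finite {t. t > s \<and> f t \<noteq> 0}" if "s > 0" for s
    by (rule finite_subset[OF _ fin[OF that]]) auto
  have P_less: "P t + f t \<le> P s" if "0 < s" "s < t" for s t
  proof -
    have "P t + f t = sum f (insert t {t'. t' > t \<and> f t' \<noteq> 0})"
      using fin'[of t] that by (simp add: P_def)
    also have "\<dots> = sum f ({t'. t' > t \<and> f t' \<noteq> 0} \<union> (if f t = 0 then {} else {t}))"
      using fin'[of t] that by auto
    also have "\<dots> \<le> P s" unfolding P_def
      using fin'[of s] that by (intro sum_mono2) (auto split: if_splits)
    finally show ?thesis .
  qed
  \<comment> \<open>the value \<open>s\<close> occupies the places from \<open>P s\<close>, the number of larger values, to \<open>P s + f s\<close>\<close>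
  define W where "W j s \<longleftrightarrow> s > 0 \<and> P s \<le> j \<and> j < P s + f s" for j s
  have W_unique: "s = t" if "W j s" "W j t" for j s t
    using that P_less[of s t] P_less[of t s] by (cases s t rule: linorder_cases) (auto simp: W_def)
  define m where "m j = (if \<exists>s. W j s then SOME s. W j s else 0)" for j
  have m_iff: "m j = s \<longleftrightarrow> W j s" if "s > 0" for j s
  proof
    show "W j s" if "m j = s"
      using that \<open>s > 0\<close> someI_ex[of "W j"] by (auto simp: m_def split: if_splits)
    show "m j = s" if "W j s"
      using that someI_ex[of "W j"] W_unique by (auto simp: m_def)
  qed
  have m_nonneg: "m j \<ge> 0" for j
  proof (cases "\<exists>s. W j s")
    case True
    then have "W j (m j)" using someI_ex[of "W j"] by (simp add: m_def)
    then show ?thesis by (simp add: W_def)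
  qed (simp add: m_def)
  have "decseq m"
    unfolding decseq_def
  proof (intro allI impI)
    fix i j :: nat assume ij: "i \<le> j"
    show "m j \<le> m i"
    proof (cases "m j = 0")
      case True then show ?thesis using m_nonneg by simp
    next
      case False
      define s where "s = m j"
      have s: "s > 0" using m_nonneg[of j] False by (simp add: s_def)
      have Ws: "W j s" using m_iff[OF s, of j] unfolding s_def by blast
      define T where "T = {t. t \<ge> s \<and> f t \<noteq> 0 \<and> i < P t + f t}"
      have sT: "s \<in> T" using Ws ij by (auto simp: T_def W_def intro: ccontr)
      have finT: "finite T" by (rule finite_subset[OF _ fin[OF s]]) (auto simp: T_def)
      define t where "t = Max T"
      have t: "t \<in> T" "\<And>t'. t' \<in> T \<Longrightarrow> t' \<le> t"
        using Max_in[OF finT] Max_ge[OF finT] sT by (auto simp: t_def)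
      then have ts: "t \<ge> s" by (simp add: T_def)
      \<comment> \<open>the largest value that leaves room for the place \<open>i\<close> is the one at \<open>i\<close>: if more than \<open>i\<close>
          places were above \<open>t\<close>, the next larger value would leave room as well\<close>
      have "P t \<le> i"
      proof (rule ccontr)
        assume "\<not> P t \<le> i"
        then have lt: "i < P t" by simp
        define U where "U = {t'. t' > t \<and> f t' \<noteq> 0}"
        have finU: "finite U" unfolding U_def using fin'[of t] s ts by simp
        have PU: "P t = sum f U" by (simp add: P_def U_def)
        have "U \<noteq> {}" using lt unfolding PU by auto
        define t1 where "t1 = Min U"
        have t1: "t1 \<in> U" "\<And>t'. t' \<in> U \<Longrightarrow> t1 \<le> t'"
          using Min_in[OF finU \<open>U \<noteq> {}\<close>] Min_le[OF finU] by (auto simp: t1_def)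
        have "U = insert t1 {t'. t' > t1 \<and> f t' \<noteq> 0}"
          using t1 by (force simp: U_def)
        then have "P t = sum f (insert t1 {t'. t' > t1 \<and> f t' \<noteq> 0})" using PU by simp
        moreover have "t1 > 0" using t1(1) s ts by (simp add: U_def)
        ultimately have "P t = P t1 + f t1" using fin'[of t1] by (simp add: P_def)
        then have "t1 \<in> T" using lt t1(1) ts by (auto simp: T_def U_def)
        then show False using t(2)[of t1] t1(1) by (simp add: U_def)
      qed
      then have "W i t" using t(1) s ts by (auto simp: W_def T_def)
      then have "m i = t" using m_iff[of t i] s ts by simp
      then show ?thesis using ts by (simp add: s_def)
    qed
  qed
  moreover have "{j. m j = s} = {P s..<P s + f s}" if "s > 0" for s
    using that by (auto simp: m_iff W_def)
  ultimately have "enumerates m f" using m_nonneg by (simp add: enumerates_def)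
  then show ?thesis by blast
qed

text \<open>
  Orthonormal bases of the spaces \<open>E s\<close> are distributed over the places at which \<open>m\<close> has the value \<open>s\<close>.
  At the places with \<open>m j = 0\<close> the value of \<open>e\<close> is arbitrary.
\<close>

lemma orthonormal_enumeration:
  fixes E :: "real \<Rightarrow> 'a::complex_hilbert set"
  assumes m: "enumerates m (\<lambda>s. cdim (E s))"
    and fin: "\<And>s. s > 0 \<Longrightarrow> \<exists>B. finite B \<and> E s = cspan B"
    and orth: "\<And>s t x y. 0 < s \<Longrightarrow> 0 < t \<Longrightarrow> s \<noteq> t \<Longrightarrow> x \<in> E s \<Longrightarrow> y \<in> E t \<Longrightarrow> cinner x y = 0"
  shows "\<exists>e. orthonormal_on {j. m j > 0} e \<and> (\<forall>j. m j > 0 \<longrightarrow> e j \<in> E (m j)) \<and>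
     (\<forall>s>0. E s = cspan (e ` {j. m j = s}))"
proof -
  have ex: "\<exists>h. inj_on h {j. m j = s} \<and> orthonormal_on (h ` {j. m j = s}) (\<lambda>x. x) \<and>
      E s = cspan (h ` {j. m j = s})" if s: "s > 0" for s
  proof -
    obtain B where B: "finite B" "E s = cspan B" using fin[OF s] by blast
    obtain C where C: "finite C" "orthonormal_on C (\<lambda>x. x)" "cspan C = E s"
      using orthonormal_finite_basis[OF B(1)] B(2) by auto
    have "cdim (E s) = card C"
      using complex_vector.dim_eq_card[of C "E s"] C orthonormal_on_independent[OF C(2)]
      by (metis complex_vector.span_span)
    then have "card {j. m j = s} = card C" "finite {j. m j = s}"
      using m s by (auto simp: enumerates_def)
    then obtain h where "bij_betw h {j. m j = s} C"
      using C(1) finite_same_card_bij by blast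
    then show ?thesis using C by (intro exI[of _ h]) (auto simp: bij_betw_def)
  qed
  then have "\<forall>s. \<exists>h. s > 0 \<longrightarrow> inj_on h {j. m j = s} \<and> orthonormal_on (h ` {j. m j = s}) (\<lambda>x. x) \<and>
      E s = cspan (h ` {j. m j = s})" by blast
  then obtain h where h: "\<And>s. s > 0 \<Longrightarrow> inj_on (h s) {j. m j = s}"
    "\<And>s. s > 0 \<Longrightarrow> orthonormal_on (h s ` {j. m j = s}) (\<lambda>x. x)"
    "\<And>s. s > 0 \<Longrightarrow> E s = cspan (h s ` {j. m j = s})"
    by metis
  define e where "e j = h (m j) j" for j
  have img: "e ` {j. m j = s} = h s ` {j. m j = s}" for s by (auto simp: e_def)
  have eE: "e j \<in> E (m j)" if "m j > 0" for j
    using that h(3)[of "m j"] by (auto simp: e_def intro: complex_vector.span_base)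
  have "cinner (e i) (e j) = (if i = j then 1 else 0)" if "m i > 0" "m j > 0" for i j
  proof (cases "m i = m j")
    case True
    have "e i \<in> h (m j) ` {k. m k = m j}" "e j \<in> h (m j) ` {k. m k = m j}"
      using True by (auto simp: e_def)
    then have "cinner (e i) (e j) = (if e i = e j then 1 else 0)"
      using orthonormal_onD[OF h(2)[OF that(2)]] by simp
    moreover have "e i = e j \<longleftrightarrow> i = j"
      using h(1)[OF that(2)] True by (auto simp: e_def inj_on_def)
    ultimately show ?thesis by simp
  next
    case False
    then show ?thesis using orth[OF that False eE eE] that by auto
  qed
  then show ?thesis using eE h(3) img by (intro exI[of _ e]) (auto simp: orthonormal_on_def)
qed

section \<open>Adjoints, finite rank, and singular values\<close>

lemma cinner_adjoint:
  assumes T: "bounded_clinear T"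
  shows "cinner (T x) y = cinner x (adjoint_op UNIV T y)"
proof -
  have "bounded_linear (\<lambda>x. cinner (T x) y)"
    by (rule bounded_linear_compose[OF bounded_linear_cinner_left bounded_clinear_bounded_linear[OF T]])
  then obtain z where z: "\<And>x. cinner (T x) y = cinner x z"
    using riesz_representation[of "\<lambda>x. cinner (T x) y"]
    by (auto simp: bounded_clinear_scaleC[OF T] cinner_scaleC_left)
  have "z' = z" if "\<forall>x. cinner (T x) y = cinner x z'" for z'
  proof -
    have "cinner (z' - z) (z' - z) = 0" using that z[of "z' - z"] by (simp add: cinner_diff_right)
    then show ?thesis by (simp add: cinner_self)
  qed
  then have "adjoint_op UNIV T y = z" unfolding adjoint_op_def using z by (intro the_equality) auto
  then show ?thesis using z by simp
qed

lemma cinner_adjoint': "bounded_clinear T \<Longrightarrow> cinner x (T y) = cinner (adjoint_op UNIV T x) y"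
  by (metis cinner_adjoint cinner_commute)

lemma cinner_ext:
  assumes "\<And>x. cinner x y = cinner x (z::'a::complex_hilbert)" shows "y = z"
proof -
  have "cinner (y - z) (y - z) = 0" using assms[of "y - z"] by (simp add: cinner_diff_right)
  then show ?thesis by (simp add: cinner_self)
qed

lemma bounded_clinear_adjoint:
  assumes T: "bounded_clinear T"
  shows "bounded_clinear (adjoint_op UNIV T)"
proof -
  obtain K where K: "\<And>x. norm (T x) \<le> norm x * K" "K > 0"
    using bounded_linear.pos_bounded[OF bounded_clinear_bounded_linear[OF T]] by blast
  let ?S = "adjoint_op UNIV T"
  note a = cinner_adjoint[OF T, symmetric]
  show ?thesis
  proof (rule bounded_clinearI[where K = K])
    show "?S (x + y) = ?S x + ?S y" for x y
      by (rule cinner_ext) (simp add: cinner_add_right a)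
    show "?S (c *\<^sub>C x) = c *\<^sub>C ?S x" for c x
      by (rule cinner_ext) (simp add: cinner_scaleC_right a)
    show "norm (?S x) \<le> K * norm x" for x
    proof -
      have "complex_of_real ((norm (?S x))\<^sup>2) = cinner (T (?S x)) x"
        by (simp only: a flip: cinner_self)
      then have "(norm (?S x))\<^sup>2 = cmod (cinner (T (?S x)) x)"
        by (metis norm_of_real abs_of_nonneg zero_le_power2)
      also have "\<dots> \<le> norm (T (?S x)) * norm x" by (rule norm_cinner)
      also have "\<dots> \<le> norm (?S x) * K * norm x" by (intro mult_right_mono K) auto
      finally have "norm (?S x) * norm (?S x) \<le> norm (?S x) * (K * norm x)"
        by (simp add: power2_eq_square mult_ac)
      then show ?thesis
        using K(2) by (cases "?S x = 0") (auto simp: mult_le_cancel_left_pos)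
    qed
  qed
qed

text \<open>
  Rank at most \<open>n\<close>, with a decomposition into rank one operators in place of a condition on the range.
\<close>

definition finite_rank :: "nat \<Rightarrow> ('a::complex_hilbert \<Rightarrow> 'a) \<Rightarrow> bool" where
  "finite_rank n F \<longleftrightarrow> (\<exists>w u. F = (\<lambda>x. \<Sum>i<n. cinner x (w i) *\<^sub>C u i))"

lemma bounded_clinear_finite_rank:
  assumes "finite_rank n F" shows "bounded_clinear F"
proof -
  obtain w u where F: "F = (\<lambda>x. \<Sum>i<n. cinner x (w i) *\<^sub>C u i)" using assms by (auto simp: finite_rank_def)
  have "norm (F x) \<le> (\<Sum>i<n. norm (w i) * norm (u i)) * norm x" for x
  proof -
    have "norm (F x) \<le> (\<Sum>i<n. norm (cinner x (w i) *\<^sub>C u i))" unfolding F by (rule norm_sum)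
    also have "\<dots> \<le> (\<Sum>i<n. norm (w i) * norm (u i) * norm x)"
    proof (rule sum_mono)
      fix i
      have "cmod (cinner x (w i)) * norm (u i) \<le> norm x * norm (w i) * norm (u i)"
        by (intro mult_right_mono norm_cinner norm_ge_zero)
      then show "norm (cinner x (w i) *\<^sub>C u i) \<le> norm (w i) * norm (u i) * norm x"
        by (simp add: norm_scaleC mult_ac)
    qed
    finally show ?thesis by (simp add: sum_distrib_right)
  qed
  then show ?thesis
    by (intro bounded_clinearI[where K = "\<Sum>i<n. norm (w i) * norm (u i)"])
      (auto simp: F cinner_add_left scaleC_add_left sum.distrib cinner_scaleC_left
        scaleC_scaleC complex_vector.scale_sum_right)
qed

text \<open>
  The \<open>n + 1\<close> images of the vectors \<open>e j\<close> lie in the span of \<open>n\<close> vectors.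
\<close>

lemma kernel_of_finite_rank:
  assumes F: "finite_rank n F" and e: "orthonormal_on {..n} e"
  shows "\<exists>c. (\<exists>j\<le>n. c j \<noteq> 0) \<and> F (\<Sum>j\<le>n. c j *\<^sub>C e j) = 0"
proof -
  obtain w u where Fw: "F = (\<lambda>x. \<Sum>i<n. cinner x (w i) *\<^sub>C u i)" using F by (auto simp: finite_rank_def)
  note lin = bounded_clinear_finite_rank[OF F]
  have Fs: "F (\<Sum>j\<le>n. c j *\<^sub>C e j) = (\<Sum>j\<le>n. c j *\<^sub>C F (e j))" for c by (rule clinear_sum[OF lin])
  have img: "F x \<in> cspan (u ` {..<n})" for x
    unfolding Fw by (intro complex_vector.span_sum complex_vector.span_scale complex_vector.span_base) auto
  show ?thesis
  proof (cases "inj_on (\<lambda>j. F (e j)) {..n}")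
    case True
    let ?S = "(\<lambda>j. F (e j)) ` {..n}"
    have "complex_vector.dependent ?S"
    proof (rule ccontr)
      assume "complex_vector.independent ?S"
      then have "card ?S \<le> card (u ` {..<n})"
        using complex_vector.independent_span_bound[of "u ` {..<n}" ?S] img by blast
      also have "\<dots> \<le> n" by (metis card_image_le card_lessThan finite_lessThan)
      finally show False using card_image[OF True] by simp
    qed
    then obtain a v where a: "v \<in> ?S" "a v \<noteq> 0" "(\<Sum>v\<in>?S. a v *\<^sub>C v) = 0"
      by (auto simp: complex_vector.dependent_finite)
    have "(\<Sum>j\<le>n. a (F (e j)) *\<^sub>C F (e j)) = 0" using a(3) True by (simp add: sum.reindex)
    then show ?thesis using a(1,2) Fs by (intro exI[of _ "\<lambda>j. a (F (e j))"]) auto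
  next
    case False
    then obtain i j where ij: "i \<le> n" "j \<le> n" "i \<noteq> j" "F (e i) = F (e j)" by (auto simp: inj_on_def)
    define c where "c k = (if k = i then 1 else if k = j then - 1 else 0 :: complex)" for k
    have "(\<Sum>k\<le>n. c k *\<^sub>C F (e k)) = (\<Sum>k\<in>{i,j}. c k *\<^sub>C F (e k))"
      using ij by (intro sum.mono_neutral_right) (auto simp: c_def)
    also have "\<dots> = 0" using ij by (simp add: c_def)
    finally have "F (\<Sum>j\<le>n. c j *\<^sub>C e j) = 0" using Fs by simp
    then show ?thesis using ij(1) by (intro exI[of _ c]) (auto simp: c_def)
  qed
qed

lemma finite_rank_image_compact:
  assumes "finite_rank n F" shows "\<exists>C. compact C \<and> F ` cball 0 1 \<subseteq> C"
proof -
  obtain w u where F: "F = (\<lambda>x. \<Sum>i<n. cinner x (w i) *\<^sub>C u i)" using assms by (auto simp: finite_rank_def)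
  have "\<exists>C. compact C \<and> (\<lambda>x. \<Sum>i<k. cinner x (w i) *\<^sub>C u i) ` cball 0 1 \<subseteq> C" for k
  proof (induction k)
    case 0
    show ?case by (intro exI[of _ "{0}"]) auto
  next
    case (Suc k)
    then obtain C where C: "compact C" "(\<lambda>x. \<Sum>i<k. cinner x (w i) *\<^sub>C u i) ` cball 0 1 \<subseteq> C" by blast
    define B where "B = (\<lambda>c. c *\<^sub>C u k) ` cball 0 (norm (w k))"
    have cB: "compact B" unfolding B_def
      by (intro compact_continuous_image linear_continuous_on bounded_linear_scaleC_left compact_cball)
    have inB: "cinner x (w k) *\<^sub>C u k \<in> B" if "norm x \<le> 1" for x
    proof -
      have "cmod (cinner x (w k)) \<le> norm (w k)"
        using norm_cinner[of x "w k"] that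
        by (meson mult_left_le_one_le norm_ge_zero order.trans)
      then show ?thesis unfolding B_def by (intro imageI) simp
    qed
    show ?case
    proof (intro exI conjI)
      show "compact {x + y | x y. x \<in> C \<and> y \<in> B}" by (rule compact_sums[OF C(1) cB])
      show "(\<lambda>x. \<Sum>i<Suc k. cinner x (w i) *\<^sub>C u i) ` cball 0 1 \<subseteq> {x + y | x y. x \<in> C \<and> y \<in> B}"
      proof (rule image_subsetI)
        fix x :: 'a assume "x \<in> cball 0 1"
        then have "(\<Sum>i<k. cinner x (w i) *\<^sub>C u i) \<in> C" "cinner x (w k) *\<^sub>C u k \<in> B"
          using C(2) inB by auto
        then show "(\<Sum>i<Suc k. cinner x (w i) *\<^sub>C u i) \<in> {x + y | x y. x \<in> C \<and> y \<in> B}"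
          unfolding sum.lessThan_Suc by blast
      qed
    qed
  qed
  then show ?thesis unfolding F by blast
qed

locale compact_op =
  fixes T :: "'a::complex_hilbert \<Rightarrow> 'a"
  assumes compact_T: "compact_operator T"
begin

lemma T_clinear: "bounded_clinear T" and T_compact: "compact (closure (T ` cball 0 1))"
  using compact_T by (auto simp: compact_operator_def)

abbreviation "P \<equiv> adjoint_op UNIV T \<circ> T"
abbreviation "E s \<equiv> eigenspace UNIV P (complex_of_real (s\<^sup>2))"

lemma cinner_P: "cinner (P x) y = cinner (T x) (T y)" "cinner x (P y) = cinner (T x) (T y)"
  by (simp_all add: cinner_adjoint[OF T_clinear, symmetric] cinner_adjoint'[OF T_clinear, symmetric])

lemma P_clinear: "bounded_clinear P"
  unfolding comp_def by (rule bounded_clinear_comp[OF bounded_clinear_adjoint[OF T_clinear] T_clinear])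

lemma csubspace_E: "csubspace (E s)"
proof -
  note lin = bounded_clinear_linear[OF P_clinear]
  show ?thesis
    by (rule complex_vector.subspaceI)
      (auto simp: eigenspace_def linear_0[OF lin] linear_add[OF lin] scaleC_add_right scaleC_scaleC
        mult.commute bounded_clinear_scaleC[OF P_clinear] simp del: o_apply)
qed

lemma cinner_E: "x \<in> E s \<Longrightarrow> cinner (T x) (T y) = of_real (s\<^sup>2) * cinner x y"
  by (simp add: eigenspace_def cinner_scaleC_left flip: cinner_P(1))

lemma norm_T_E: 
  assumes "x \<in> E s" shows "norm (T x) = \<bar>s\<bar> * norm x"
proof -
  have "complex_of_real ((norm (T x))\<^sup>2) = of_real (s\<^sup>2 * (norm x)\<^sup>2)"
    unfolding of_real_mult cinner_self[symmetric] by (rule cinner_E[OF assms])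
  then have "(norm (T x))\<^sup>2 = (\<bar>s\<bar> * norm x)\<^sup>2" unfolding of_real_eq_iff by (simp add: power_mult_distrib)
  then show ?thesis by (simp add: power2_eq_iff_nonneg)
qed

lemma E_orthogonal:
  assumes "0 < s" "0 < t" "s \<noteq> t" "x \<in> E s" "y \<in> E t"
  shows "cinner x y = 0"
proof -
  have "of_real (s\<^sup>2) * cinner x y = cinner (T x) (T y)" by (rule cinner_E[OF assms(4), symmetric])
  also have "\<dots> = cnj (cinner (T y) (T x))" by (rule cinner_commute)
  also have "\<dots> = of_real (t\<^sup>2) * cinner x y"
    unfolding cinner_E[OF assms(5)] by (simp add: cinner_commute[of x y])
  finally have "s\<^sup>2 = t\<^sup>2 \<or> cinner x y = 0"
    unfolding mult_cancel_right of_real_eq_iff by blast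
  then show ?thesis using assms(1-3) by (auto simp: power2_eq_iff_nonneg)
qed

text \<open>
  The images have pairwise distance more than \<open>e\<close>, so each of them needs its own ball in a covering of
  the image of the unit ball by balls of radius \<open>e/2\<close>.
\<close>

lemma orthogonal_images_bounded:
  assumes e: "e > 0"
  obtains k where "\<And>X. finite X \<Longrightarrow> (\<forall>x\<in>X. norm x = 1 \<and> norm (T x) \<ge> e) \<Longrightarrow>
     (\<forall>x\<in>X. \<forall>y\<in>X. x \<noteq> y \<longrightarrow> cinner (T x) (T y) = 0) \<Longrightarrow> card X \<le> k"
proof -
  have "e / 2 > 0" using e by simp
  then obtain C where C: "finite C" "closure (T ` cball 0 1) \<subseteq> (\<Union>x\<in>C. ball x (e/2))"
    using T_compact unfolding compact_eq_totally_bounded by meson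
  have "\<forall>x. norm x = 1 \<longrightarrow> (\<exists>z\<in>C. dist z (T x) < e / 2)"
  proof (intro allI impI)
    fix x :: 'a assume "norm x = 1"
    then have "T x \<in> closure (T ` cball 0 1)" by (intro subsetD[OF closure_subset] imageI) simp
    then have "T x \<in> (\<Union>x\<in>C. ball x (e/2))" using C(2) by (rule subsetD[rotated])
    then show "\<exists>z\<in>C. dist z (T x) < e / 2" by auto
  qed
  then obtain h where h: "\<And>x. norm x = 1 \<Longrightarrow> h x \<in> C \<and> dist (h x) (T x) < e / 2" by metis
  have "card X \<le> card C" if X: "finite X" "\<forall>x\<in>X. norm x = 1 \<and> norm (T x) \<ge> e"
    "\<forall>x\<in>X. \<forall>y\<in>X. x \<noteq> y \<longrightarrow> cinner (T x) (T y) = 0" for X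
  proof (rule card_inj_on_le[OF _ _ C(1)])
    show "h ` X \<subseteq> C" using h X(2) by auto
    show "inj_on h X"
    proof (rule inj_onI, rule ccontr)
      fix x y assume xy: "x \<in> X" "y \<in> X" "h x = h y" "x \<noteq> y"
      have "dist (T x) (T y) < e"
        using h[of x] h[of y] X(2) xy by (metis dist_triangle_half_r)
      then have "(norm (T x - T y))\<^sup>2 < e\<^sup>2" using e by (simp add: dist_norm power_strict_mono)
      moreover have "inner (T x) (T y) = 0" using X(3) xy by (metis Re_cinner zero_complex.sel(1))
      then have "(norm (T x - T y))\<^sup>2 = (norm (T x))\<^sup>2 + (norm (T y))\<^sup>2"
        by (simp add: power2_norm_eq_inner inner_diff_left inner_diff_right inner_commute)
      moreover have "(norm (T x))\<^sup>2 \<ge> e\<^sup>2" using X(2) xy e by (intro power_mono) auto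
      ultimately show False by (smt (verit) zero_le_power2)
    qed
  qed
  then show ?thesis by (rule that)
qed

text \<open>
  An orthonormal set of maximal cardinality in \<open>E s\<close> spans \<open>E s\<close>.
\<close>

lemma E_finite_dimensional:
  assumes s: "s > 0"
  shows "\<exists>B. finite B \<and> E s = cspan B"
proof -
  obtain k where k: "\<And>X. finite X \<Longrightarrow> (\<forall>x\<in>X. norm x = 1 \<and> norm (T x) \<ge> s) \<Longrightarrow>
     (\<forall>x\<in>X. \<forall>y\<in>X. x \<noteq> y \<longrightarrow> cinner (T x) (T y) = 0) \<Longrightarrow> card X \<le> k"
    by (rule orthogonal_images_bounded[OF s]) (rule that)
  define Q where "Q B \<longleftrightarrow> finite B \<and> B \<subseteq> E s \<and> orthonormal_on B (\<lambda>x. x)" for B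
  have bound: "card B \<le> k" if "Q B" for B
  proof (rule k)
    have B: "finite B" "\<And>x. x \<in> B \<Longrightarrow> x \<in> E s" "orthonormal_on B (\<lambda>x. x)"
      using that unfolding Q_def by blast+
    show "finite B" by (rule B)
    show "\<forall>x\<in>B. norm x = 1 \<and> s \<le> norm (T x)"
    proof
      fix x assume x: "x \<in> B"
      show "norm x = 1 \<and> s \<le> norm (T x)"
        using norm_T_E[OF B(2)[OF x]] orthonormal_on_norm[OF B(3) x] by simp
    qed
    show "\<forall>x\<in>B. \<forall>y\<in>B. x \<noteq> y \<longrightarrow> cinner (T x) (T y) = 0"
    proof (intro ballI impI)
      fix x y assume xy: "x \<in> B" "y \<in> B" "x \<noteq> y"
      show "cinner (T x) (T y) = 0"
        unfolding cinner_E[OF B(2)[OF xy(1)]] using orthonormal_onD[OF B(3) xy(1,2)] xy(3) by simp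
    qed
  qed
  have "Q {}" by (simp add: Q_def orthonormal_on_def)
  then obtain B where B: "Q B" and max: "\<And>C. Q C \<Longrightarrow> card C \<le> card B"
    using ex_has_greatest_nat[of Q "{}" card "Suc k"] bound by (auto simp: less_Suc_eq_le)
  have "E s \<subseteq> cspan B"
  proof (rule ccontr)
    assume "\<not> E s \<subseteq> cspan B"
    then obtain x where x: "x \<in> E s" "x \<notin> cspan B" by blast
    define y where "y = x - (\<Sum>b\<in>B. cinner x b *\<^sub>C b)"
    have sum: "(\<Sum>b\<in>B. cinner x b *\<^sub>C b) \<in> cspan B"
      by (intro complex_vector.span_sum complex_vector.span_scale complex_vector.span_base)
    then have "y \<noteq> 0" using x(2) by (auto simp: y_def)
    have sumE: "(\<Sum>b\<in>B. cinner x b *\<^sub>C b) \<in> E s"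
    proof (rule complex_vector.subspace_sum[OF csubspace_E])
      fix b assume "b \<in> B"
      then have "b \<in> E s" using B unfolding Q_def by blast
      then show "cinner x b *\<^sub>C b \<in> E s" by (rule complex_vector.subspace_scale[OF csubspace_E])
    qed
    have yE: "y \<in> E s" unfolding y_def by (intro complex_vector.subspace_diff[OF csubspace_E] x sumE)
    have yB: "cinner y b = 0" if "b \<in> B" for b
      using cinner_orthonormal_sum[of B "\<lambda>x. x" B b "cinner x"] that B
      by (simp add: y_def cinner_diff_left Q_def)
    define z where "z = inverse (norm y) *\<^sub>R y"
    have zz: "cinner z z = 1"
      unfolding z_def by (rule cinner_normalized[OF \<open>y \<noteq> 0\<close>])
    have zB: "cinner z b = 0" "cinner b z = 0" if "b \<in> B" for b
      using yB[OF that] by (auto simp: z_def cinner_scaleR_left cinner_scaleR_right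
          intro: trans[OF cinner_commute])
    have zE: "z \<in> E s" unfolding z_def scaleC_of_real[symmetric]
      by (intro complex_vector.subspace_scale[OF csubspace_E] yE)
    have zn: "z \<notin> B" using zB(1)[of z] zz by auto
    then have neq: "b \<noteq> z" "z \<noteq> b" if "b \<in> B" for b using that by blast+
    have "Q (insert z B)"
      using B zz zB zE neq unfolding Q_def orthonormal_on_def by simp
    with zn show False using max[of "insert z B"] B by (simp add: Q_def)
  qed
  moreover have "cspan B \<subseteq> E s"
    using B unfolding Q_def by (intro complex_vector.span_minimal csubspace_E) blast
  ultimately have "E s = cspan B" by (rule subset_antisym)
  then show ?thesis using B unfolding Q_def by blast
qed

lemma dim_E_nonzero_ex:
  assumes "cdim (E s) \<noteq> 0"
  shows "\<exists>x\<in>E s. norm x = 1"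
proof -
  have "E s \<noteq> {0}" using assms cdim_zero by metis
  then obtain x where x: "x \<in> E s" "x \<noteq> 0" using csubspace_E[of s] complex_vector.subspace_0 by blast
  then show ?thesis
    by (intro bexI[of _ "of_real (inverse (norm x)) *\<^sub>C x"] complex_vector.subspace_scale[OF csubspace_E])
      (auto simp: norm_scaleC norm_inverse simp del: of_real_inverse)
qed

lemma finitely_many_singular_values:
  assumes e: "e > 0"
  shows "finite {s. s \<ge> e \<and> cdim (E s) \<noteq> 0}" (is "finite ?S")
proof (rule ccontr)
  assume inf: "infinite ?S"
  obtain k where k: "\<And>X. finite X \<Longrightarrow> (\<forall>x\<in>X. norm x = 1 \<and> norm (T x) \<ge> e) \<Longrightarrow>
     (\<forall>x\<in>X. \<forall>y\<in>X. x \<noteq> y \<longrightarrow> cinner (T x) (T y) = 0) \<Longrightarrow> card X \<le> k"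
    by (rule orthogonal_images_bounded[OF e]) (rule that)
  obtain S where S: "S \<subseteq> ?S" "finite S" "card S = Suc k"
    using infinite_arbitrarily_large[OF inf] by blast
  have "\<forall>s\<in>S. \<exists>x. x \<in> E s \<and> norm x = 1" using S(1) dim_E_nonzero_ex by blast
  then obtain x where x: "\<And>s. s \<in> S \<Longrightarrow> x s \<in> E s \<and> norm (x s) = 1" by metis
  have orth: "cinner (x s) (x t) = 0" if "s \<in> S" "t \<in> S" "s \<noteq> t" for s t
    using E_orthogonal[of s t] x that S(1) e by force
  have "inj_on x S"
  proof (rule inj_onI, rule ccontr)
    fix s t assume st: "s \<in> S" "t \<in> S" "x s = x t" "s \<noteq> t"
    then have "cinner (x s) (x s) = 0" using orth[of s t] by simp
    then show False using x[OF st(1)] by (simp add: cinner_self)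
  qed
  then have "card (x ` S) = Suc k" using S(3) by (simp add: card_image)
  moreover have "card (x ` S) \<le> k"
  proof (rule k)
    show "finite (x ` S)" using S(2) by simp
    show "\<forall>y\<in>x ` S. norm y = 1 \<and> e \<le> norm (T y)"
    proof safe
      fix s assume s: "s \<in> S"
      show "norm (x s) = 1" using x[OF s] by simp
      have "s \<ge> e" using s S(1) by auto
      then show "e \<le> norm (T (x s))" using norm_T_E[of "x s" s] x[OF s] e by simp
    qed
    show "\<forall>y\<in>x ` S. \<forall>z\<in>x ` S. y \<noteq> z \<longrightarrow> cinner (T y) (T z) = 0"
    proof safe
      fix s t assume st: "s \<in> S" "t \<in> S" "x s \<noteq> x t"
      then show "cinner (T (x s)) (T (x t)) = 0"
        using cinner_E[of "x s" s "x t"] x[OF st(1)] orth[of s t] by auto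
    qed
  qed
  ultimately show False by simp
qed

lemma singular_value_enumerates: "enumerates (singular_value T) (\<lambda>s. cdim (E s))"
proof -
  have eq: "singular_value T = (THE m. enumerates m (\<lambda>s. cdim (E s)))"
    unfolding singular_value_def enumerates_def ..
  show ?thesis
    unfolding eq
  proof (rule theI'[where P = "\<lambda>m. enumerates m (\<lambda>s. cdim (E s))"])
    show "\<exists>!m. enumerates m (\<lambda>s. cdim (E s))"
      using enumerates_exists[of "\<lambda>s. cdim (E s)"]
        enumerates_unique[of "\<lambda>s. cdim (E s)"] finitely_many_singular_values
      by blast
  qed
qed

lemma singular_vectors:
  obtains e where "orthonormal_on {j. singular_value T j > 0} e"
    "\<And>j. singular_value T j > 0 \<Longrightarrow> e j \<in> E (singular_value T j)"
    "\<And>s. s > 0 \<Longrightarrow> E s = cspan (e ` {j. singular_value T j = s})"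
proof -
  obtain e where e: "orthonormal_on {j. singular_value T j > 0} e \<and>
     (\<forall>j. singular_value T j > 0 \<longrightarrow> e j \<in> E (singular_value T j)) \<and>
     (\<forall>s>0. E s = cspan (e ` {j. singular_value T j = s}))"
    using orthonormal_enumeration[OF singular_value_enumerates E_finite_dimensional E_orthogonal] ..
  show ?thesis
  proof (rule that[of e])
    show "orthonormal_on {j. singular_value T j > 0} e" using e by (rule conjunct1)
    show "e j \<in> E (singular_value T j)" if "singular_value T j > 0" for j
      using e[THEN conjunct2, THEN conjunct1] that by blast
    show "E s = cspan (e ` {j. singular_value T j = s})" if "s > 0" for s
      using e[THEN conjunct2, THEN conjunct2] that by blast
  qed
qed

lemma singular_value_facts: "decseq (singular_value T)" "0 \<le> singular_value T j"
  using singular_value_enumerates by (auto simp: enumerates_def)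

text \<open>
  If the form of \<open>P\<close> had a supremum \<open>r > m\<^sub>n\<^sup>2\<close> on the unit sphere of \<open>M\<close>, with \<open>m\<^sub>n\<close> the singular value at \<open>n\<close>, then
  compactness would turn the approximate eigenvectors into an eigenvector of \<open>P\<close> in \<open>M\<close> with
  eigenvalue \<open>r\<close>.  The eigenvectors for \<open>r\<close> are in the span of those \<open>e j\<close>, \<open>j < n\<close>, to which \<open>M\<close> is
  orthogonal.
\<close>

lemma norm_T_orthogonal_le:
  fixes e :: "nat \<Rightarrow> 'a" and n :: nat
  defines "M \<equiv> {y. \<forall>x\<in>e ` {j. j < n \<and> singular_value T j > 0}. cinner y x = 0}"
  assumes e: "\<And>j. singular_value T j > 0 \<Longrightarrow> e j \<in> E (singular_value T j)"
    "\<And>s. s > 0 \<Longrightarrow> E s = cspan (e ` {j. singular_value T j = s})"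
    and y: "y \<in> M"
  shows "norm (T y) \<le> singular_value T n * norm y"
proof (cases "y = 0")
  case True
  then show ?thesis using linear_0[OF bounded_clinear_linear[OF T_clinear]] by simp
next
  case False
  let ?m = "singular_value T"
  have M: "csubspace M" "closed M" unfolding M_def
    by (rule csubspace_orthogonal, rule closed_orthogonal_complement)
  note bP = bounded_clinear_bounded_linear[OF P_clinear]
  have PM: "P x \<in> M" if x: "x \<in> M" for x
    unfolding M_def
  proof safe
    fix j assume j: "j < n" "?m j > 0"
    have "cinner (P x) (e j) = cinner x (P (e j))" by (simp only: cinner_P)
    also have "P (e j) = of_real ((?m j)\<^sup>2) *\<^sub>C e j" using e(1)[OF j(2)] by (simp add: eigenspace_def)
    also have "cinner x (of_real ((?m j)\<^sup>2) *\<^sub>C e j) = 0"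
      using x j unfolding cinner_scaleC_right M_def by auto
    finally show "cinner (P x) (e j) = 0" .
  qed
  have Pi: "inner (P x) y = inner (T x) (T y)" "inner x (P y) = inner (T x) (T y)" for x y
    using cinner_P[of x y] by (metis Re_cinner)+
  have pos: "positive_on M P" unfolding positive_on_def
    using PM by (simp only: Pi) auto
  obtain r where r: "r \<ge> 0" "\<And>x. x \<in> M \<Longrightarrow> inner (P x) x \<le> r * (norm x)\<^sup>2"
    "\<And>\<epsilon>. \<epsilon> > 0 \<Longrightarrow> \<exists>x\<in>M. norm x = 1 \<and> norm (r *\<^sub>R x - P x) < \<epsilon>"
    using approximate_top_eigenvector[OF csubspace_subspace[OF M(1)] bP pos y False] by blast
  have "r \<le> (?m n)\<^sup>2"
  proof (rule ccontr)
    assume "\<not> r \<le> (?m n)\<^sup>2"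
    then have rm: "r > (?m n)\<^sup>2" by simp
    then have r0: "r > 0" by (smt (verit) zero_le_power2)
    have "\<forall>k. \<exists>x. x \<in> M \<and> norm x = 1 \<and> norm (r *\<^sub>R x - P x) < inverse (real (Suc k))"
      using r(3) by (meson inverse_positive_iff_positive of_nat_0_less_iff zero_less_Suc)
    then obtain X where X: "\<And>k. X k \<in> M" "\<And>k. norm (X k) = 1"
      "\<And>k. norm (r *\<^sub>R X k - P (X k)) < inverse (real (Suc k))" by metis
    have "\<forall>k. T (X k) \<in> closure (T ` cball 0 1)"
      using X(2) by (intro allI subsetD[OF closure_subset] imageI) simp
    moreover have "seq_compact (closure (T ` cball 0 1))"
      using T_compact by (rule compact_imp_seq_compact)
    ultimately obtain l \<sigma> where l0: "strict_mono (\<sigma> :: nat \<Rightarrow> nat)" "((\<lambda>k. T (X k)) \<circ> \<sigma>) \<longlonglongrightarrow> l"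
      using seq_compactE[of "closure (T ` cball 0 1)" "\<lambda>k. T (X k)"] by blast
    then have l: "strict_mono \<sigma>" "(\<lambda>k. T (X (\<sigma> k))) \<longlonglongrightarrow> l" by (simp_all add: comp_def)
    have "(\<lambda>k. P (X (\<sigma> k))) \<longlonglongrightarrow> adjoint_op UNIV T l"
      unfolding comp_def
      by (intro bounded_linear.tendsto[OF bounded_clinear_bounded_linear[OF bounded_clinear_adjoint[OF T_clinear]]] l)
    moreover have lim0: "(\<lambda>k. r *\<^sub>R X (\<sigma> k) - P (X (\<sigma> k))) \<longlonglongrightarrow> 0"
    proof -
      have "(\<lambda>k. r *\<^sub>R X k - P (X k)) \<longlonglongrightarrow> 0"
        by (rule Lim_null_comparison[OF _ LIMSEQ_inverse_real_of_nat])
          (use X(3) in \<open>auto intro!: always_eventually less_imp_le simp: comp_def\<close>)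
      from LIMSEQ_subseq_LIMSEQ[OF this l(1)] show ?thesis unfolding comp_def .
    qed
    ultimately have "(\<lambda>k. r *\<^sub>R X (\<sigma> k) - P (X (\<sigma> k)) + P (X (\<sigma> k))) \<longlonglongrightarrow> 0 + adjoint_op UNIV T l"
      by (intro tendsto_add)
    then have "(\<lambda>k. inverse r *\<^sub>R (r *\<^sub>R X (\<sigma> k))) \<longlonglongrightarrow> inverse r *\<^sub>R adjoint_op UNIV T l"
      by (intro tendsto_scaleR tendsto_const) simp
    then obtain z where z: "(\<lambda>k. X (\<sigma> k)) \<longlonglongrightarrow> z" using r0 by auto
    have zM: "z \<in> M" by (rule closed_sequentially[OF M(2) _ z]) (simp add: X(1))
    have "(\<lambda>k. norm (X (\<sigma> k))) \<longlonglongrightarrow> norm z" using z by (rule tendsto_norm)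
    then have nz: "norm z = 1" unfolding X(2) using tendsto_const LIMSEQ_unique[of "\<lambda>k. 1" "norm z" 1] by simp
    have "(\<lambda>k. r *\<^sub>R X (\<sigma> k) - P (X (\<sigma> k))) \<longlonglongrightarrow> r *\<^sub>R z - P z"
      by (intro tendsto_intros bounded_linear.tendsto[OF bP] z)
    then have "r *\<^sub>R z - P z = 0" using lim0 by (rule LIMSEQ_unique)
    then have "P z = of_real r *\<^sub>C z" by (simp only: scaleC_of_real) simp
    then have "z \<in> E (sqrt r)" using r0 by (simp add: eigenspace_def)
    then have "z \<in> cspan (e ` {j. ?m j = sqrt r})" using e(2)[of "sqrt r"] r0 by simp
    moreover have "?m n < sqrt r" using rm by (simp add: real_less_rsqrt)
    then have "j < n" if "?m j = sqrt r" for j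
      using that singular_value_facts(1) unfolding decseq_def by (metis leI linorder_not_le)
    then have "cinner z x = 0" if "x \<in> e ` {j. ?m j = sqrt r}" for x
      using that zM r0 unfolding M_def by auto
    ultimately have "cinner z z = 0" by (metis orthogonal_span)
    then show False using nz by (simp add: cinner_self)
  qed
  then have "(norm (T y))\<^sup>2 \<le> (?m n)\<^sup>2 * (norm y)\<^sup>2"
    using r(2)[OF y] unfolding Pi power2_norm_eq_inner[of "T y"]
    by (meson mult_right_mono order.trans zero_le_power2)
  then show ?thesis
    using singular_value_facts(2)[of n] by (metis power_mult_distrib power2_le_imp_le mult_nonneg_nonneg norm_ge_zero)
qed

text \<open>
  Truncation along the eigenvectors of \<open>P\<close>.  Together with \<open>singular_value_le\<close> this says that the
  singular value at \<open>n\<close> is the distance of \<open>T\<close> to the operators of rank at most \<open>n\<close>.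
\<close>

lemma finite_rank_approximation:
  "\<exists>F. finite_rank n F \<and> (\<forall>x. norm (T x - F x) \<le> singular_value T n * norm x)"
proof -
  let ?m = "singular_value T"
  obtain e where e: "orthonormal_on {j. ?m j > 0} e" "\<And>j. ?m j > 0 \<Longrightarrow> e j \<in> E (?m j)"
    "\<And>s. s > 0 \<Longrightarrow> E s = cspan (e ` {j. ?m j = s})"
    by (rule singular_vectors) (rule that)
  let ?J = "{j. j < n \<and> ?m j > 0}"
  define F where "F x = (\<Sum>i<n. cinner x (if ?m i > 0 then e i else 0) *\<^sub>C T (e i))" for x
  have "finite_rank n F" by (auto simp: finite_rank_def F_def[abs_def])
  moreover have "norm (T x - F x) \<le> ?m n * norm x" for x
  proof -
    define y where "y = x - (\<Sum>j\<in>?J. cinner x (e j) *\<^sub>C e j)"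
    have sub: "?J \<subseteq> {j. ?m j > 0}" by auto
    have yorth: "cinner y (e j) = 0" if "j \<in> ?J" for j
      using cinner_orthonormal_sum[OF e(1) _ sub, of j "\<lambda>j. cinner x (e j)"] that
      by (simp add: y_def cinner_diff_left)
    have "F x = (\<Sum>j\<in>?J. cinner x (e j) *\<^sub>C T (e j))"
      unfolding F_def by (rule sum.mono_neutral_cong_right) auto
    also have "\<dots> = T (\<Sum>j\<in>?J. cinner x (e j) *\<^sub>C e j)"
      by (rule clinear_sum[OF T_clinear, symmetric])
    finally have "T x - F x = T y"
      using linear_diff[OF bounded_clinear_linear[OF T_clinear]]
      by (simp add: y_def)
    also have "norm (T y) \<le> ?m n * norm y"
      by (rule norm_T_orthogonal_le[OF e(2,3)]) (use yorth in auto)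
    also have "norm y \<le> norm x"
    proof -
      have "cinner (x - y) y = 0"
      proof -
        have "cinner y (x - y) = 0"
          unfolding y_def[symmetric] by (subst y_def) (simp add: cinner_sum_right cinner_scaleC_right yorth)
        then show ?thesis by (metis cinner_commute complex_cnj_zero)
      qed
      then have "inner (x - y) y = 0" by (metis Re_cinner zero_complex.sel(1))
      then have "(norm x)\<^sup>2 = (norm (x - y))\<^sup>2 + (norm y)\<^sup>2"
        by (simp add: power2_norm_eq_inner inner_diff_left inner_diff_right inner_commute)
      then show ?thesis by (smt (verit) norm_ge_zero power2_le_imp_le zero_le_power2)
    qed
    finally show ?thesis using singular_value_facts(2)[of n] by (simp add: mult_left_mono)
  qed
  ultimately show ?thesis by blast
qed

text \<open>
  Some nonzero combination \<open>x\<close> of the first \<open>n + 1\<close> eigenvectors is in the kernel of \<open>F\<close>, and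
  \<open>m\<^sub>n \<parallel>x\<parallel> \<le> \<parallel>T x\<parallel> = \<parallel>(T - F) x\<parallel>\<close>, where \<open>m\<^sub>n\<close> is the singular value at \<open>n\<close>.
\<close>

lemma singular_value_le:
  assumes F: "finite_rank n F" and K: "K \<ge> 0" "\<And>x. norm (T x - F x) \<le> K * norm x"
  shows "singular_value T n \<le> K"
proof (cases "singular_value T n > 0")
  case True
  let ?m = "singular_value T"
  obtain e where e: "orthonormal_on {j. ?m j > 0} e" "\<And>j. ?m j > 0 \<Longrightarrow> e j \<in> E (?m j)"
    by (rule singular_vectors) (rule that)
  have ge: "?m j \<ge> ?m n" if "j \<le> n" for j using that singular_value_facts(1) by (simp add: decseq_def)
  then have sub: "{..n} \<subseteq> {j. ?m j > 0}" using True by force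
  have on: "orthonormal_on {..n} e" by (rule orthonormal_on_subset[OF e(1) sub])
  obtain c where c: "\<exists>j\<le>n. c j \<noteq> 0" "F (\<Sum>j\<le>n. c j *\<^sub>C e j) = 0"
    using kernel_of_finite_rank[OF F on] by blast
  define x where "x = (\<Sum>j\<le>n. c j *\<^sub>C e j)"
  have nx: "(norm x)\<^sup>2 = (\<Sum>j\<le>n. (cmod (c j))\<^sup>2)"
    unfolding x_def by (rule norm_orthonormal_sum[OF on]) auto
  have "(norm x)\<^sup>2 \<noteq> 0" unfolding nx using c(1) by (subst sum_nonneg_eq_0_iff) auto
  then have x0: "norm x > 0" by simp
  have "cinner (T x) (T x) = (\<Sum>j\<le>n. c j * cinner (T (e j)) (T x))"
    by (subst x_def, subst clinear_sum[OF T_clinear]) (simp add: cinner_sum_left cinner_scaleC_left)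
  also have "\<dots> = (\<Sum>j\<le>n. c j * (of_real ((?m j)\<^sup>2) * cnj (c j)))"
  proof (intro sum.cong refl)
    fix j assume j: "j \<in> {..n}"
    then have "cinner (T (e j)) (T x) = of_real ((?m j)\<^sup>2) * cinner (e j) x"
      using sub by (intro cinner_E e(2)) auto
    also have "cinner (e j) x = cnj (cinner x (e j))" by (rule cinner_commute)
    also have "cinner x (e j) = c j"
      unfolding x_def using cinner_orthonormal_sum[OF on, of "{..n}" j c] j by simp
    finally show "c j * cinner (T (e j)) (T x) = c j * (of_real ((?m j)\<^sup>2) * cnj (c j))" by simp
  qed
  also have "\<dots> = of_real (\<Sum>j\<le>n. (?m j)\<^sup>2 * (cmod (c j))\<^sup>2)"
    unfolding of_real_sum of_real_mult complex_norm_square by (intro sum.cong refl) (simp add: mult_ac)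
  finally have "(norm (T x))\<^sup>2 = (\<Sum>j\<le>n. (?m j)\<^sup>2 * (cmod (c j))\<^sup>2)"
    unfolding cinner_self of_real_eq_iff .
  also have "\<dots> \<ge> (\<Sum>j\<le>n. (?m n)\<^sup>2 * (cmod (c j))\<^sup>2)"
    using ge True by (intro sum_mono mult_right_mono power_mono) auto
  also have "(\<Sum>j\<le>n. (?m n)\<^sup>2 * (cmod (c j))\<^sup>2) = (?m n * norm x)\<^sup>2"
    by (simp add: nx power_mult_distrib sum_distrib_left)
  finally have "?m n * norm x \<le> norm (T x)" by (rule power2_le_imp_le) simp
  also have "norm (T x) \<le> K * norm x" using K(2)[of x] c(2) by (simp add: x_def)
  finally show ?thesis using x0 by simp
next
  case False
  then show ?thesis using K(1) by simp
qed

end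

lemma compact_operatorI_approx:
  assumes T: "bounded_clinear T"
    and approx: "\<And>\<epsilon>. \<epsilon> > 0 \<Longrightarrow> \<exists>n F. finite_rank n F \<and> (\<forall>x. norm (T x - F x) \<le> \<epsilon> * norm x)"
  shows "compact_operator T"
proof -
  have "\<exists>k. finite k \<and> closure (T ` cball 0 1) \<subseteq> (\<Union>x\<in>k. ball x e)" if e: "e > 0" for e
  proof -
    obtain n F where F: "finite_rank n F" "\<And>x. norm (T x - F x) \<le> e / 3 * norm x"
      using approx[of "e / 3"] e by auto
    obtain C where C: "compact C" "F ` cball 0 1 \<subseteq> C" using finite_rank_image_compact[OF F(1)] by blast
    obtain k where k: "finite k" "C \<subseteq> (\<Union>x\<in>k. ball x (e / 3))"
      using C(1) e unfolding compact_eq_totally_bounded by (meson divide_pos_pos zero_less_numeral)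
    have "T ` cball 0 1 \<subseteq> (\<Union>x\<in>k. cball x (e * 2 / 3))"
    proof safe
      fix x :: 'a assume "x \<in> cball 0 1"
      then have x: "norm x \<le> 1" by simp
      then have "F x \<in> C" using C(2) by auto
      then obtain z where z: "z \<in> k" "dist z (F x) < e / 3" using k(2) by auto
      have "e / 3 * norm x \<le> e / 3 * 1" using x e by (intro mult_left_mono) auto
      then have "dist (F x) (T x) \<le> e / 3" using F(2)[of x] by (simp add: dist_norm norm_minus_commute)
      then have "dist z (T x) \<le> e * 2 / 3" using z(2) dist_triangle[of z "T x" "F x"] by simp
      then show "T x \<in> (\<Union>x\<in>k. cball x (e * 2 / 3))" using z(1) by auto
    qed
    then have "closure (T ` cball 0 1) \<subseteq> (\<Union>x\<in>k. cball x (e * 2 / 3))"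
      using k(1) by (intro closure_minimal closed_UN) auto
    also have "\<dots> \<subseteq> (\<Union>x\<in>k. ball x e)" using e by (intro UN_mono) auto
    finally show ?thesis using k(1) by blast
  qed
  then have "compact (closure (T ` cball 0 1))"
    unfolding compact_eq_totally_bounded by (auto simp: complete_eq_closed)
  then show ?thesis using T by (simp add: compact_operator_def)
qed

text \<open>
  Membership in the ideal in terms of approximation by operators of finite rank.  The arguments on
  traces use this in place of singular values.
\<close>

lemma weak_lorentz_iff:
  assumes g: "\<And>j. g (real j) > 0" and g0: "(\<lambda>j. g (real j)) \<longlonglongrightarrow> 0"
  shows "T \<in> weak_lorentz g \<longleftrightarrow> bounded_clinear T \<and>
    (\<exists>K\<ge>0. \<forall>n. \<exists>F. finite_rank n F \<and> (\<forall>x. norm (T x - F x) \<le> K * g (real n) * norm x))"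
proof
  assume "T \<in> weak_lorentz g"
  then have T: "compact_operator T" and O: "singular_value T \<in> O(\<lambda>j. g (real j))"
    by (auto simp: weak_lorentz_def)
  interpret compact_op T by unfold_locales (fact T)
  obtain c where c: "c > 0" "eventually (\<lambda>j. norm (singular_value T j) \<le> c * norm (g (real j))) sequentially"
    using landau_o.bigE[OF O] by auto
  then obtain N where N0: "\<forall>j\<ge>N. norm (singular_value T j) \<le> c * norm (g (real j))"
    unfolding eventually_sequentially by blast
  have N: "singular_value T j \<le> c * g (real j)" if "j \<ge> N" for j
    using N0 that g[of j] singular_value_facts(2)[of j] by (auto simp: less_imp_le)
  define K where "K = c + (\<Sum>j<N. singular_value T j / g (real j))"
  have nn: "(\<Sum>j<N. singular_value T j / g (real j)) \<ge> 0"
    using g singular_value_facts(2) by (intro sum_nonneg divide_nonneg_pos) auto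
  have le: "singular_value T n \<le> K * g (real n)" for n
  proof (cases "n < N")
    case True
    have "singular_value T n / g (real n) \<le> (\<Sum>j<N. singular_value T j / g (real j))"
      using True g singular_value_facts(2)
      by (intro member_le_sum) (auto intro: divide_nonneg_pos)
    then have "singular_value T n / g (real n) \<le> K" using c(1) by (simp add: K_def)
    then show ?thesis using g[of n] by (simp add: field_simps)
  next
    case False
    then have "singular_value T n \<le> c * g (real n)" using N by simp
    also have "\<dots> \<le> K * g (real n)" using nn g[of n] by (simp add: K_def)
    finally show ?thesis .
  qed
  have "\<exists>F. finite_rank n F \<and> (\<forall>x. norm (T x - F x) \<le> K * g (real n) * norm x)" for n
    using finite_rank_approximation[of n] le[of n] by (meson mult_right_mono norm_ge_zero order.trans)
  then show "bounded_clinear T \<and>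
    (\<exists>K\<ge>0. \<forall>n. \<exists>F. finite_rank n F \<and> (\<forall>x. norm (T x - F x) \<le> K * g (real n) * norm x))"
    using T_clinear nn c(1) by (intro conjI exI[of _ K]) (auto simp: K_def)
next
  assume "bounded_clinear T \<and>
    (\<exists>K\<ge>0. \<forall>n. \<exists>F. finite_rank n F \<and> (\<forall>x. norm (T x - F x) \<le> K * g (real n) * norm x))"
  then obtain K where T: "bounded_clinear T" and K: "K \<ge> 0"
    "\<And>n. \<exists>F. finite_rank n F \<and> (\<forall>x. norm (T x - F x) \<le> K * g (real n) * norm x)" by blast
  have "compact_operator T"
  proof (rule compact_operatorI_approx[OF T])
    fix \<epsilon> :: real assume \<epsilon>: "\<epsilon> > 0"
    have "(\<lambda>j. K * g (real j)) \<longlonglongrightarrow> K * 0" by (intro tendsto_intros g0)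
    then have "eventually (\<lambda>j. K * g (real j) < \<epsilon>) sequentially" using \<epsilon> by (simp add: order_tendstoD(2))
    then obtain n where n: "K * g (real n) < \<epsilon>" unfolding eventually_sequentially by blast
    obtain F where "finite_rank n F" "\<And>x. norm (T x - F x) \<le> K * g (real n) * norm x" using K(2) by blast
    then show "\<exists>n F. finite_rank n F \<and> (\<forall>x. norm (T x - F x) \<le> \<epsilon> * norm x)"
      using n by (meson less_imp_le mult_right_mono norm_ge_zero order.trans)
  qed
  then interpret compact_op T by unfold_locales
  have "singular_value T n \<le> K * g (real n)" for n
    using K(2)[of n] singular_value_le[of n _ "K * g (real n)"] K(1) g[of n] by (meson less_imp_le mult_nonneg_nonneg)
  then have "singular_value T \<in> O(\<lambda>j. g (real j))"
    using g singular_value_facts(2) by (intro bigoI[of _ K] always_eventually) (auto simp: less_imp_le)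
  then show "T \<in> weak_lorentz g" using \<open>compact_operator T\<close> by (simp add: weak_lorentz_def)
qed

section \<open>The negative power as a diagonal operator\<close>

locale discrete_finite_selfadjoint = discrete_selfadjoint +
  assumes finite_mult: "\<And>t. t > 0 \<Longrightarrow> \<exists>B. finite B \<and> eigenspace D A (complex_of_real t) = cspan B"
begin

abbreviation "E s \<equiv> eigenspace D A (complex_of_real (1 / s))"

lemma dim_eigenspace_finite:
  assumes "e > 0" shows "finite {s. s \<ge> e \<and> cdim (E s) \<noteq> 0}"
proof (rule finite_subset[rotated])
  show "finite ((\<lambda>t. 1 / t) ` {t. 0 \<le> t \<and> t \<le> 1 / e \<and> eigenspace D A (complex_of_real t) \<noteq> {0}})"
    by (intro finite_imageI finitely_many_eigenvalues)
  show "{s. s \<ge> e \<and> cdim (E s) \<noteq> 0} \<subseteq>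
      (\<lambda>t. 1 / t) ` {t. 0 \<le> t \<and> t \<le> 1 / e \<and> eigenspace D A (complex_of_real t) \<noteq> {0}}"
  proof (rule subsetI)
    fix s assume "s \<in> {s. s \<ge> e \<and> cdim (E s) \<noteq> 0}"
    then have s: "s \<ge> e" "cdim (E s) \<noteq> 0" by simp_all
    have "E s \<noteq> {0}" using s(2) cdim_zero by metis
    then show "s \<in> (\<lambda>t. 1 / t) ` {t. 0 \<le> t \<and> t \<le> 1 / e \<and> eigenspace D A (complex_of_real t) \<noteq> {0}}"
      using s(1) assms by (intro image_eqI[of _ _ "1 / s"]) (auto simp: frac_le)
  qed
qed

lemma pos_eigenvalue_enumeration:
  obtains m where "enumerates m (\<lambda>s. cdim (E s))"
    "\<And>j. pos_eigenvalue D A j = (if m j = 0 then \<infinity> else ereal (1 / m j))"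
proof -
  let ?f = "\<lambda>s. cdim (E s)"
  obtain m where m: "enumerates m ?f"
    using enumerates_exists[of ?f] dim_eigenspace_finite by blast
  have m_nonneg: "m j \<ge> 0" for j using m by (simp add: enumerates_def)
  define l where "l j = (if m j = 0 then \<infinity> else ereal (1 / m j))" for j
  \<comment> \<open>reciprocals exchange the increasing enumerations in \<open>(0,\<infinity>]\<close> and the decreasing ones in \<open>[0,\<infinity>)\<close>\<close>
  define Q where "Q l \<longleftrightarrow> mono l \<and> (\<forall>j. 0 < l j) \<and>
     (\<forall>t>0. finite {j. l j = ereal t} \<and>
            card {j. l j = ereal t} = cdim (eigenspace D A (complex_of_real t)))"
    for l :: "nat \<Rightarrow> ereal"
  have "Q l"
    unfolding Q_def
  proof (intro conjI allI impI)
    show "mono l"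
    proof (rule monoI)
      fix i j :: nat assume "i \<le> j"
      then have "m j \<le> m i" using m by (simp add: enumerates_def decseq_def)
      then show "l i \<le> l j"
        using m_nonneg[of i] m_nonneg[of j] by (auto simp: l_def frac_le)
    qed
    show "0 < l j" for j using m_nonneg[of j] by (auto simp: l_def)
    fix t :: real assume t: "t > 0"
    have eq: "{j. l j = ereal t} = {j. m j = 1 / t}"
      using t by (auto simp: l_def field_simps)
    show "finite {j. l j = ereal t}" unfolding eq using m t by (simp add: enumerates_def)
    show "card {j. l j = ereal t} = cdim (eigenspace D A (complex_of_real t))"
      unfolding eq using m t by (simp add: enumerates_def)
  qed
  moreover have "l' = l" if Q: "Q l'" for l'
  proof -
    define m' where "m' j = (if l' j = \<infinity> then 0 else 1 / real_of_ereal (l' j))" for j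
    have pos: "0 < l' j" for j using Q by (simp add: Q_def)
    have cases: "l' j = \<infinity> \<and> m' j = 0 \<or> (\<exists>r>0. l' j = ereal r \<and> m' j = 1 / r)" for j
      using pos[of j] by (cases "l' j") (auto simp: m'_def)
    have "enumerates m' ?f"
      unfolding enumerates_def
    proof (intro conjI allI impI)
      show "decseq m'"
        unfolding decseq_def
      proof (intro allI impI)
        fix i j :: nat assume "i \<le> j"
        then have "l' i \<le> l' j" using Q by (simp add: Q_def monoD)
        then show "m' j \<le> m' i" using cases[of i] cases[of j] by (auto simp: frac_le)
      qed
      show "0 \<le> m' j" for j using cases[of j] by auto
      fix s :: real assume s: "s > 0"
      have eq: "{j. m' j = s} = {j. l' j = ereal (1 / s)}"
      proof safe
        fix j
        show "l' j = ereal (1 / m' j)" if "s = m' j" using cases[of j] that s by auto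
        show "m' j = s" if "l' j = ereal (1 / s)" using cases[of j] that s by auto
      qed
      show "finite {j. m' j = s}" unfolding eq using Q s by (simp add: Q_def)
      show "card {j. m' j = s} = ?f s" unfolding eq using Q s by (simp add: Q_def)
    qed
    then have "m' = m" using enumerates_unique[OF dim_eigenspace_finite _ m] by blast
    show "l' = l"
    proof
      fix j show "l' j = l j"
        using cases[of j] \<open>m' = m\<close> by (auto simp: l_def)
    qed
  qed
  ultimately have "(THE l. Q l) = l" by (rule the_equality)
  then have "pos_eigenvalue D A = l" unfolding pos_eigenvalue_def Q_def .
  then show ?thesis using m by (intro that) (auto simp: l_def)
qed

text \<open>
  The diagonal operator has the properties that define the negative power, and an operator with these
  properties is determined on the eigenvectors, which are total.
\<close>

lemma neg_power_diag_op:
  assumes m: "enumerates m (\<lambda>s. cdim (E s))" and pos: "\<And>j. m j > 0" and p: "p > 0"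
  obtains e where "orthonormal_on UNIV e"
    "neg_power D A p = diag_op (\<lambda>j. complex_of_real (m j powr p)) e e"
proof -
  have orth: "cinner x y = 0" if "0 < s" "0 < t" "s \<noteq> t" "x \<in> E s" "y \<in> E t" for s t x y
    by (rule eigenspaces_orthogonal[OF that(4,5)]) (use that in auto)
  have fd: "\<exists>B. finite B \<and> E s = cspan B" if "s > 0" for s
    using finite_mult[of "1 / s"] that by simp
  obtain e where e: "orthonormal_on {j. m j > 0} e \<and> (\<forall>j. m j > 0 \<longrightarrow> e j \<in> E (m j)) \<and>
     (\<forall>s>0. E s = cspan (e ` {j. m j = s}))"
    using orthonormal_enumeration[OF m fd orth] ..
  have e1: "orthonormal_on UNIV e" using e pos by simp
  have e2: "e j \<in> E (m j)" for j using e pos by blast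
  have e3: "E s = cspan (e ` {j. m j = s})" if "s > 0" for s using e that by blast
  define R where "R = diag_op (\<lambda>j. complex_of_real (m j powr p)) e e"
  have bd: "cmod (complex_of_real (m j powr p)) \<le> m 0 powr p" for j
  proof -
    have "m j \<le> m 0" using m by (simp add: enumerates_def decseq_def)
    then show ?thesis using pos[of j] p by (simp add: powr_mono2)
  qed
  note R = bounded_clinear_diag_op[where a = "\<lambda>j. complex_of_real (m j powr p)", OF e1 e1 bd, folded R_def]
  have Re: "R (e j) = complex_of_real (m j powr p) *\<^sub>C e j" for j
    unfolding R_def by (rule diag_op_basis[where a = "\<lambda>j. complex_of_real (m j powr p)", OF e1 e1 bd])
  define Q where "Q R \<longleftrightarrow> bounded_clinear R \<and>
     (\<forall>x \<in> eigenspace D A 0. R x = 0) \<and>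
     (\<forall>t>0. \<forall>x \<in> eigenspace D A (complex_of_real t). R x = (t powr (- p)) *\<^sub>R x)" for R
  have "Q R"
    unfolding Q_def
  proof (intro conjI ballI allI impI)
    show "bounded_clinear R" by (fact R)
    show "R x = 0" if x: "x \<in> eigenspace D A 0" for x
    proof -
      have "cinner x (e j) = 0" for j
        using eigenspaces_orthogonal[of x 0 "e j" "1 / m j"] e2[of j] x pos[of j] by auto
      then show ?thesis by (simp add: R_def diag_op_def)
    qed
    fix t :: real and x assume t: "t > 0" and x: "x \<in> eigenspace D A (complex_of_real t)"
    have "x \<in> cspan (e ` {j. m j = 1 / t})" using e3[of "1 / t"] x t by simp
    then show "R x = (t powr (- p)) *\<^sub>R x"
    proof (induction rule: complex_vector.span_induct_alt)
      case base
      show ?case using R by (metis bounded_clinear_scaleC complex_vector.scale_zero_left scaleR_zero_right)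
    next
      case (step c y z)
      then obtain j where j: "y = e j" "m j = 1 / t" by blast
      have "R (c *\<^sub>C y + z) = c *\<^sub>C R y + R z"
        using linear_add[OF bounded_clinear_linear[OF R]]
        by (simp add: bounded_clinear_scaleC[OF R])
      also have "R y = complex_of_real (t powr (-p)) *\<^sub>C y"
        using Re[of j] t by (simp add: j powr_minus_divide powr_divide)
      also have "R z = complex_of_real (t powr (-p)) *\<^sub>C z" using step by (simp add: scaleC_of_real)
      finally show ?case
        by (simp add: scaleC_add_right scaleC_scaleC mult.commute flip: scaleC_of_real)
    qed
  qed
  moreover have "R' = R" if R': "Q R'" for R'
  proof
    fix x
    define V where "V = cspan (\<Union>t\<in>{0..}. eigenspace D A (complex_of_real t))"
    have bR': "bounded_clinear R'" using R' by (simp add: Q_def)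
    have eq: "R' x = R x" if "x \<in> eigenspace D A (complex_of_real t)" "t \<ge> 0" for x t
    proof (cases "t = 0")
      case True
      then show ?thesis using that R' \<open>Q R\<close> by (auto simp: Q_def)
    next
      case False
      then have "t > 0" using that(2) by simp
      then have "R' x = (t powr (- p)) *\<^sub>R x" "R x = (t powr (- p)) *\<^sub>R x"
        using R' \<open>Q R\<close> that(1) unfolding Q_def by blast+
      then show ?thesis by simp
    qed
    note bd = bounded_clinear_diff[OF bR' R]
    have "R' y - R y = 0" if "y \<in> V" for y
      using that unfolding V_def
    proof (induction rule: complex_vector.span_induct_alt)
      case base
      show ?case using linear_0[OF bounded_clinear_linear[OF bd]] .
    next
      case (step c y z)
      then have "R' y - R y = 0" using eq by auto
      then show ?case
        using step(2) linear_add[OF bounded_clinear_linear[OF bd], of "c *\<^sub>C y" z]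
          bounded_clinear_scaleC[OF bd, of c y] by simp
    qed
    then have "V \<subseteq> {y. R' y - R y = 0}" by auto
    moreover have "closed {y. R' y - R y = 0}"
      by (intro closed_Collect_eq continuous_intros linear_continuous_on bounded_clinear_bounded_linear bR' R)
    ultimately have "closure V \<subseteq> {y. R' y - R y = 0}" by (rule closure_minimal)
    moreover have "closure V = UNIV"
      unfolding V_def
    proof (rule dense_if_orthogonal_trivial[OF complex_vector.subspace_span])
      fix x assume "\<forall>y\<in>cspan (\<Union>t\<in>{0..}. eigenspace D A (complex_of_real t)). cinner x y = 0"
      then show "x = 0" by (intro eigenvectors_total) (auto intro: complex_vector.span_base)
    qed
    ultimately show "R' x = R x" by auto
  qed
  ultimately have "(THE R. Q R) = R" by (rule the_equality)
  then have "neg_power D A p = R" unfolding neg_power_def Q_def .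
  then show ?thesis using e1 by (intro that) (auto simp: R_def)
qed

end

section \<open>Diagonal operators in the ideal, and traces that they must annihilate\<close>

text \<open>
  What the arguments on traces need of \<open>g\<close>.  The condition \<open>g_quasi\<close> replaces monotonicity, which
  \<open>(t + 1)\<^sup>-\<^sup>1 (log (t + 2))\<^sup>q\<close> has only for large \<open>t\<close>; \<open>g_double\<close> keeps the ideal stable under repeating
  every diagonal entry twice.
\<close>

locale lorentz_function =
  fixes g :: "real \<Rightarrow> real" and C :: real
  assumes g_pos: "\<And>j. g (real j) > 0"
    and g_lim: "(\<lambda>j. g (real j)) \<longlonglongrightarrow> 0"
    and g_quasi: "\<And>i j. j \<le> i \<Longrightarrow> g (real i) \<le> C * g (real j)"
    and g_double: "\<And>j. g (real (j div 2)) \<le> C * g (real j)"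

lemma diag_op_add:
  assumes "orthonormal_on UNIV u" "orthonormal_on UNIV v" "\<And>j. cmod (a j) \<le> K" "\<And>j. cmod (b j) \<le> L"
  shows "diag_op (\<lambda>j. a j + b j) u v x = diag_op a u v x + diag_op b u v x"
proof -
  have "cmod (a j + b j) \<le> K + L" for j
    using assms(3)[of j] assms(4)[of j] norm_triangle_ineq[of "a j" "b j"] by linarith
  note s = diag_op_sums[where a = "\<lambda>j. a j + b j", OF assms(1,2) this]
  show ?thesis
    using sums_add[OF diag_op_sums[where a = a, OF assms(1,2,3)] diag_op_sums[where a = b, OF assms(1,2,4)], of x x]
    by (intro sums_unique2[OF s]) (simp add: ring_distribs scaleC_add_left)
qed

lemma diag_op_scale:
  assumes "orthonormal_on UNIV u" "orthonormal_on UNIV v" "\<And>j. cmod (a j) \<le> K"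
  shows "diag_op (\<lambda>j. c * a j) u v x = c *\<^sub>C diag_op a u v x"
proof -
  have "cmod (c * a j) \<le> cmod c * K" for j using assms(3)[of j] by (simp add: norm_mult mult_left_mono)
  note s = diag_op_sums[where a = "\<lambda>j. c * a j", OF assms(1,2) this]
  show ?thesis
    using bounded_linear.sums[OF bounded_linear_scaleC_right diag_op_sums[where a = a, OF assms(1,2,3), of x], of c]
    by (intro sums_unique2[OF s]) (simp add: scaleC_scaleC mult.assoc)
qed

lemma diag_op_truncate:
  assumes "orthonormal_on UNIV u" "orthonormal_on UNIV v"
  shows "diag_op (\<lambda>j. if j < n then a j else 0) u v x = (\<Sum>j<n. (a j * cinner x (u j)) *\<^sub>C v j)"
proof -
  have "(\<lambda>j. ((if j < n then a j else 0) * cinner x (u j)) *\<^sub>C v j) sums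
      (\<Sum>j<n. ((if j < n then a j else 0) * cinner x (u j)) *\<^sub>C v j)"
    by (rule sums_finite) auto
  then have "diag_op (\<lambda>j. if j < n then a j else 0) u v x =
      (\<Sum>j<n. ((if j < n then a j else 0) * cinner x (u j)) *\<^sub>C v j)"
    unfolding diag_op_def by (rule sums_unique[symmetric])
  also have "\<dots> = (\<Sum>j<n. (a j * cinner x (u j)) *\<^sub>C v j)" by (intro sum.cong) auto
  finally show ?thesis .
qed

lemma finite_rank_truncate: "finite_rank n (\<lambda>x. \<Sum>j<n. (a j * cinner x (u j)) *\<^sub>C v j)"
  unfolding finite_rank_def
  by (intro exI[of _ "\<lambda>j. cnj (a j) *\<^sub>C u j"] exI[of _ v]) (simp add: cinner_scaleC_right)

context lorentz_function
begin

lemma C_pos: "C > 0"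
proof -
  have "0 < C * g (real 0)" using g_pos[of 0] g_quasi[of 0 0] by linarith
  then show ?thesis using g_pos[of 0] by (simp add: zero_less_mult_iff)
qed

lemma coeff_bounded:
  assumes "\<And>j. cmod (a j) \<le> K * g (real j)"
  shows "cmod (a j) \<le> K * (C * g (real 0))" "K \<ge> 0"
proof -
  have "0 \<le> K * g (real 0)" using assms[of 0] norm_ge_zero[of "a 0"] by linarith
  then show K: "K \<ge> 0" using g_pos[of 0] by (simp add: zero_le_mult_iff)
  show "cmod (a j) \<le> K * (C * g (real 0))"
    using assms[of j] mult_left_mono[OF g_quasi[of 0 j] K] by linarith
qed

lemma diag_op_tail:
  assumes u: "orthonormal_on UNIV u" and v: "orthonormal_on UNIV v"
    and a: "\<And>j. cmod (a j) \<le> K * g (real j)"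
  shows "norm (diag_op a u v x - (\<Sum>j<n. (a j * cinner x (u j)) *\<^sub>C v j)) \<le> K * C * g (real n) * norm x"
proof -
  note cb = coeff_bounded[where a = a, OF a]
  let ?b = "\<lambda>j. if j < n then a j else 0" and ?c = "\<lambda>j. if j < n then 0 else a j"
  have b: "cmod (?b j) \<le> K * (C * g (real 0))" for j
    using cb(1)[of j] by (auto intro: order.trans[OF norm_ge_zero])
  have c: "cmod (?c j) \<le> K * C * g (real n)" for j
  proof (cases "j < n")
    case True
    then show ?thesis using cb(2) C_pos g_pos[of n] by simp
  next
    case False
    have "cmod (a j) \<le> K * g (real j)" by (rule a)
    also have "\<dots> \<le> K * (C * g (real n))" using False cb(2) g_quasi[of n j] by (intro mult_left_mono) auto
    finally show ?thesis using False by simp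
  qed
  have "diag_op a u v x = diag_op (\<lambda>j. ?b j + ?c j) u v x" by (rule arg_cong[of _ _ "\<lambda>a. diag_op a u v x"]) auto
  also have "\<dots> = diag_op ?b u v x + diag_op ?c u v x" by (rule diag_op_add[where a = ?b and b = ?c, OF u v b c])
  finally have "diag_op a u v x - (\<Sum>j<n. (a j * cinner x (u j)) *\<^sub>C v j) = diag_op ?c u v x"
    unfolding diag_op_truncate[OF u v] by simp
  then show ?thesis using diag_op_norm[where a = ?c, OF u v c, of x] by simp
qed

lemma diag_op_in_weak_lorentz:
  assumes u: "orthonormal_on UNIV u" and v: "orthonormal_on UNIV v"
    and a: "\<And>j. cmod (a j) \<le> K * g (real j)"
  shows "diag_op a u v \<in> weak_lorentz g"
  unfolding weak_lorentz_iff[OF g_pos g_lim]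
proof (intro conjI exI allI)
  note cb = coeff_bounded[where a = a, OF a]
  show "bounded_clinear (diag_op a u v)" by (rule bounded_clinear_diag_op[where a = a, OF u v cb(1)])
  show "K * C \<ge> 0" using cb(2) C_pos by simp
qed (rule finite_rank_truncate, rule diag_op_tail[where a = a, OF u v a])

lemma trace_diff:
  assumes \<phi>: "trace_on g \<phi>" and S: "S \<in> weak_lorentz g" and T: "T \<in> weak_lorentz g"
    and T': "(\<lambda>x. (- 1) *\<^sub>C T x) \<in> weak_lorentz g"
  shows "\<phi> (\<lambda>x. S x - T x) = \<phi> S - \<phi> T"
proof -
  have "\<phi> (\<lambda>x. S x + (- 1) *\<^sub>C T x) = \<phi> S + \<phi> (\<lambda>x. (- 1) *\<^sub>C T x)"
    using bspec[OF bspec[OF conjunct1[OF \<phi>[unfolded trace_on_def]] S] T'] .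
  also have "\<phi> (\<lambda>x. (- 1) *\<^sub>C T x) = (- 1) * \<phi> T" using \<phi> T unfolding trace_on_def by blast
  finally show ?thesis by simp
qed

lemma trace_diag_op_scale:
  assumes \<phi>: "trace_on g \<phi>" and u: "orthonormal_on UNIV u" and a: "\<And>j. cmod (a j) \<le> K * g (real j)"
  shows "\<phi> (diag_op (\<lambda>j. c * a j) u u) = c * \<phi> (diag_op a u u)"
proof -
  have "diag_op (\<lambda>j. c * a j) u u = (\<lambda>x. c *\<^sub>C diag_op a u u x)"
    by (intro ext diag_op_scale[where a = a, OF u u coeff_bounded(1)[where a = a, OF a]])
  then show ?thesis using \<phi> diag_op_in_weak_lorentz[where a = a, OF u u a] unfolding trace_on_def by simp
qed

lemma trace_diag_op_add:
  assumes \<phi>: "trace_on g \<phi>" and u: "orthonormal_on UNIV u" and a: "\<And>j. cmod (a j) \<le> K * g (real j)"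
    and b: "\<And>j. cmod (b j) \<le> L * g (real j)"
  shows "\<phi> (diag_op (\<lambda>j. a j + b j) u u) = \<phi> (diag_op a u u) + \<phi> (diag_op b u u)"
proof -
  have "diag_op (\<lambda>j. a j + b j) u u = (\<lambda>x. diag_op a u u x + diag_op b u u x)"
    by (intro ext diag_op_add[where a = a and b = b, OF u u coeff_bounded(1)[where a = a, OF a] coeff_bounded(1)[where a = b, OF b]])
  then show ?thesis using \<phi> diag_op_in_weak_lorentz[where a = a, OF u u a] diag_op_in_weak_lorentz[where a = b, OF u u b]
    unfolding trace_on_def by simp
qed

text \<open>
  With the partial isometry \<open>B\<close> from \<open>u\<close> to \<open>v\<close> and the operator \<open>T\<close> that has the entries \<open>a\<close> from \<open>v\<close> to \<open>u\<close>,
  the two diagonal operators are \<open>T B\<close> and \<open>B T\<close>.  The sequences need not be total, so a subsequence of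
  an orthonormal sequence is admissible.
\<close>

lemma trace_diag_op_transport:
  assumes \<phi>: "trace_on g \<phi>" and u: "orthonormal_on UNIV u" and v: "orthonormal_on UNIV v"
    and a: "\<And>j. cmod (a j) \<le> K * g (real j)"
  shows "\<phi> (diag_op a u u) = \<phi> (diag_op a v v)"
proof -
  define B where "B = diag_op (\<lambda>_. 1) u v"
  define T where "T = diag_op a v u"
  have one: "cmod ((\<lambda>_. 1) (j::nat)) \<le> 1" for j by simp
  have B: "bounded_clinear B" unfolding B_def by (rule bounded_clinear_diag_op[where a = "\<lambda>_. 1", OF u v one])
  have T: "T \<in> weak_lorentz g" unfolding T_def by (rule diag_op_in_weak_lorentz[where a = a, OF v u a])
  have "\<phi> (\<lambda>x. B (T x) - T (B x)) = 0" using \<phi> B T unfolding trace_on_def by blast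
  moreover have "B (T x) = diag_op a v v x" for x
    unfolding B_def T_def using diag_op_comp[where b = a and a = "\<lambda>_. 1", OF u v coeff_bounded(1)[where a = a, OF a], of v x] by simp
  moreover have "T (B x) = diag_op a u u x" for x
    unfolding B_def T_def using diag_op_comp[where b = "\<lambda>_. 1" and a = a, OF v u one, of u x] by simp
  moreover have "(\<lambda>x. (- 1) *\<^sub>C diag_op a u u x) = diag_op (\<lambda>j. (- 1) * a j) u u"
    by (intro ext diag_op_scale[where a = a, OF u u coeff_bounded(1)[where a = a, OF a], symmetric])
  moreover have "diag_op (\<lambda>j. (- 1) * a j) u u \<in> weak_lorentz g"
    by (rule diag_op_in_weak_lorentz[where K = K, OF u u]) (simp add: a)
  ultimately show ?thesis
    using trace_diff[OF \<phi> diag_op_in_weak_lorentz[where a = a, OF v v a] diag_op_in_weak_lorentz[where a = a, OF u u a]] by simp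
qed

text \<open>
  The operator is the sum of its parts on the even and on the odd places, and both are copies of the
  diagonal operator with entries \<open>a\<close>.
\<close>

lemma trace_diag_op_double:
  assumes \<phi>: "trace_on g \<phi>" and u: "orthonormal_on UNIV u" and a: "\<And>j. cmod (a j) \<le> K * g (real j)"
  shows "\<phi> (diag_op (\<lambda>j. a (j div 2)) u u) = 2 * \<phi> (diag_op a u u)"
proof -
  let ?v = "\<lambda>j. u (2 * j)" and ?w = "\<lambda>j. u (2 * j + 1)" and ?b = "\<lambda>j. a (j div 2)"
  have v: "orthonormal_on UNIV ?v" and w: "orthonormal_on UNIV ?w"
    using u by (auto simp: orthonormal_on_def)
  note cb = coeff_bounded[where a = a, OF a]
  have b: "cmod (?b j) \<le> K * (C * g (real 0))" for j by (rule cb(1))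
  have "diag_op ?b u u x = diag_op a ?v ?v x + diag_op a ?w ?w x" for x
  proof -
    define f where "f j = (?b j * cinner x (u j)) *\<^sub>C u j" for j
    have "f sums diag_op ?b u u x" unfolding f_def by (rule diag_op_sums[where a = ?b, OF u u b])
    then have "(\<lambda>n. \<Sum>j<n. f j) \<longlonglongrightarrow> diag_op ?b u u x" by (simp add: sums_def)
    then have "(\<lambda>n. \<Sum>j<2 * n. f j) \<longlonglongrightarrow> diag_op ?b u u x"
      using LIMSEQ_subseq_LIMSEQ[of "\<lambda>n. \<Sum>j<n. f j" _ "\<lambda>n. 2 * n"] by (simp add: strict_mono_def comp_def)
    moreover have "(\<Sum>j<2 * n. f j) = (\<Sum>j<n. f (2 * j)) + (\<Sum>j<n. f (2 * j + 1))" for n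
      by (induction n) auto
    moreover have "(\<lambda>n. (\<Sum>j<n. f (2 * j)) + (\<Sum>j<n. f (2 * j + 1))) \<longlonglongrightarrow> diag_op a ?v ?v x + diag_op a ?w ?w x"
      using diag_op_sums[where a = a, OF v v cb(1), of x] diag_op_sums[where a = a, OF w w cb(1), of x]
      by (intro tendsto_add) (simp_all add: sums_def f_def)
    ultimately show ?thesis using LIMSEQ_unique by simp
  qed
  then have eq: "diag_op ?b u u = (\<lambda>x. diag_op a ?v ?v x + diag_op a ?w ?w x)" by (rule ext)
  have "\<phi> (diag_op ?b u u) = \<phi> (diag_op a ?v ?v) + \<phi> (diag_op a ?w ?w)"
    using \<phi> diag_op_in_weak_lorentz[where a = a, OF v v a] diag_op_in_weak_lorentz[where a = a, OF w w a]
    unfolding trace_on_def eq by simp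
  also have "\<phi> (diag_op a ?v ?v) = \<phi> (diag_op a u u)"
    by (rule trace_diag_op_transport[OF \<phi> v u]) (rule a)
  also have "\<phi> (diag_op a ?w ?w) = \<phi> (diag_op a u u)"
    by (rule trace_diag_op_transport[OF \<phi> w u]) (rule a)
  finally show ?thesis by (simp only: mult_2)
qed

lemma trace_diag_op_vanishes:
  assumes \<phi>: "trace_on g \<phi>" and u: "orthonormal_on UNIV u" and b: "\<And>j. cmod (b j) \<le> K * g (real j)"
  shows "\<phi> (diag_op (\<lambda>j. b j - b (j div 2) / 2) u u) = 0"
proof -
  have b2: "cmod (b (j div 2)) \<le> K * C * g (real j)" for j
    using b[of "j div 2"] mult_left_mono[OF g_double[of j] coeff_bounded(2)[where a = b, OF b]] by simp
  have b3: "cmod ((- 1 / 2) * b (j div 2)) \<le> K * C * g (real j)" for j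
    using b2[of j] by (simp add: norm_mult norm_divide) (use norm_ge_zero[of "b (j div 2)"] in linarith)
  have "\<phi> (diag_op (\<lambda>j. b j + (- 1 / 2) * b (j div 2)) u u) = \<phi> (diag_op b u u) + (- 1 / 2) * \<phi> (diag_op (\<lambda>j. b (j div 2)) u u)"
    unfolding trace_diag_op_scale[where a = "\<lambda>j. b (j div 2)", OF \<phi> u b2, symmetric] by (rule trace_diag_op_add[where a = b and b = "\<lambda>j. (- 1 / 2) * b (j div 2)", OF \<phi> u b b3])
  also have "\<dots> = 0" by (simp add: trace_diag_op_double[where a = b, OF \<phi> u b])
  finally show ?thesis by simp
qed

end

text \<open>
  The solution \<open>b\<close> of \<open>d j = b j - b (j div 2) / 2\<close>.  At \<open>j = 0\<close> the equation is \<open>d 0 = b 0 / 2\<close>, because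
  \<open>0 div 2 = 0\<close>.
\<close>

fun halving_sum :: "(nat \<Rightarrow> complex) \<Rightarrow> nat \<Rightarrow> complex" where
  "halving_sum d j = (if j = 0 then 2 * d 0 else d j + halving_sum d (j div 2) / 2)"

declare halving_sum.simps [simp del]

text \<open>
  The function \<open>h\<close> is a potential that dominates the sums of \<open>(i + 1) \<bar>d i\<bar>\<close> over
  \<open>i = j, j div 2, j div 4, ...\<close>.  Since \<open>(j + 1) / 2 \<le> j div 2 + 1\<close>, such a sum bounds \<open>(j + 1) \<bar>b j\<bar>\<close> for the
  solution \<open>b\<close> of the recursion; the place \<open>0\<close> contributes \<open>2 \<bar>d 0\<bar>\<close>.
\<close>

lemma (in lorentz_function) trace_diag_op_zero:
  assumes \<phi>: "trace_on g \<phi>" and u: "orthonormal_on UNIV u"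
    and h: "h 0 \<ge> 0" "\<And>j. j \<ge> 1 \<Longrightarrow> real (j + 1) * cmod (d j) \<le> h j - h (j div 2)"
    and hg: "\<And>j. h j + 2 * cmod (d 0) \<le> K * (real (j + 1) * g (real j))"
  shows "\<phi> (diag_op d u u) = 0"
proof -
  let ?b = "halving_sum d"
  have bound: "real (j + 1) * cmod (?b j) \<le> h j + 2 * cmod (d 0)" for j
  proof (induction j rule: less_induct)
    case (less j)
    show ?case
    proof (cases "j = 0")
      case True
      then show ?thesis using h(1) by (simp add: halving_sum.simps[of d 0] norm_mult)
    next
      case False
      have "j + 1 \<le> 2 * (j div 2 + 1)" by presburger
      then have "real (j + 1) \<le> real (2 * (j div 2 + 1))" by (rule of_nat_mono)
      then have "real (j + 1) / 2 \<le> real (j div 2 + 1)" by simp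
      then have "real (j + 1) / 2 * cmod (?b (j div 2)) \<le> real (j div 2 + 1) * cmod (?b (j div 2))"
        by (rule mult_right_mono) simp
      also have "\<dots> \<le> h (j div 2) + 2 * cmod (d 0)" using False by (intro less) simp
      finally have 1: "real (j + 1) / 2 * cmod (?b (j div 2)) \<le> h (j div 2) + 2 * cmod (d 0)" .
      have "cmod (?b j) \<le> cmod (d j) + cmod (?b (j div 2)) / 2"
        using False norm_triangle_ineq[of "d j" "?b (j div 2) / 2"]
        by (simp add: halving_sum.simps[of d j] norm_divide)
      then have "real (j + 1) * cmod (?b j) \<le> real (j + 1) * (cmod (d j) + cmod (?b (j div 2)) / 2)"
        by (rule mult_left_mono) simp
      also have "\<dots> = real (j + 1) * cmod (d j) + real (j + 1) / 2 * cmod (?b (j div 2))"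
        by (simp add: algebra_simps)
      finally show ?thesis using 1 h(2)[of j] False by linarith
    qed
  qed
  have "cmod (?b j) \<le> K * g (real j)" for j
  proof -
    have "real (j + 1) * cmod (?b j) \<le> real (j + 1) * (K * g (real j))"
      using order.trans[OF bound[of j] hg[of j]] by (simp only: mult_ac)
    then show ?thesis by (rule mult_left_le_imp_le) simp
  qed
  from trace_diag_op_vanishes[where b = ?b, OF \<phi> u this] have "\<phi> (diag_op (\<lambda>j. ?b j - ?b (j div 2) / 2) u u) = 0" .
  moreover have "?b j - ?b (j div 2) / 2 = d j" for j
    by (cases "j = 0") (simp_all add: halving_sum.simps[of d 0] halving_sum.simps[of d j])
  ultimately show ?thesis by simp
qed

section \<open>The trace of finite rank operators\<close>

text \<open>
  The basis only provides a definition that does not depend on a decomposition into rank one operators.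
\<close>

definition op_trace :: "(nat \<Rightarrow> 'a::complex_hilbert) \<Rightarrow> ('a \<Rightarrow> 'a) \<Rightarrow> complex" where
  "op_trace \<xi> F = (\<Sum>j. cinner (F (\<xi> j)) (\<xi> j))"

lemma trace_rank_one_sums:
  assumes "orthonormal_basis \<xi>"
  shows "(\<lambda>j. cinner (cinner (\<xi> j) w *\<^sub>C u) (\<xi> j)) sums cinner u w"
proof -
  have "(\<lambda>j. cinner (cinner u (\<xi> j) *\<^sub>C \<xi> j) w) sums cinner u w"
    by (rule bounded_linear.sums[OF bounded_linear_cinner_left orthonormal_basis_sums[OF assms]])
  then show ?thesis by (simp add: cinner_scaleC_left mult.commute)
qed

lemma op_trace_sums:
  assumes "orthonormal_basis \<xi>" "F = (\<lambda>x. \<Sum>i\<in>I. cinner x (w i) *\<^sub>C u i)"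
  shows "(\<lambda>j. cinner (F (\<xi> j)) (\<xi> j)) sums (\<Sum>i\<in>I. cinner (u i) (w i))"
  unfolding assms(2) cinner_sum_left by (intro sums_sum trace_rank_one_sums assms(1))

lemma op_trace_eq:
  assumes "orthonormal_basis \<xi>" "F = (\<lambda>x. \<Sum>i\<in>I. cinner x (w i) *\<^sub>C u i)"
  shows "op_trace \<xi> F = (\<Sum>i\<in>I. cinner (u i) (w i))"
  unfolding op_trace_def by (rule sums_unique[OF op_trace_sums[OF assms], symmetric])

lemma op_trace_summable:
  assumes "orthonormal_basis \<xi>" "finite_rank n F"
  shows "summable (\<lambda>j. cinner (F (\<xi> j)) (\<xi> j))"
proof -
  obtain w u where F: "F = (\<lambda>x. \<Sum>i<n. cinner x (w i) *\<^sub>C u i)" using assms(2) by (auto simp: finite_rank_def)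
  show ?thesis by (rule sums_summable[OF op_trace_sums[OF assms(1) F]])
qed

lemma op_trace_add:
  assumes "orthonormal_basis \<xi>" "finite_rank n F" "finite_rank m G"
  shows "op_trace \<xi> (\<lambda>x. F x + G x) = op_trace \<xi> F + op_trace \<xi> G"
  unfolding op_trace_def cinner_add_left
  by (rule suminf_add[symmetric]) (rule op_trace_summable[OF assms(1)], fact)+

lemma op_trace_scale:
  assumes "orthonormal_basis \<xi>" "finite_rank n F"
  shows "op_trace \<xi> (\<lambda>x. c *\<^sub>C F x) = c * op_trace \<xi> F"
  unfolding op_trace_def cinner_scaleC_left
  by (rule suminf_mult) (rule op_trace_summable[OF assms])

lemma finite_rank_scale:
  assumes "finite_rank n F" shows "finite_rank n (\<lambda>x. c *\<^sub>C F x)"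
proof -
  obtain w u where F: "F = (\<lambda>x. \<Sum>i<n. cinner x (w i) *\<^sub>C u i)" using assms by (auto simp: finite_rank_def)
  show ?thesis unfolding F finite_rank_def
    by (intro exI[of _ w] exI[of _ "\<lambda>i. c *\<^sub>C u i"])
      (simp add: complex_vector.scale_sum_right scaleC_scaleC mult.commute)
qed

lemma finite_rank_add:
  assumes "finite_rank n F" "finite_rank m G" shows "finite_rank (n + m) (\<lambda>x. F x + G x)"
proof -
  obtain w u where F: "F = (\<lambda>x. \<Sum>i<n. cinner x (w i) *\<^sub>C u i)" using assms(1) by (auto simp: finite_rank_def)
  obtain w' u' where G: "G = (\<lambda>x. \<Sum>i<m. cinner x (w' i) *\<^sub>C u' i)" using assms(2) by (auto simp: finite_rank_def)
  define W where "W i = (if i < n then w i else w' (i - n))" for i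
  define U where "U i = (if i < n then u i else u' (i - n))" for i
  have "(\<Sum>i<n + m. cinner x (W i) *\<^sub>C U i) = F x + G x" for x
  proof -
    have "(\<Sum>i<n + m. cinner x (W i) *\<^sub>C U i) =
        (\<Sum>i<n. cinner x (W i) *\<^sub>C U i) + (\<Sum>i<m. cinner x (W (i + n)) *\<^sub>C U (i + n))"
      by (induction m) (simp_all add: add_ac)
    then show ?thesis by (simp add: F G W_def U_def)
  qed
  then show ?thesis unfolding finite_rank_def by (intro exI[of _ W] exI[of _ U]) auto
qed

lemma finite_rank_comp:
  assumes "finite_rank n F" "bounded_clinear B"
  shows "finite_rank n (\<lambda>x. B (F x))" "finite_rank n (\<lambda>x. F (B x))"
    "orthonormal_basis \<xi> \<Longrightarrow> op_trace \<xi> (\<lambda>x. B (F x)) = op_trace \<xi> (\<lambda>x. F (B x))"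
proof -
  obtain w u where F: "F = (\<lambda>x. \<Sum>i<n. cinner x (w i) *\<^sub>C u i)" using assms(1) by (auto simp: finite_rank_def)
  have BF: "(\<lambda>x. B (F x)) = (\<lambda>x. \<Sum>i<n. cinner x (w i) *\<^sub>C B (u i))"
    unfolding F by (intro ext clinear_sum[OF assms(2)])
  have FB: "(\<lambda>x. F (B x)) = (\<lambda>x. \<Sum>i<n. cinner x (adjoint_op UNIV B (w i)) *\<^sub>C u i)"
    unfolding F by (simp only: cinner_adjoint[OF assms(2)])
  show "finite_rank n (\<lambda>x. B (F x))" unfolding BF finite_rank_def
    by (intro exI[of _ w] exI[of _ "\<lambda>i. B (u i)"] refl)
  show "finite_rank n (\<lambda>x. F (B x))" unfolding FB finite_rank_def
    by (intro exI[of _ "\<lambda>i. adjoint_op UNIV B (w i)"] exI[of _ u] refl)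
  show "op_trace \<xi> (\<lambda>x. B (F x)) = op_trace \<xi> (\<lambda>x. F (B x))" if "orthonormal_basis \<xi>"
    unfolding op_trace_eq[OF that BF] op_trace_eq[OF that FB] by (simp only: cinner_adjoint[OF assms(2)])
qed

text \<open>
  For an orthonormal basis \<open>B\<close> of a space that contains the range, the trace is the sum of the \<open>n\<close> or fewer numbers
  \<open>(F b, b)\<close>.
\<close>

lemma op_trace_bound:
  assumes \<xi>: "orthonormal_basis \<xi>" and F: "finite_rank n F" and K: "\<And>x. norm (F x) \<le> K * norm x" "K \<ge> 0"
  shows "cmod (op_trace \<xi> F) \<le> real n * K"
proof -
  note bF = bounded_clinear_finite_rank[OF F]
  obtain w u where Fw: "F = (\<lambda>x. \<Sum>i<n. cinner x (w i) *\<^sub>C u i)" using F by (auto simp: finite_rank_def)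
  obtain B where B: "finite B" "card B \<le> card (u ` {..<n})" "orthonormal_on B (\<lambda>x. x)"
    "cspan B = cspan (u ` {..<n})"
    using orthonormal_finite_basis[of "u ` {..<n}"] by auto
  have cB: "card B \<le> n" using B(2) card_image_le[of "{..<n}" u] by simp
  have "F x \<in> cspan B" for x
    unfolding Fw B(4) by (intro complex_vector.span_sum complex_vector.span_scale complex_vector.span_base) auto
  then have "F x = (\<Sum>b\<in>B. cinner (F x) b *\<^sub>C b)" for x by (rule orthonormal_expansion_finite[OF B(1,3)])
  then have "F = (\<lambda>x. \<Sum>b\<in>B. cinner x (adjoint_op UNIV F b) *\<^sub>C b)"
    by (simp only: cinner_adjoint[OF bF]) (rule ext)
  then have "op_trace \<xi> F = (\<Sum>b\<in>B. cinner b (adjoint_op UNIV F b))" by (rule op_trace_eq[OF \<xi>])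
  also have "\<dots> = (\<Sum>b\<in>B. cinner (F b) b)" by (simp only: cinner_adjoint[OF bF])
  finally have "cmod (op_trace \<xi> F) \<le> (\<Sum>b\<in>B. cmod (cinner (F b) b))" by (simp add: norm_sum)
  also have "\<dots> \<le> (\<Sum>b\<in>B. K)"
  proof (rule sum_mono)
    fix b assume b: "b \<in> B"
    have nb: "norm b = 1" by (rule orthonormal_on_norm[OF B(3) b])
    show "cmod (cinner (F b) b) \<le> K" using norm_cinner[of "F b" b] K(1)[of b] nb by simp
  qed
  also have "\<dots> \<le> real n * K" using cB K(2) by (simp add: mult_right_mono)
  finally show ?thesis .
qed

section \<open>A trace with values in sequences modulo bounded multiples of the weight\<close>

text \<open>
  The rank is allowed to be a multiple of \<open>n\<close>, so that sums need no regrouping.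
\<close>

definition approximates :: "(real \<Rightarrow> real) \<Rightarrow> ('a::complex_hilbert \<Rightarrow> 'a) \<Rightarrow> (nat \<Rightarrow> 'a \<Rightarrow> 'a) \<Rightarrow> real \<Rightarrow> bool" where
  "approximates g T F K \<longleftrightarrow> K \<ge> 0 \<and> (\<forall>n. (\<exists>r. real r \<le> K * real n \<and> finite_rank r (F n)) \<and>
     (\<forall>x. norm (T x - F n x) \<le> K * g (real n) * norm x))"

lemma approximatesD:
  assumes "approximates g T F K"
  shows "K \<ge> 0" "\<exists>r. real r \<le> K * real n \<and> finite_rank r (F n)"
    "norm (T x - F n x) \<le> K * g (real n) * norm x"
  using assms unfolding approximates_def by blast+

lemma approximates_add:
  assumes "approximates g S F K" "approximates g T G L"
  shows "approximates g (\<lambda>x. S x + T x) (\<lambda>n x. F n x + G n x) (K + L)"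
  unfolding approximates_def
proof (intro conjI allI)
  show "0 \<le> K + L" using approximatesD(1)[OF assms(1)] approximatesD(1)[OF assms(2)] by simp
  fix n
  obtain r s where "real r \<le> K * real n" "finite_rank r (F n)" "real s \<le> L * real n" "finite_rank s (G n)"
    using approximatesD(2)[OF assms(1)] approximatesD(2)[OF assms(2)] by metis
  then show "\<exists>r. real r \<le> (K + L) * real n \<and> finite_rank r (\<lambda>x. F n x + G n x)"
    by (intro exI[of _ "r + s"]) (simp add: finite_rank_add distrib_right)
  fix x
  have "norm (S x + T x - (F n x + G n x)) \<le> norm (S x - F n x) + norm (T x - G n x)"
    using norm_triangle_ineq[of "S x - F n x" "T x - G n x"] by (simp add: algebra_simps)
  then show "norm (S x + T x - (F n x + G n x)) \<le> (K + L) * g (real n) * norm x"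
    using approximatesD(3)[OF assms(1), of x n] approximatesD(3)[OF assms(2), of x n]
    by (simp add: algebra_simps)
qed

lemma approximates_scale:
  assumes "approximates g T F K"
  shows "approximates g (\<lambda>x. c *\<^sub>C T x) (\<lambda>n x. c *\<^sub>C F n x) ((1 + cmod c) * K)"
  unfolding approximates_def
proof (intro conjI allI)
  note K = approximatesD(1)[OF assms]
  show "0 \<le> (1 + cmod c) * K" using K by simp
  fix n
  obtain r where r: "real r \<le> K * real n" "finite_rank r (F n)" using approximatesD(2)[OF assms] by metis
  have "1 * (K * real n) \<le> (1 + cmod c) * (K * real n)" using K by (intro mult_right_mono) auto
  then show "\<exists>r. real r \<le> (1 + cmod c) * K * real n \<and> finite_rank r (\<lambda>x. c *\<^sub>C F n x)"
    using r finite_rank_scale by (intro exI[of _ r]) (simp add: mult.assoc)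
  fix x
  have "norm (c *\<^sub>C T x - c *\<^sub>C F n x) = cmod c * norm (T x - F n x)"
    by (simp add: norm_scaleC flip: complex_vector.scale_right_diff_distrib)
  also have "\<dots> \<le> (1 + cmod c) * norm (T x - F n x)" by (rule mult_right_mono) auto
  also have "\<dots> \<le> (1 + cmod c) * (K * g (real n) * norm x)"
    by (intro mult_left_mono approximatesD(3)[OF assms]) auto
  finally show "norm (c *\<^sub>C T x - c *\<^sub>C F n x) \<le> (1 + cmod c) * K * g (real n) * norm x" by (simp add: mult.assoc)
qed

lemma approximates_comp:
  assumes T: "approximates g T F K" and B: "bounded_clinear B" and g: "\<And>n. g (real n) > 0"
  shows "\<exists>L. approximates g (\<lambda>x. B (T x)) (\<lambda>n x. B (F n x)) L"
    "\<exists>L. approximates g (\<lambda>x. T (B x)) (\<lambda>n x. F n (B x)) L"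
proof -
  note bB = bounded_clinear_bounded_linear[OF B]
  obtain M where M: "\<And>x. norm (B x) \<le> norm x * M" "M > 0" using bounded_linear.pos_bounded[OF bB] by blast
  note K = approximatesD(1)[OF T]
  have rk: "real r \<le> (1 + M) * K * real n" if "real r \<le> K * real n" for r n
  proof -
    have "1 * (K * real n) \<le> (1 + M) * (K * real n)" using K M(2) by (intro mult_right_mono) auto
    then show ?thesis using that by (simp add: mult.assoc)
  qed
  have L0: "0 \<le> (1 + M) * K" using K M(2) by simp
  have grow: "M * (K * g (real n) * norm x) \<le> (1 + M) * K * g (real n) * norm x" for n x
  proof -
    have "0 \<le> K * g (real n) * norm x" using K g[of n] by simp
    then show ?thesis by (simp add: algebra_simps)
  qed
  have "approximates g (\<lambda>x. B (T x)) (\<lambda>n x. B (F n x)) ((1 + M) * K)"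
    unfolding approximates_def
  proof (intro conjI allI L0)
    fix n
    obtain r where r: "real r \<le> K * real n" "finite_rank r (F n)" using approximatesD(2)[OF T] by metis
    then show "\<exists>r. real r \<le> (1 + M) * K * real n \<and> finite_rank r (\<lambda>x. B (F n x))"
      using rk finite_rank_comp(1)[OF r(2) B] by blast
    fix x
    have "norm (B (T x) - B (F n x)) = norm (B (T x - F n x))"
      by (simp add: linear_diff[OF bounded_linear.linear[OF bB]])
    also have "\<dots> \<le> M * norm (T x - F n x)" using M(1)[of "T x - F n x"] by (simp add: mult.commute)
    also have "\<dots> \<le> M * (K * g (real n) * norm x)"
      using M(2) approximatesD(3)[OF T] by (intro mult_left_mono) auto
    finally show "norm (B (T x) - B (F n x)) \<le> (1 + M) * K * g (real n) * norm x"
      using grow[of n x] by linarith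
  qed
  then show "\<exists>L. approximates g (\<lambda>x. B (T x)) (\<lambda>n x. B (F n x)) L" by blast
  have "approximates g (\<lambda>x. T (B x)) (\<lambda>n x. F n (B x)) ((1 + M) * K)"
    unfolding approximates_def
  proof (intro conjI allI L0)
    fix n
    obtain r where r: "real r \<le> K * real n" "finite_rank r (F n)" using approximatesD(2)[OF T] by metis
    then show "\<exists>r. real r \<le> (1 + M) * K * real n \<and> finite_rank r (\<lambda>x. F n (B x))"
      using rk finite_rank_comp(2)[OF r(2) B] by blast
    fix x
    have "norm (T (B x) - F n (B x)) \<le> K * g (real n) * norm (B x)" by (rule approximatesD(3)[OF T])
    also have "\<dots> \<le> K * g (real n) * (norm x * M)" using K g[of n] M(1)[of x] by (intro mult_left_mono) auto
    finally show "norm (T (B x) - F n (B x)) \<le> (1 + M) * K * g (real n) * norm x"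
      using grow[of n x] by (simp add: mult_ac)
  qed
  then show "\<exists>L. approximates g (\<lambda>x. T (B x)) (\<lambda>n x. F n (B x)) L" by blast
qed

text \<open>
  The difference of \<open>F n\<close> and \<open>G n\<close> has rank \<open>O(n)\<close> and norm \<open>O(g(n))\<close>.
\<close>

lemma approximates_unique:
  assumes \<xi>: "orthonormal_basis \<xi>" and F: "approximates g T F K" and G: "approximates g T G L"
    and g: "\<And>n. g (real n) > 0"
  shows "cmod (op_trace \<xi> (F n) - op_trace \<xi> (G n)) \<le> (K + L)\<^sup>2 * (real n * g (real n))"
proof -
  note K = approximatesD(1)[OF F] and L = approximatesD(1)[OF G]
  obtain r s where r: "real r \<le> K * real n" "finite_rank r (F n)" and s: "real s \<le> L * real n" "finite_rank s (G n)"
    using approximatesD(2)[OF F] approximatesD(2)[OF G] by metis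
  note sG = finite_rank_scale[OF s(2), of "- 1"]
  let ?H = "\<lambda>x. F n x + (- 1) *\<^sub>C G n x"
  have H: "finite_rank (r + s) ?H" by (rule finite_rank_add[OF r(2) sG])
  have nH: "norm (?H x) \<le> (K + L) * g (real n) * norm x" for x
  proof -
    have "norm (?H x) \<le> norm (T x - F n x) + norm (T x - G n x)"
      using norm_triangle_ineq4[of "T x - G n x" "T x - F n x"] by simp
    then show ?thesis using approximatesD(3)[OF F, of x n] approximatesD(3)[OF G, of x n]
      by (simp add: algebra_simps)
  qed
  have KL: "(K + L) * g (real n) \<ge> 0" using K L g[of n] by simp
  have "op_trace \<xi> (F n) - op_trace \<xi> (G n) = op_trace \<xi> ?H"
    using op_trace_add[OF \<xi> r(2) sG] op_trace_scale[OF \<xi> s(2), of "- 1"] by simp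
  also have "cmod \<dots> \<le> real (r + s) * ((K + L) * g (real n))" by (rule op_trace_bound[OF \<xi> H nH KL])
  also have "\<dots> \<le> ((K + L) * real n) * ((K + L) * g (real n))"
    using r(1) s(1) KL by (intro mult_right_mono) (auto simp: distrib_right)
  finally show ?thesis by (simp add: power2_eq_square mult_ac)
qed

section \<open>Linear functionals on sequences\<close>

global_interpretation complex_seq: vector_space "\<lambda>(c::complex) f (n::nat). c * f n"
  by unfold_locales (auto simp: fun_eq_iff algebra_simps)

text \<open>
  The two sequences are linearly independent modulo the subspace \<open>W\<close> of the sequences that are
  \<open>O(w)\<close>, so a basis of \<open>W\<close> extended by them carries a linear functional with prescribed values.
\<close>

lemma sequence_functional_exists:
  fixes w :: "nat \<Rightarrow> real" and \<sigma> \<tau> :: "nat \<Rightarrow> complex" and v :: complex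
  assumes w: "\<And>n. w n \<ge> 0"
    and indep: "\<And>a b K. (\<And>n. cmod (a * \<sigma> n + b * \<tau> n) \<le> K * w n) \<Longrightarrow> a = 0 \<and> b = 0"
  obtains \<Lambda> :: "(nat \<Rightarrow> complex) \<Rightarrow> complex" where
    "\<And>f h. \<Lambda> (\<lambda>n. f n + h n) = \<Lambda> f + \<Lambda> h" "\<And>c f. \<Lambda> (\<lambda>n. c * f n) = c * \<Lambda> f"
    "\<And>f K. (\<And>n. cmod (f n) \<le> K * w n) \<Longrightarrow> \<Lambda> f = 0" "\<Lambda> \<sigma> = 1" "\<Lambda> \<tau> = v"
proof -
  define W where "W = {f :: nat \<Rightarrow> complex. \<exists>K. \<forall>n. cmod (f n) \<le> K * w n}"
  have W: "complex_seq.subspace W"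
  proof (rule complex_seq.subspaceI)
    show "0 \<in> W" using w by (auto simp: W_def intro!: exI[of _ 0])
    show "f + h \<in> W" if fh: "f \<in> W" "h \<in> W" for f h
    proof -
      obtain K L where "\<And>n. cmod (f n) \<le> K * w n" "\<And>n. cmod (h n) \<le> L * w n" using fh by (auto simp: W_def)
      then have "cmod ((f + h) n) \<le> (K + L) * w n" for n
        using norm_triangle_ineq[of "f n" "h n"] by (fastforce simp: distrib_right intro: order.trans add_mono)
      then show ?thesis by (auto simp: W_def)
    qed
    show "(\<lambda>n. c * f n) \<in> W" if f: "f \<in> W" for c f
    proof -
      obtain K where "\<And>n. cmod (f n) \<le> K * w n" using f by (auto simp: W_def)
      then have "cmod (c * f n) \<le> cmod c * K * w n" for n
        by (simp add: norm_mult mult.assoc mult_left_mono)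
      then show ?thesis by (auto simp: W_def)
    qed
  qed
  obtain B where B: "B \<subseteq> W" "\<not> complex_seq.dependent B" "W \<subseteq> complex_seq.span B"
    by (rule complex_seq.basis_exists[of W])
  have spanB: "complex_seq.span B = W"
    using B W by (metis complex_seq.span_minimal subset_antisym)
  have \<sigma>: "\<sigma> \<notin> complex_seq.span B"
  proof
    assume "\<sigma> \<in> complex_seq.span B"
    then obtain K where "\<And>n. cmod (1 * \<sigma> n + 0 * \<tau> n) \<le> K * w n" unfolding spanB by (auto simp: W_def)
    from indep[OF this] show False by simp
  qed
  have \<tau>: "\<tau> \<notin> complex_seq.span (insert \<sigma> B)"
  proof
    assume "\<tau> \<in> complex_seq.span (insert \<sigma> B)"
    then obtain k where "\<tau> - (\<lambda>n. k * \<sigma> n) \<in> W"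
      unfolding complex_seq.span_insert spanB by blast
    then obtain K where "\<And>n. cmod ((- k) * \<sigma> n + 1 * \<tau> n) \<le> K * w n" by (auto simp: W_def)
    from indep[OF this] show False by simp
  qed
  have ind: "\<not> complex_seq.dependent (insert \<tau> (insert \<sigma> B))"
    using B(2) \<sigma> \<tau> by (intro complex_seq.independent_insertI)
  interpret pair: vector_space_pair "\<lambda>(c::complex) f (n::nat). c * f n" "(*) :: complex \<Rightarrow> complex \<Rightarrow> complex"
    by unfold_locales (simp_all only: ring_distribs mult.assoc mult_1_left)
  define val where "val f = (if f = \<tau> then v else if f = \<sigma> then 1 else 0 :: complex)" for f
  obtain \<Lambda> where \<Lambda>0: "Vector_Spaces.linear (\<lambda>(c::complex) f (n::nat). c * f n) (*) \<Lambda> \<and>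
      (\<forall>f\<in>insert \<tau> (insert \<sigma> B). \<Lambda> f = val f)"
    using pair.linear_independent_extend[OF ind, of val] ..
  note lin = \<Lambda>0[THEN conjunct1]
  have \<Lambda>: "\<Lambda> f = val f" if "f \<in> insert \<tau> (insert \<sigma> B)" for f using \<Lambda>0[THEN conjunct2] that by (rule bspec)
  interpret L: Vector_Spaces.linear "\<lambda>(c::complex) f (n::nat). c * f n" "(*)" \<Lambda> by (fact lin)
  have ne: "\<sigma> \<noteq> \<tau>" using \<tau> complex_seq.span_base[of \<sigma> "insert \<sigma> B"] by auto
  have zero: "\<Lambda> f = 0" if f: "f \<in> W" for f
  proof -
    have b0: "\<Lambda> b = 0" if b: "b \<in> B" for b
    proof -
      have "b \<noteq> \<sigma>" "b \<noteq> \<tau>"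
        using b \<sigma> \<tau> complex_seq.span_base[of b B] complex_seq.span_base[of b "insert \<sigma> B"] by auto
      then show ?thesis using \<Lambda>[of b] b by (simp add: val_def)
    qed
    have "f \<in> complex_seq.span B" using f spanB by simp
    then show ?thesis
    proof (induction rule: complex_seq.span_induct_alt)
      case base
      show ?case by (rule L.zero)
    next
      case (step c x y)
      then show ?case by (simp only: L.add L.scale b0) simp
    qed
  qed
  show ?thesis
  proof (rule that[of \<Lambda>])
    show "\<Lambda> (\<lambda>n. f n + h n) = \<Lambda> f + \<Lambda> h" for f h using L.add[of f h] by (simp add: plus_fun_def)
    show "\<Lambda> (\<lambda>n. c * f n) = c * \<Lambda> f" for c f by (rule L.scale)
    show "\<Lambda> f = 0" if "\<And>n. cmod (f n) \<le> K * w n" for f K using that by (intro zero) (auto simp: W_def)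
    show "\<Lambda> \<sigma> = 1" using \<Lambda>[of \<sigma>] ne by (simp add: val_def)
    show "\<Lambda> \<tau> = v" using \<Lambda>[of \<tau>] by (simp add: val_def)
  qed
qed

section \<open>Existence of traces with prescribed values\<close>

lemma diag_op_of_eigenbasis:
  assumes T: "bounded_clinear T" and \<xi>: "orthonormal_basis \<xi>" and e: "\<And>j. T (\<xi> j) = a j *\<^sub>C \<xi> j"
  shows "T = diag_op a \<xi> \<xi>"
proof
  fix x
  have "(\<lambda>j. T (cinner x (\<xi> j) *\<^sub>C \<xi> j)) sums T x"
    by (rule bounded_linear.sums[OF bounded_clinear_bounded_linear[OF T] orthonormal_basis_sums[OF \<xi>]])
  then have "(\<lambda>j. (a j * cinner x (\<xi> j)) *\<^sub>C \<xi> j) sums T x"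
    by (simp add: bounded_clinear_scaleC[OF T] e scaleC_scaleC mult.commute)
  then show "T x = diag_op a \<xi> \<xi> x" unfolding diag_op_def by (rule sums_unique)
qed

context lorentz_function
begin

lemma approximates_exists:
  fixes T :: "'a::complex_hilbert \<Rightarrow> 'a"
  assumes "T \<in> weak_lorentz g" shows "\<exists>F K. approximates g T F K"
proof -
  obtain K where K: "K \<ge> 0" "\<And>n. \<exists>F. finite_rank n F \<and> (\<forall>x. norm (T x - F x) \<le> K * g (real n) * norm x)"
    using assms unfolding weak_lorentz_iff[OF g_pos g_lim] by blast
  then obtain F where F: "\<And>n. finite_rank n (F n)" "\<And>n x. norm (T x - F n x) \<le> K * g (real n) * norm x"
    by metis
  have "approximates g T F (K + 1)"
    unfolding approximates_def
  proof (intro conjI allI)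
    fix n
    show "\<exists>r. real r \<le> (K + 1) * real n \<and> finite_rank r (F n)"
      using F(1)[of n] K(1) by (intro exI[of _ n]) (auto simp: distrib_right)
    fix x :: 'a
    have "0 \<le> g (real n) * norm x" using g_pos[of n] by simp
    then show "norm (T x - F n x) \<le> (K + 1) * g (real n) * norm x"
      using F(2)[of x n] by (simp add: distrib_right)
  qed (use K in simp)
  then show ?thesis by blast
qed

lemma approximates_diag_op:
  fixes u :: "nat \<Rightarrow> 'a::complex_hilbert"
  assumes u: "orthonormal_on UNIV u" and a: "\<And>j. cmod (a j) \<le> K * g (real j)"
  shows "approximates g (diag_op a u u) (\<lambda>n x. \<Sum>j<n. (a j * cinner x (u j)) *\<^sub>C u j) (K * C + 1)"
  unfolding approximates_def
proof (intro conjI allI)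
  have KC: "0 \<le> K * C" using coeff_bounded(2)[where a = a, OF a] C_pos by simp
  then show "0 \<le> K * C + 1" by simp
  fix n
  show "\<exists>r. real r \<le> (K * C + 1) * real n \<and> finite_rank r (\<lambda>x. \<Sum>j<n. (a j * cinner x (u j)) *\<^sub>C u j)"
    using KC by (intro exI[of _ n] conjI finite_rank_truncate) (auto simp: distrib_right)
  fix x :: 'a
  have "0 \<le> g (real n) * norm x" using g_pos[of n] by simp
  then show "norm (diag_op a u u x - (\<Sum>j<n. (a j * cinner x (u j)) *\<^sub>C u j)) \<le> (K * C + 1) * g (real n) * norm x"
    using diag_op_tail[where a = a, OF u u a, of x n] by (simp add: distrib_right)
qed

lemma op_trace_truncate:
  assumes \<xi>: "orthonormal_basis \<xi>" and u: "orthonormal_on UNIV u"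
  shows "op_trace \<xi> (\<lambda>x. \<Sum>j<n. (a j * cinner x (u j)) *\<^sub>C u j) = (\<Sum>j<n. a j)"
proof -
  have "(\<lambda>x. \<Sum>j<n. (a j * cinner x (u j)) *\<^sub>C u j) = (\<lambda>x. \<Sum>j<n. cinner x (cnj (a j) *\<^sub>C u j) *\<^sub>C u j)"
    by (simp add: cinner_scaleC_right)
  from op_trace_eq[OF \<xi> this] show ?thesis
    using u by (simp add: cinner_scaleC_right orthonormal_on_def)
qed

text \<open>
  The trace is the composition of the functional with the sequence of the traces of approximating
  finite rank operators, which is well defined modulo \<open>O(n g(n))\<close>.  For a diagonal operator the
  truncations approximate, and their traces are the partial sums of the entries; so the trace is
  normalized as soon as the functional is \<open>1\<close> on the partial sums of \<open>g\<close>.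
\<close>

theorem normalized_trace_exists:
  fixes u \<xi> :: "nat \<Rightarrow> 'a::complex_hilbert" and a :: "nat \<Rightarrow> complex"
  assumes \<xi>: "orthonormal_basis \<xi>" and u: "orthonormal_on UNIV u"
    and a: "\<And>j. cmod (a j) \<le> L * g (real j)"
    and indep: "\<And>b c K. (\<And>n. cmod (b * complex_of_real (\<Sum>j<n. g (real j)) + c * (\<Sum>j<n. a j))
        \<le> K * (real n * g (real n))) \<Longrightarrow> b = 0 \<and> c = 0"
  shows "\<exists>\<phi> :: ('a \<Rightarrow> 'a) \<Rightarrow> complex. normalized_trace g \<phi> \<and> \<phi> (diag_op a u u) = v"
proof -
  obtain \<Lambda> :: "(nat \<Rightarrow> complex) \<Rightarrow> complex" where
    add: "\<And>f h. \<Lambda> (\<lambda>n. f n + h n) = \<Lambda> f + \<Lambda> h" and scale: "\<And>c f. \<Lambda> (\<lambda>n. c * f n) = c * \<Lambda> f"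
    and zero: "\<And>f K. (\<And>n. cmod (f n) \<le> K * (real n * g (real n))) \<Longrightarrow> \<Lambda> f = 0"
    and one: "\<Lambda> (\<lambda>n. complex_of_real (\<Sum>j<n. g (real j))) = 1" and val: "\<Lambda> (\<lambda>n. \<Sum>j<n. a j) = v"
  proof (rule sequence_functional_exists[of "\<lambda>n. real n * g (real n)"
        "\<lambda>n. complex_of_real (\<Sum>j<n. g (real j))" "\<lambda>n. \<Sum>j<n. a j" v])
    show "0 \<le> real n * g (real n)" for n using g_pos[of n] by simp
    show "b = 0 \<and> c = 0" if "\<And>n. cmod (b * complex_of_real (\<Sum>j<n. g (real j)) + c * (\<Sum>j<n. a j))
        \<le> K * (real n * g (real n))" for b c K by (rule indep[OF that])
    fix \<Lambda> :: "(nat \<Rightarrow> complex) \<Rightarrow> complex"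
    assume *: "\<And>f h. \<Lambda> (\<lambda>n. f n + h n) = \<Lambda> f + \<Lambda> h" "\<And>c f. \<Lambda> (\<lambda>n. c * f n) = c * \<Lambda> f"
      "\<And>f K. (\<And>n. cmod (f n) \<le> K * (real n * g (real n))) \<Longrightarrow> \<Lambda> f = 0"
      "\<Lambda> (\<lambda>n. complex_of_real (\<Sum>j<n. g (real j))) = 1" "\<Lambda> (\<lambda>n. \<Sum>j<n. a j) = v"
    show thesis by (rule that[OF *(1,2,3,4,5)])
  qed
  define \<phi> where "\<phi> T = \<Lambda> (\<lambda>n. op_trace \<xi> ((SOME F. \<exists>K. approximates g T F K) n))" for T
  have \<phi>: "\<phi> T = \<Lambda> (\<lambda>n. op_trace \<xi> (F n))" if F: "approximates g T F K" for T F K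
  proof -
    define G where "G = (SOME F. \<exists>K. approximates g T F K)"
    have "\<exists>L. approximates g T G L" 
      unfolding G_def by (rule someI_ex[of "\<lambda>F. \<exists>K. approximates g T F K"]) (intro exI, rule F)
    then obtain L where G: "approximates g T G L" by blast
    have "\<Lambda> (\<lambda>n. op_trace \<xi> (G n) + (- 1) * op_trace \<xi> (F n)) = 0"
      using approximates_unique[OF \<xi> G F g_pos] by (intro zero[of _ "(L + K)\<^sup>2"]) simp
    then show ?thesis unfolding add scale by (simp add: \<phi>_def G_def)
  qed
  have "trace_on g \<phi>"
    unfolding trace_on_def
  proof (intro conjI ballI allI impI)
    fix S T :: "'a \<Rightarrow> 'a" assume S: "S \<in> weak_lorentz g" and T: "T \<in> weak_lorentz g"
    obtain F K where F: "approximates g S F K" using approximates_exists[OF S] by blast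
    obtain G L where G: "approximates g T G L" using approximates_exists[OF T] by blast
    have "op_trace \<xi> (\<lambda>x. F n x + G n x) = op_trace \<xi> (F n) + op_trace \<xi> (G n)" for n
      using approximatesD(2)[OF F, of n] approximatesD(2)[OF G, of n] op_trace_add[OF \<xi>] by blast
    then show "\<phi> (\<lambda>x. S x + T x) = \<phi> S + \<phi> T"
      unfolding \<phi>[OF approximates_add[OF F G]] \<phi>[OF F] \<phi>[OF G] by (simp add: add)
  next
    fix c and T :: "'a \<Rightarrow> 'a" assume T: "T \<in> weak_lorentz g"
    obtain F K where F: "approximates g T F K" using approximates_exists[OF T] by blast
    have "op_trace \<xi> (\<lambda>x. c *\<^sub>C F n x) = c * op_trace \<xi> (F n)" for n
      using approximatesD(2)[OF F, of n] op_trace_scale[OF \<xi>] by blast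
    then show "\<phi> (\<lambda>x. c *\<^sub>C T x) = c * \<phi> T"
      unfolding \<phi>[OF approximates_scale[OF F]] \<phi>[OF F] by (simp add: scale)
  next
    fix B T :: "'a \<Rightarrow> 'a" assume T: "T \<in> weak_lorentz g" and B: "bounded_clinear B"
    obtain F K where F: "approximates g T F K" using approximates_exists[OF T] by blast
    obtain L where L: "approximates g (\<lambda>x. B (T x)) (\<lambda>n x. B (F n x)) L"
      using approximates_comp(1)[OF F B g_pos] by blast
    obtain M where M: "approximates g (\<lambda>x. T (B x)) (\<lambda>n x. F n (B x)) M"
      using approximates_comp(2)[OF F B g_pos] by blast
    have eq: "(\<lambda>x. B (T x) - T (B x)) = (\<lambda>x. B (T x) + (- 1) *\<^sub>C T (B x))" by simp
    have tr: "op_trace \<xi> (\<lambda>x. B (F n x) + (- 1) *\<^sub>C F n (B x)) = 0" for n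
    proof -
      obtain r where r: "finite_rank r (F n)" using approximatesD(2)[OF F, of n] by blast
      note fr = finite_rank_comp[OF r B]
      show ?thesis
        unfolding op_trace_add[OF \<xi> fr(1) finite_rank_scale[OF fr(2)]] op_trace_scale[OF \<xi> fr(2)] fr(3)[OF \<xi>]
        by simp
    qed
    have "\<Lambda> (\<lambda>n. 0) = 0" by (rule zero[of _ 0]) simp
    then show "\<phi> (\<lambda>x. B (T x) - T (B x)) = 0"
      unfolding eq \<phi>[OF approximates_add[OF L approximates_scale[OF M]]] tr .
  qed
  moreover have diag: "\<phi> (diag_op b w w) = \<Lambda> (\<lambda>n. \<Sum>j<n. b j)"
    if "orthonormal_on UNIV w" "\<And>j. cmod (b j) \<le> K * g (real j)" for b w K
    unfolding \<phi>[OF approximates_diag_op[where a = b, OF that]] op_trace_truncate[OF \<xi> that(1)] ..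
  have "\<phi> T = 1" if T: "bounded_clinear T" "orthonormal_basis \<eta>" "\<And>j. T (\<eta> j) = g (real j) *\<^sub>R \<eta> j" for T \<eta>
  proof -
    have "T = diag_op (\<lambda>j. complex_of_real (g (real j))) \<eta> \<eta>"
      using T(3) by (intro diag_op_of_eigenbasis T) (simp add: scaleC_of_real)
    moreover have "cmod (complex_of_real (g (real j))) \<le> 1 * g (real j)" for j using g_pos[of j] by simp
    ultimately show ?thesis
      using diag[of \<eta> "\<lambda>j. complex_of_real (g (real j))" 1] orthonormal_basis_orthonormal[OF T(2)] one by simp
  qed
  ultimately have "normalized_trace g \<phi>" unfolding normalized_trace_def by blast
  moreover have "\<phi> (diag_op a u u) = v" using diag[OF u a] val by simp
  ultimately show ?thesis by blast
qed

end

section \<open>Inversion of the counting function\<close>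

lemma weyl_main_term_at_top:
  fixes c p q :: real
  assumes c: "c > 0" "p > 0" "q \<ge> 0"
  shows "filterlim (\<lambda>x. c * x powr p * ln x powr q) at_top at_top"
proof (cases "q = 0")
  case True
  have a: "filterlim (\<lambda>x. c * x powr p * 1) at_top at_top" using c(1,2) by real_asymp
  have b: "\<forall>\<^sub>F x in at_top. c * x powr p * 1 = c * x powr p * ln x powr q"
    using eventually_gt_at_top[of 1] by eventually_elim (simp add: True)
  show ?thesis by (rule filterlim_cong[OF refl refl b, THEN iffD1, OF a])
next
  case False
  then have "q > 0" using c(3) by simp
  then show ?thesis using c(1,2) by real_asymp
qed

text \<open>
  Since \<open>l\<close> is monotone, at most \<open>j\<close> terms are below \<open>l j\<close> and at least \<open>j + 1\<close> terms are below every
  \<open>y > l j\<close>.  The asymptotics of the counting function at \<open>l j\<close>, and at \<open>y\<close> in the limit from the right,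
  therefore enclose \<open>j + 1\<close>, whatever the multiplicity of the value \<open>l j\<close>.
\<close>

lemma counting_inversion:
  fixes l :: "nat \<Rightarrow> real" and c p q \<alpha> :: real and \<epsilon> :: "real \<Rightarrow> real"
  defines "F \<equiv> \<lambda>x. c * x powr p * ln x powr q"
  assumes l: "mono l" "\<And>j. l j > 0"
    and c: "c > 0" "p > 0" "q \<ge> 0" "\<alpha> > 0"
    and \<epsilon>: "\<epsilon> \<in> O(\<lambda>x. ln x powr (- \<alpha>))"
    and N: "\<forall>\<^sub>F x in at_top. real (card {j. l j < x}) = F x * (1 + \<epsilon> x)"
  shows "filterlim l at_top sequentially"
    and "\<exists>K. \<forall>\<^sub>F j in sequentially. \<bar>real (j + 1) / F (l j) - 1\<bar> \<le> K * ln (l j) powr (- \<alpha>)"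
proof -
  obtain K where K: "K > 0" "\<forall>\<^sub>F x in at_top. norm (\<epsilon> x) \<le> K * norm (ln x powr (- \<alpha>))"
    using landau_o.bigE[OF \<epsilon>] by auto
  have lim0: "((\<lambda>x. K * ln x powr (- \<alpha>)) \<longlongrightarrow> 0) at_top"
    using c(4) K(1) by real_asymp
  have Finf: "filterlim F at_top at_top"
    unfolding F_def by (rule weyl_main_term_at_top[OF c(1-3)])
  have Kev: "\<forall>\<^sub>F x in at_top. \<bar>\<epsilon> x\<bar> \<le> K * ln x powr (- \<alpha>)"
    using K(2) by eventually_elim simp
  have half: "\<forall>\<^sub>F x in at_top. K * ln x powr (- \<alpha>) < 1/2"
    using order_tendstoD(2)[OF lim0, of "1/2"] by simp
  have pos: "\<forall>\<^sub>F x in at_top. card {j. l j < x} > 0"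
    using N Kev half filterlim_at_top_dense[THEN iffD1, OF Finf, rule_format, of 0]
  proof eventually_elim
    case (elim x)
    have "F x * (1 + \<epsilon> x) > 0" using elim by (intro mult_pos_pos) auto
    then have "real (card {j. l j < x}) > 0" using elim by simp
    then show ?case by simp
  qed
  have fin: "finite {j. l j < x}" for x
  proof -
    obtain X where "\<And>y. y \<ge> X \<Longrightarrow> card {j. l j < y} > 0"
      using pos unfolding eventually_at_top_linorder by blast
    then have "finite {j. l j < max x X}" using card_gt_0_iff by (metis max.cobounded2)
    then show ?thesis by (rule rev_finite_subset) auto
  qed
  show linf: "filterlim l at_top sequentially"
    unfolding filterlim_at_top
  proof
    fix Z
    obtain j where "j \<notin> {j. l j < Z}" using fin[of Z] infinite_UNIV_nat by (metis UNIV_eq_I)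
    then have "l i \<ge> Z" if "i \<ge> j" for i using monoD[OF l(1) that] by simp
    then show "\<forall>\<^sub>F j in sequentially. Z \<le> l j" unfolding eventually_sequentially by blast
  qed
  define Q where "Q x \<longleftrightarrow> real (card {j. l j < x}) = F x * (1 + \<epsilon> x) \<and> \<bar>\<epsilon> x\<bar> \<le> K * ln x powr (- \<alpha>) \<and>
     x > 1 \<and> F x > 0" for x
  have "\<forall>\<^sub>F x in at_top. Q x"
    unfolding Q_def
    using N Kev eventually_gt_at_top[of 1] filterlim_at_top_dense[THEN iffD1, OF Finf, rule_format, of 0]
    by eventually_elim auto
  then obtain X where X: "\<And>x. x \<ge> X \<Longrightarrow> Q x" unfolding eventually_at_top_linorder by blast
  have "\<forall>\<^sub>F j in sequentially. l j \<ge> X" using linf unfolding filterlim_at_top by blast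
  moreover have "\<forall>\<^sub>F j in sequentially. F (l j) \<ge> 1" 
    using filterlim_compose[OF Finf linf] unfolding filterlim_at_top by blast
  moreover have "\<bar>real (j + 1) / F (l j) - 1\<bar> \<le> K * ln (l j) powr (- \<alpha>)" if j: "l j \<ge> X" "F (l j) \<ge> 1" for j
  proof -
    let ?x = "l j"
    have Qx: "Q ?x" using X j by blast
    have "card {i. l i < ?x} \<le> card {..<j}"
    proof (rule card_mono)
      show "{i. l i < ?x} \<subseteq> {..<j}" using monoD[OF l(1)] by (auto simp: not_le[symmetric] intro: ccontr)
    qed simp
    then have low: "F ?x * (1 + \<epsilon> ?x) \<le> real j" using Qx by (simp add: Q_def)
    have "F ?x * (1 - K * ln ?x powr (- \<alpha>)) \<le> F ?x * (1 + \<epsilon> ?x)"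
      using Qx by (intro mult_left_mono) (auto simp: Q_def)
    then have lower: "1 - K * ln ?x powr (- \<alpha>) \<le> real (j + 1) / F ?x"
      using low Qx by (simp add: Q_def field_simps)
    have up: "real (j + 1) \<le> F y * (1 + K * ln y powr (- \<alpha>))" if y: "y > ?x" for y
    proof -
      have Qy: "Q y" using X j y by simp
      have "card {..j} \<le> card {i. l i < y}"
        using monoD[OF l(1)] y by (intro card_mono fin) (auto intro: le_less_trans)
      then have "real (j + 1) \<le> F y * (1 + \<epsilon> y)" using Qy by (simp add: Q_def)
      also have "\<dots> \<le> F y * (1 + K * ln y powr (- \<alpha>))"
        using Qy by (intro mult_left_mono) (auto simp: Q_def)
      finally show ?thesis .
    qed
    have x1: "?x > 1" using Qx by (simp add: Q_def)
    \<comment> \<open>the error term \<open>\<epsilon>\<close> need not be continuous, but its bound is\<close>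
    have "((\<lambda>y. F y * (1 + K * ln y powr (- \<alpha>))) \<longlongrightarrow> F ?x * (1 + K * ln ?x powr (- \<alpha>))) (at_right ?x)"
      unfolding F_def using x1 by (intro tendsto_intros) auto
    moreover have "\<forall>\<^sub>F y in at_right ?x. real (j + 1) \<le> F y * (1 + K * ln y powr (- \<alpha>))"
      using eventually_at_right_less by (rule eventually_mono) (rule up)
    ultimately have "real (j + 1) \<le> F ?x * (1 + K * ln ?x powr (- \<alpha>))"
      by (rule tendsto_lowerbound) simp
    then have "real (j + 1) / F ?x \<le> 1 + K * ln ?x powr (- \<alpha>)" using j(2) by (simp add: field_simps)
    with lower show ?thesis by linarith
  qed
  ultimately show "\<exists>K. \<forall>\<^sub>F j in sequentially. \<bar>real (j + 1) / F (l j) - 1\<bar> \<le> K * ln (l j) powr (- \<alpha>)"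
    by (intro exI[of _ K]) (auto elim: eventually_elim2)
qed

section \<open>The logarithmic weights\<close>

lemma taylor_powr: "q > 0 \<Longrightarrow> (\<lambda>u::real. (1 - u) powr q - 1 + q * u) \<in> O[at_right 0](\<lambda>u. u\<^sup>2)"
  by real_asymp

lemma weight_shift:
  assumes "q > 0"
  shows "(\<lambda>t::real. (1 / t * ln t powr q) / (inverse (t + 1) * ln (t + 2) powr q) - 1) \<in> O(\<lambda>t. 1 / ln (t + 2))"
    "(\<lambda>t::real. ln (ln t) / ln t - ln (ln (t + 2)) / ln (t + 2)) \<in> O(\<lambda>t. 1 / ln (t + 2))"
proof -
  define u where "u t = (ln (t + 2) - ln t) / ln (t + 2)" for t :: real
  have U: "filterlim u (at_right 0) at_top" unfolding u_def by real_asymp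
  have uO: "u \<in> O(\<lambda>t. 1 / ln (t + 2))" unfolding u_def by real_asymp
  have "(\<lambda>u::real. (1 - u) powr q - 1) \<in> O[at_right 0](\<lambda>u. u)" using assms by real_asymp
  from landau_o.big.compose[OF this U] have "(\<lambda>t. (1 - u t) powr q - 1) \<in> O(u)" .
  then have S: "(\<lambda>t. (1 - u t) powr q - 1) \<in> O(\<lambda>t. 1 / ln (t + 2))" using uO by (rule landau_o.big_trans)
  have "(\<lambda>t::real. (t + 1) / t) \<in> O(\<lambda>_. 1)" by real_asymp
  from landau_o.big.mult[OF this S]
  have "(\<lambda>t. (t + 1) / t * ((1 - u t) powr q - 1)) \<in> O(\<lambda>t. 1 / ln (t + 2))" by simp
  moreover have "(\<lambda>t::real. (t + 1) / t - 1) \<in> O(\<lambda>t. 1 / ln (t + 2))" by real_asymp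
  ultimately have "(\<lambda>t. (t + 1) / t * ((1 - u t) powr q - 1) + ((t + 1) / t - 1)) \<in> O(\<lambda>t. 1 / ln (t + 2))"
    by (rule sum_in_bigo)
  moreover have "\<forall>\<^sub>F t in at_top. (t + 1) / t * ((1 - u t) powr q - 1) + ((t + 1) / t - 1) =
      (1 / t * ln t powr q) / (inverse (t + 1) * ln (t + 2) powr q) - 1"
    using eventually_gt_at_top[of 1]
  proof eventually_elim
    case (elim t)
    have "1 - u t = ln t / ln (t + 2)" using elim by (simp add: u_def field_simps)
    then have "(1 - u t) powr q = ln t powr q / ln (t + 2) powr q" using elim by (simp add: powr_divide)
    then show ?case using elim by (simp add: field_simps)
  qed
  ultimately show "(\<lambda>t::real. (1 / t * ln t powr q) / (inverse (t + 1) * ln (t + 2) powr q) - 1) \<in> O(\<lambda>t. 1 / ln (t + 2))"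
    by (rule landau_o.big.in_cong[THEN iffD1, rotated])
  show "(\<lambda>t::real. ln (ln t) / ln t - ln (ln (t + 2)) / ln (t + 2)) \<in> O(\<lambda>t. 1 / ln (t + 2))"
    by real_asymp
qed

text \<open>
  The numerator has the size of the deviation of \<open>a\<^sub>j\<close> from \<open>c p\<^sup>-\<^sup>q g(j)\<close>, and the denominator is the
  increment of \<open>(log(n + 2))\<^sup>q\<close>, that is, of \<open>n g(n)\<close> up to a bounded factor.
\<close>

lemma weight_increment:
  assumes "(q::real) > 0" "k > 0"
  shows "filterlim (\<lambda>j::nat. k * (inverse (real j + 1) * ln (real j + 2) powr q * (ln (ln (real j + 2)) / ln (real j + 2))) /
      (ln (real j + 3) powr q - ln (real j + 2) powr q)) at_top sequentially"
  using assms by real_asymp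

lemma weight_increment_pos:
  assumes "(q::real) > 0"
  shows "ln (real j + 3) powr q - ln (real j + 2) powr q > 0"
proof -
  have "ln (real j + 2) < ln (real j + 3)" by simp
  then show ?thesis using assms by (simp add: powr_less_mono2)
qed

lemma weight_tendsto:
  assumes "(q::real) \<ge> 0"
  shows "(\<lambda>j::nat. inverse (real j + 1) * ln (real j + 2) powr q) \<longlonglongrightarrow> 0"
proof (cases "q = 0")
  case True
  have "(\<lambda>j::nat. inverse (real j + 1)) \<longlonglongrightarrow> 0" by real_asymp
  then show ?thesis using True by simp
next
  case False
  then have "q > 0" using assms by simp
  then show ?thesis by real_asymp
qed

text \<open>
  The Stolz--Cesaro principle for infinite limits.
\<close>

lemma stolz_dominate:
  fixes x t :: "nat \<Rightarrow> real"
  assumes x: "\<And>M. \<forall>\<^sub>F j in sequentially. x j \<ge> M * t j"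
    and T: "filterlim (\<lambda>n. \<Sum>j<n. t j) at_top sequentially"
  shows "\<forall>\<^sub>F n in sequentially. (\<Sum>j<n. x j) \<ge> M * (\<Sum>j<n. t j)"
proof -
  obtain J where J: "\<And>j. j \<ge> J \<Longrightarrow> x j \<ge> (M + 1) * t j"
    using x[of "M + 1"] unfolding eventually_sequentially by blast
  define B where "B = (M + 1) * (\<Sum>j<J. t j) - (\<Sum>j<J. x j)"
  have "\<forall>\<^sub>F n in sequentially. (\<Sum>j<n. t j) \<ge> B" using T unfolding filterlim_at_top by blast
  moreover have "\<forall>\<^sub>F n in sequentially. n \<ge> J" by (rule eventually_ge_at_top)
  ultimately show ?thesis
  proof eventually_elim
    case (elim n)
    have split: "(\<Sum>j<n. f j) = (\<Sum>j<J. f j) + (\<Sum>j=J..<n. f j)" for f :: "nat \<Rightarrow> real"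
      using elim(2) by (metis lessThan_atLeast0 sum.atLeastLessThan_concat zero_le)
    have "(M + 1) * (\<Sum>j=J..<n. t j) \<le> (\<Sum>j=J..<n. x j)"
      unfolding sum_distrib_left using J by (intro sum_mono) auto
    then have "(\<Sum>j<n. x j) \<ge> (M + 1) * (\<Sum>j<n. t j) - B"
      unfolding split[of x] split[of t] B_def by (simp add: algebra_simps)
    then show ?case using elim(1) by (simp add: algebra_simps)
  qed
qed

lemma powr_one_minus_le:
  fixes u q :: real
  assumes "0 \<le> u" "u < 1" "q > 0"
  shows "(1 - u) powr q \<le> 1 - q / (1 + q) * u"
proof -
  have "ln (1 - u) \<le> - u" using ln_le_minus_one[of "1 - u"] assms by simp
  then have "q * ln (1 - u) \<le> - (q * u)" using assms by (metis mult_left_mono less_imp_le mult_minus_right)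
  then have "(1 - u) powr q \<le> exp (- (q * u))" using assms by (simp add: powr_def)
  also have "\<dots> \<le> 1 / (1 + q * u)"
    using exp_ge_add_one_self[of "q * u"] assms by (simp add: exp_minus inverse_eq_divide frac_le add_pos_nonneg)
  also have "\<dots> \<le> 1 - q / (1 + q) * u"
  proof -
    have "q * u \<le> q * 1" using assms by (intro mult_left_mono) auto
    then have "q * u / (1 + q) \<le> q * u / (1 + q * u)"
      using assms by (intro divide_left_mono) (auto intro!: mult_pos_pos add_pos_nonneg)
    moreover have "1 + q * u > 0" using assms by (simp add: add_pos_nonneg)
    then have "1 / (1 + q * u) = 1 - q * u / (1 + q * u)" by (simp add: field_simps)
    ultimately show ?thesis by simp
  qed
  finally show ?thesis .
qed

lemma powr_one_minus_ge:
  fixes u s :: real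
  assumes "0 \<le> u" "u < 1" "s > 0"
  shows "(1 - u) powr (- s) \<ge> 1 + s * u"
proof -
  have "ln (1 - u) \<le> - u" using ln_le_minus_one[of "1 - u"] assms by simp
  then have "s * u \<le> - s * ln (1 - u)" using assms mult_left_mono[of u "- ln (1 - u)" s] by simp
  then have "exp (s * u) \<le> (1 - u) powr (- s)" using assms by (simp add: powr_def)
  then show ?thesis using exp_ge_add_one_self[of "s * u"] by linarith
qed

lemma ln_halving:
  assumes "j \<ge> 1"
  shows "ln (real (j div 2) + 2) \<le> ln (real j + 2) - ln (6/5)" "0 < ln (6/5 :: real)"
    "ln 2 \<le> ln (real (j div 2) + 2)"
proof -
  have "real (j div 2) \<le> real j / 2" by linarith
  then have "(real (j div 2) + 2) * (6/5) \<le> real j + 2" using assms by (simp add: field_simps)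
  then have "ln ((real (j div 2) + 2) * (6/5)) \<le> ln (real j + 2)" by (subst ln_le_cancel_iff) auto
  also have "ln ((real (j div 2) + 2) * (6/5)) = ln (real (j div 2) + 2) + ln (6/5)"
    by (rule ln_mult_pos) auto
  finally show "ln (real (j div 2) + 2) \<le> ln (real j + 2) - ln (6/5)" by simp
qed auto

text \<open>
  The power \<open>(log(j + 2))\<^sup>q\<close> is a potential for \<open>(log(j + 2))\<^sup>q\<^sup>-\<^sup>1\<close> in the sense of \<open>trace_diag_op_zero\<close>:
  halving the index lowers the logarithm by at least the constant \<open>log(6/5)\<close>.
\<close>

lemma potential_positive:
  fixes q :: real
  assumes q: "q > 0"
  shows "\<exists>k>0. \<forall>j\<ge>1. k * ln (real j + 2) powr (q - 1) \<le> ln (real j + 2) powr q - ln (real (j div 2) + 2) powr q"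
proof (intro exI conjI allI impI)
  let ?\<kappa> = "ln (6/5 :: real)"
  show "q / (1 + q) * ?\<kappa> > 0" using q by simp
  fix j :: nat assume j: "j \<ge> 1"
  define y where "y = ln (real j + 2)"
  define y' where "y' = ln (real (j div 2) + 2)"
  have y': "y' > 0" "y' \<le> y - ?\<kappa>" using ln_halving[OF j] by (auto simp: y_def y'_def)
  have y: "y > ?\<kappa>" "y > 0" using y' ln_halving(2)[OF j] by linarith+
  have "y' powr q \<le> (y - ?\<kappa>) powr q" using y' q by (intro powr_mono2) auto
  also have "y - ?\<kappa> = y * (1 - ?\<kappa> / y)" using y by (simp add: field_simps)
  also have "(y * (1 - ?\<kappa> / y)) powr q = y powr q * (1 - ?\<kappa> / y) powr q" using y by (simp add: powr_mult)
  also have "\<dots> \<le> y powr q * (1 - q / (1 + q) * (?\<kappa> / y))"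
    using y q by (intro mult_left_mono powr_one_minus_le) auto
  also have "\<dots> = y powr q - q / (1 + q) * ?\<kappa> * y powr (q - 1)"
    using y by (simp add: powr_diff algebra_simps)
  finally show "q / (1 + q) * ?\<kappa> * ln (real j + 2) powr (q - 1) \<le> ln (real j + 2) powr q - ln (real (j div 2) + 2) powr q"
    by (simp add: y_def y'_def)
qed

text \<open>
  The analogous potential for \<open>(log(j + 2))\<^sup>-\<^sup>s\<^sup>-\<^sup>1\<close> is a constant minus \<open>(log(j + 2))\<^sup>-\<^sup>s\<close>, which is bounded.
\<close>

lemma potential_negative:
  fixes s :: real
  assumes s: "s > 0"
  shows "\<exists>k>0. \<forall>j\<ge>1. k * ln (real j + 2) powr (- s - 1) \<le> ln (real (j div 2) + 2) powr (- s) - ln (real j + 2) powr (- s)"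
proof (intro exI conjI allI impI)
  let ?\<kappa> = "ln (6/5 :: real)"
  show "s * ?\<kappa> > 0" using s by simp
  fix j :: nat assume j: "j \<ge> 1"
  define y where "y = ln (real j + 2)"
  define y' where "y' = ln (real (j div 2) + 2)"
  have y': "y' > 0" "y' \<le> y - ?\<kappa>" using ln_halving[OF j] by (auto simp: y_def y'_def)
  have y: "y > ?\<kappa>" "y > 0" using y' ln_halving(2)[OF j] by linarith+
  have "y powr (- s) + s * ?\<kappa> * y powr (- s - 1) = y powr (- s) * (1 + s * (?\<kappa> / y))"
    using y by (simp add: powr_diff algebra_simps)
  also have "\<dots> \<le> y powr (- s) * (1 - ?\<kappa> / y) powr (- s)"
    using y s by (intro mult_left_mono powr_one_minus_ge) auto
  also have "\<dots> = (y * (1 - ?\<kappa> / y)) powr (- s)" using y by (simp add: powr_mult)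
  also have "y * (1 - ?\<kappa> / y) = y - ?\<kappa>" using y by (simp add: field_simps)
  also have "(y - ?\<kappa>) powr (- s) \<le> y' powr (- s)" using y' s by (intro powr_mono2') auto
  finally show "s * ?\<kappa> * ln (real j + 2) powr (- s - 1) \<le> ln (real (j div 2) + 2) powr (- s) - ln (real j + 2) powr (- s)"
    by (simp add: y_def y'_def)
qed

text \<open>
  With \<open>r = (i + 2)/(j + 2)\<close>, the logarithm grows at most by the factor \<open>1 + log r / log 2\<close>, whose \<open>q\<close>-th
  power is \<open>O(r)\<close>.
\<close>

lemma weight_quasi_decreasing:
  fixes q :: real
  assumes q: "q \<ge> 0"
  shows "\<exists>C. \<forall>i j::nat. j \<le> i \<longrightarrow>
     inverse (real i + 1) * ln (real i + 2) powr q \<le> C * (inverse (real j + 1) * ln (real j + 2) powr q)"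
proof -
  \<comment> \<open>the tangent of the logarithm at \<open>A\<close> gives \<open>ln (1 + x / ln 2) \<le> (1 + x / ln 2) / A + ln A\<close>; its slope
      is small enough for \<open>q\<close> times the right-hand side to grow at most like \<open>x\<close>\<close>
  define A where "A = q / ln 2 + 1"
  have A: "A \<ge> 1" using q by (simp add: A_def)
  define B where "B = exp (q / A + q * ln A)"
  have key: "(1 + x / ln 2) powr q \<le> B * exp x" if x: "x \<ge> 0" for x :: real
  proof -
    have z: "1 + x / ln 2 > 0" using x by (simp add: add_pos_nonneg)
    have "ln (1 + x / ln 2) = ln ((1 + x / ln 2) / A) + ln A" using A z by (simp add: ln_div)
    also have "\<dots> \<le> (1 + x / ln 2) / A + ln A"
      using ln_le_minus_one[of "(1 + x / ln 2) / A"] A z by simp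
    finally have "q * ln (1 + x / ln 2) \<le> q * ((1 + x / ln 2) / A + ln A)" using q by (rule mult_left_mono)
    also have "\<dots> = q / A + q * ln A + (q / ln 2 / A) * x"
      by (simp add: ring_distribs add_divide_distrib)
    also have "(q / ln 2 / A) * x \<le> 1 * x"
    proof (rule mult_right_mono)
      have "q / ln 2 \<le> A" by (simp add: A_def)
      then show "q / ln 2 / A \<le> 1" using A by (subst divide_le_eq_1_pos) auto
    qed (fact x)
    finally have "q * ln (1 + x / ln 2) \<le> q / A + q * ln A + x" by simp
    then show ?thesis using z by (simp add: powr_def B_def flip: exp_add)
  qed
  show ?thesis
  proof (intro exI allI impI)
    fix i j :: nat assume ij: "j \<le> i"
    define r where "r = (real i + 2) / (real j + 2)"
    have r: "r \<ge> 1" using ij by (simp add: r_def)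
    have y: "ln (real j + 2) \<ge> ln 2" by simp
    have y0: "ln (real j + 2) > 0" by simp
    have "ln (real i + 2) = ln (real j + 2) + ln r" by (simp add: r_def ln_div)
    also have "\<dots> \<le> ln (real j + 2) * (1 + ln r / ln 2)"
    proof -
      have "ln r * 1 \<le> ln r * (ln (real j + 2) / ln 2)" using r y by (intro mult_left_mono) auto
      then show ?thesis by (simp add: algebra_simps)
    qed
    finally have "ln (real i + 2) powr q \<le> (ln (real j + 2) * (1 + ln r / ln 2)) powr q"
      using q by (intro powr_mono2) auto
    also have "\<dots> = ln (real j + 2) powr q * (1 + ln r / ln 2) powr q"
      using r y0 by (simp add: powr_mult)
    also have "\<dots> \<le> ln (real j + 2) powr q * (B * exp (ln r))" using r by (intro mult_left_mono key) auto
    also have "\<dots> = ln (real j + 2) powr q * (B * r)" using r by simp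
    finally have 1: "ln (real i + 2) powr q \<le> ln (real j + 2) powr q * (B * r)" .
    have "(real i + 2) * (real j + 1) \<le> (real i + 1) * (real j + 2)" using ij by (simp add: algebra_simps)
    then have "r \<le> (real i + 1) / (real j + 1)" by (simp add: r_def field_simps)
    then have 2: "inverse (real i + 1) * r \<le> inverse (real j + 1)" by (simp add: field_simps)
    have B0: "B > 0" by (simp add: B_def)
    have "inverse (real i + 1) * ln (real i + 2) powr q \<le> inverse (real i + 1) * (ln (real j + 2) powr q * (B * r))"
      using 1 by (intro mult_left_mono) auto
    also have "\<dots> = B * ln (real j + 2) powr q * (inverse (real i + 1) * r)" by simp
    also have "\<dots> \<le> B * ln (real j + 2) powr q * inverse (real j + 1)"
      using 2 B0 by (intro mult_left_mono) auto
    finally show "inverse (real i + 1) * ln (real i + 2) powr q \<le> B * (inverse (real j + 1) * ln (real j + 2) powr q)"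
      by (simp add: mult_ac)
  qed
qed

lemma weight_halving:
  fixes q :: real
  assumes q: "q \<ge> 0"
  shows "inverse (real (j div 2) + 1) * ln (real (j div 2) + 2) powr q \<le> 2 * (inverse (real j + 1) * ln (real j + 2) powr q)"
proof -
  have "j + 1 \<le> 2 * (j div 2 + 1)" by presburger
  then have "real (j + 1) \<le> real (2 * (j div 2 + 1))" by (rule of_nat_mono)
  then have "inverse (real (j div 2) + 1) \<le> 2 * inverse (real j + 1)" by (simp add: field_simps)
  moreover have "ln (real (j div 2) + 2) powr q \<le> ln (real j + 2) powr q"
  proof -
    have "real (j div 2) \<le> real j" by simp
    then show ?thesis using q by (intro powr_mono2) auto
  qed
  ultimately show ?thesis by (subst mult.assoc[symmetric]) (intro mult_mono, auto)
qed

section \<open>Asymptotics of the eigenvalues\<close>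

lemma tendsto_zero_if_bigo:
  fixes f h :: "'b \<Rightarrow> real"
  assumes "f \<in> O[F](h)" "(h \<longlongrightarrow> 0) F"
  shows "(f \<longlongrightarrow> 0) F"
proof -
  obtain K where K: "K > 0" "\<forall>\<^sub>F x in F. norm (f x) \<le> K * norm (h x)"
    using landau_o.bigE[OF assms(1)] by auto
  have "((\<lambda>x. K * norm (h x)) \<longlongrightarrow> K * norm (0::real)) F" by (intro tendsto_intros assms(2))
  then have "((\<lambda>x. K * norm (h x)) \<longlongrightarrow> 0) F" by simp
  with K(2) show ?thesis by (rule Lim_null_comparison)
qed

context
  fixes l :: "nat \<Rightarrow> real" and c p q \<alpha> K :: real
  assumes linf: "filterlim l at_top sequentially"
    and c: "c > 0" "p > 0" "q \<ge> 0" "\<alpha> > 0"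
    and K: "\<forall>\<^sub>F j in sequentially.
      \<bar>real (j + 1) / (c * l j powr p * ln (l j) powr q) - 1\<bar> \<le> K * ln (l j) powr (- \<alpha>)"
begin

private definition "\<theta> j = real (j + 1) / (c * l j powr p * ln (l j) powr q) - 1"

private lemma Linf: "filterlim (\<lambda>j. ln (l j)) at_top sequentially"
  by (rule filterlim_compose[OF ln_at_top linf])

private lemma Yinf: "filterlim (\<lambda>j. ln (real j + 2)) at_top sequentially" by real_asymp

private lemma theta_bigo: "\<theta> \<in> O(\<lambda>j. ln (l j) powr (- \<alpha>))"
proof (rule landau_o.bigI[of "\<bar>K\<bar> + 1"])
  show "\<forall>\<^sub>F j in sequentially. norm (\<theta> j) \<le> (\<bar>K\<bar> + 1) * norm (ln (l j) powr (- \<alpha>))"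
    using K
  proof eventually_elim
    case (elim j)
    have "K * ln (l j) powr (- \<alpha>) \<le> (\<bar>K\<bar> + 1) * ln (l j) powr (- \<alpha>)" by (rule mult_right_mono) auto
    with elim show ?case by (simp add: \<theta>_def)
  qed
qed simp

private lemma theta_lim: "\<theta> \<longlonglongrightarrow> 0"
proof (rule tendsto_zero_if_bigo[OF theta_bigo])
  have "((\<lambda>x. x powr (- \<alpha>)) \<longlongrightarrow> 0) at_top" using c(4) by real_asymp
  from filterlim_compose[OF this Linf] show "(\<lambda>j. ln (l j) powr - \<alpha>) \<longlonglongrightarrow> 0" .
qed

private lemma ev: "\<forall>\<^sub>F j in sequentially. l j > 1 \<and> ln (l j) > 0 \<and> \<theta> j > - 1 \<and>
    real (j + 1) = c * l j powr p * ln (l j) powr q * (1 + \<theta> j)"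
proof -
  have "\<forall>\<^sub>F j in sequentially. l j > 1"
    using filterlim_at_top_dense[THEN iffD1, OF linf] by blast
  moreover have "\<forall>\<^sub>F j in sequentially. \<theta> j > - 1"
    by (rule order_tendstoD(1)[OF theta_lim]) simp
  ultimately show ?thesis
  proof eventually_elim
    case (elim j)
    then have "ln (l j) > 0" by simp
    then have "c * l j powr p * ln (l j) powr q > 0" using c elim by (intro mult_pos_pos) auto
    then show ?case using elim c \<open>ln (l j) > 0\<close> by (simp add: \<theta>_def)
  qed
qed

private definition "\<beta> j = ln (real j + 2) - p * ln (l j) - q * ln (ln (l j))"

private lemma beta_lim: "\<beta> \<longlonglongrightarrow> ln c"
proof -
  have "(\<lambda>j. ln c + ln (1 + \<theta> j) + (ln (real j + 2) - ln (real j + 1))) \<longlonglongrightarrow> ln c + ln (1 + 0) + 0"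
  proof (intro tendsto_add tendsto_const tendsto_ln)
    show "\<theta> \<longlonglongrightarrow> 0" by (rule theta_lim)
    show "(\<lambda>j. ln (real j + 2) - ln (real j + 1)) \<longlonglongrightarrow> 0" by real_asymp
  qed simp
  moreover have "\<forall>\<^sub>F j in sequentially. ln c + ln (1 + \<theta> j) + (ln (real j + 2) - ln (real j + 1)) = \<beta> j"
    using ev
  proof eventually_elim
    case (elim j)
    have "ln (real (j + 1)) = ln (c * l j powr p * ln (l j) powr q * (1 + \<theta> j))" using elim by presburger
    also have "\<dots> = ln c + p * ln (l j) + q * ln (ln (l j)) + ln (1 + \<theta> j)"
      using elim c by (simp add: ln_mult ln_powr)
    finally show ?case by (simp add: \<beta>_def add.commute)
  qed
  ultimately have "\<beta> \<longlonglongrightarrow> ln c + ln (1 + 0) + 0" by (rule Lim_transform_eventually)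
  then show ?thesis by simp
qed

text \<open>
  The relation \<open>log(j + 2) = p log l\<^sub>j + q log log l\<^sub>j + O(1)\<close> makes powers of \<open>log l\<^sub>j\<close> and of \<open>log(j + 2)\<close>
  comparable.
\<close>

private lemma ratio_lim: "(\<lambda>j. ln (real j + 2) / ln (l j)) \<longlonglongrightarrow> p"
proof -
  have "((\<lambda>x::real. ln x / x) \<longlongrightarrow> 0) at_top" by real_asymp
  from filterlim_compose[OF this Linf] have 1: "(\<lambda>j. ln (ln (l j)) / ln (l j)) \<longlonglongrightarrow> 0" .
  have 2: "(\<lambda>j. \<beta> j / ln (l j)) \<longlonglongrightarrow> 0"
    by (rule tendsto_divide_0[OF beta_lim filterlim_at_top_imp_at_infinity[OF Linf]])
  have "(\<lambda>j. p + q * (ln (ln (l j)) / ln (l j)) + \<beta> j / ln (l j)) \<longlonglongrightarrow> p + q * 0 + 0"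
    by (intro tendsto_intros 1 2)
  moreover have "\<forall>\<^sub>F j in sequentially. p + q * (ln (ln (l j)) / ln (l j)) + \<beta> j / ln (l j) = ln (real j + 2) / ln (l j)"
    using ev by eventually_elim (simp add: \<beta>_def field_simps)
  ultimately have "(\<lambda>j. ln (real j + 2) / ln (l j)) \<longlonglongrightarrow> p + q * 0 + 0" by (rule Lim_transform_eventually)
  then show ?thesis by simp
qed

private lemma log_power_bigo: "(\<lambda>j. ln (l j) powr (- s)) \<in> O(\<lambda>j. ln (real j + 2) powr (- s))"
proof (rule bigoI_tendsto)
  have "(\<lambda>j. (ln (real j + 2) / ln (l j)) powr s) \<longlonglongrightarrow> p powr s"
    using c(2) by (intro tendsto_intros ratio_lim) auto
  moreover have "\<forall>\<^sub>F j in sequentially. (ln (real j + 2) / ln (l j)) powr s =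
      ln (l j) powr (- s) / ln (real j + 2) powr (- s)"
    using ev by eventually_elim (simp add: powr_divide powr_minus_divide)
  ultimately show "(\<lambda>j. ln (l j) powr (- s) / ln (real j + 2) powr (- s)) \<longlonglongrightarrow> p powr s"
    by (rule Lim_transform_eventually)
  show "\<forall>\<^sub>F j in sequentially. ln (real j + 2) powr - s \<noteq> 0" by (intro always_eventually allI) simp
qed

lemma eigenvalue_power_asymptotics_pure:
  assumes q0: "q = 0"
  shows "(\<lambda>j. l j powr (- p) * real (j + 1) - c) \<in> O(\<lambda>j. ln (real j + 2) powr (- \<alpha>))"
proof -
  have "(\<lambda>j. c * \<theta> j) \<in> O(\<lambda>j. ln (real j + 2) powr (- \<alpha>))"
    using landau_o.big_trans[OF theta_bigo log_power_bigo] c(1) by simp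
  moreover have "\<forall>\<^sub>F j in sequentially. c * \<theta> j = l j powr (- p) * real (j + 1) - c"
    using ev
  proof eventually_elim
    case (elim j)
    have "l j powr (- p) * real (j + 1) = l j powr (- p) * (c * l j powr p * ln (l j) powr q * (1 + \<theta> j))"
      using elim by presburger
    also have "\<dots> = c * (1 + \<theta> j)" using elim q0 by (simp add: powr_minus field_simps)
    finally show ?case by (simp add: algebra_simps)
  qed
  ultimately show ?thesis by (rule landau_o.big.in_cong[THEN iffD1, rotated])
qed

text \<open>
  Put \<open>u = 1 - p log l\<^sub>j / y\<close>.  Then \<open>u = q (log y)/y + O(1/y)\<close>, and
  \<open>(1 - u)\<^sup>q = 1 - q u + O(u\<^sup>2) = 1 - q\<^sup>2 (log y)/y + O(1/y)\<close>.  The relative error of the counting function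
  contributes another \<open>O(1/y)\<close>.
\<close>

lemma eigenvalue_power_asymptotics_log:
  assumes q: "q > 0" and \<alpha>: "\<alpha> = 1"
  defines "y \<equiv> \<lambda>j. ln (real j + 2)"
  shows "(\<lambda>j. l j powr (- p) / (c * p powr (- q) * (inverse (real j + 1) * y j powr q)) -
      (1 - q\<^sup>2 * (ln (y j) / y j))) \<in> O(\<lambda>j. 1 / y j)"
proof -
  have y0: "y j > 0" for j by (simp add: y_def)
  have yinf: "filterlim y at_top sequentially" unfolding y_def by (rule Yinf)
  define u where "u j = (q * ln (ln (l j)) + \<beta> j) / y j" for j
  have u_eq: "\<forall>\<^sub>F j in sequentially. 1 - u j = p * ln (l j) / y j"
    using ev
  proof eventually_elim
    case (elim j)
    show ?case using y0[of j] by (simp add: u_def \<beta>_def y_def field_simps)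
  qed
  define r where "r j = u j - q * (ln (y j) / y j)" for j
  have r: "r \<in> O(\<lambda>j. 1 / y j)"
  proof -
    have "(\<lambda>j. \<beta> j - q * ln (y j / ln (l j))) \<longlonglongrightarrow> ln c - q * ln p"
      unfolding y_def using c(2) by (intro tendsto_intros beta_lim ratio_lim) auto
    then have "(\<lambda>j. \<beta> j - q * ln (y j / ln (l j))) \<in> O(\<lambda>_. 1)" by (intro bigoI_tendsto[where c = "ln c - q * ln p"]) auto
    from landau_o.big.mult[OF this landau_o.big_refl[of "\<lambda>j. 1 / y j"]]
    have "(\<lambda>j. (\<beta> j - q * ln (y j / ln (l j))) * (1 / y j)) \<in> O(\<lambda>j. 1 / y j)" by simp
    moreover have "\<forall>\<^sub>F j in sequentially. (\<beta> j - q * ln (y j / ln (l j))) * (1 / y j) = r j"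
      using ev
    proof eventually_elim
      case (elim j)
      then have "ln (y j / ln (l j)) = ln (y j) - ln (ln (l j))" using y0[of j] by (simp add: ln_div)
      then have "(\<beta> j - q * ln (y j / ln (l j))) * (1 / y j) = (\<beta> j - q * (ln (y j) - ln (ln (l j)))) / y j"
        by simp
      also have "\<dots> = r j"
        by (simp add: r_def u_def right_diff_distrib diff_divide_distrib add_divide_distrib)
      finally show ?case .
    qed
    ultimately show ?thesis by (rule landau_o.big.in_cong[THEN iffD1, rotated])
  qed
  have u_r: "u j = q * (ln (y j) / y j) + r j" for j by (simp add: r_def)
  have "(\<lambda>x::real. 1 / x) \<in> O(\<lambda>x. ln x / x)" by real_asymp
  from landau_o.big_trans[OF r landau_o.big.compose[OF this yinf]]
  have "r \<in> O(\<lambda>j. ln (y j) / y j)" .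
  moreover have "(\<lambda>j. q * (ln (y j) / y j)) \<in> O(\<lambda>j. ln (y j) / y j)"
    using q by (subst landau_o.big.cmult_in_iff) auto
  ultimately have uO: "u \<in> O(\<lambda>j. ln (y j) / y j)"
    unfolding u_r[abs_def] by (intro sum_in_bigo)
  have "((\<lambda>x::real. ln x / x) \<longlongrightarrow> 0) at_top" by real_asymp
  from tendsto_zero_if_bigo[OF uO filterlim_compose[OF this yinf]] have ulim: "u \<longlonglongrightarrow> 0" .
  have upos: "\<forall>\<^sub>F j in sequentially. u j > 0"
  proof -
    have "filterlim (\<lambda>j. ln (ln (l j))) at_top sequentially"
      by (rule filterlim_compose[OF ln_at_top Linf])
    then have "filterlim (\<lambda>j. q * ln (ln (l j))) at_top sequentially"
      by (rule filterlim_tendsto_pos_mult_at_top[OF tendsto_const q])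
    from filterlim_tendsto_add_at_top[OF beta_lim this]
    have "\<forall>\<^sub>F j in sequentially. \<beta> j + q * ln (ln (l j)) > 0"
      using filterlim_at_top_dense[THEN iffD1] by blast
    then show ?thesis by eventually_elim (simp add: u_def y0 add.commute)
  qed
  have uright: "filterlim u (at_right 0) sequentially"
    using ulim upos by (auto simp: filterlim_at elim: eventually_mono)
  have sq: "(\<lambda>j. (u j)\<^sup>2) \<in> O(\<lambda>j. 1 / y j)"
  proof -
    have "(\<lambda>x::real. (ln x / x)\<^sup>2) \<in> O(\<lambda>x. 1 / x)" by real_asymp
    from landau_o.big_trans[OF landau_o.big_power[OF uO, of 2] landau_o.big.compose[OF this yinf]]
    show ?thesis .
  qed
  have "(\<lambda>j. (1 - u j) powr q - 1 + q * u j) \<in> O(\<lambda>j. (u j)\<^sup>2)"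
    using landau_o.big.compose[OF taylor_powr[OF q] uright] by simp
  from landau_o.big_trans[OF this sq]
  have tay: "(\<lambda>j. (1 - u j) powr q - 1 + q * u j) \<in> O(\<lambda>j. 1 / y j)" .
  define X where "X j = (1 - u j) powr q" for j
  define Z where "Z j = 1 - q\<^sup>2 * (ln (y j) / y j)" for j
  have "(\<lambda>j. ((1 - u j) powr q - 1 + q * u j) - q * r j) \<in> O(\<lambda>j. 1 / y j)"
    using r q by (intro sum_in_bigo tay) simp_all
  then have XZ: "(\<lambda>j. X j - Z j) \<in> O(\<lambda>j. 1 / y j)"
    by (rule landau_o.big.in_cong[THEN iffD1, rotated])
      (auto simp: X_def Z_def u_r power2_eq_square algebra_simps intro!: always_eventually)
  have Xlim: "X \<longlonglongrightarrow> (1 - 0) powr q" unfolding X_def by (intro tendsto_intros ulim) auto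
  then have "X \<in> O(\<lambda>_. 1)" by (intro bigoI_tendsto[where c = "(1 - 0) powr q"]) auto
  moreover have "\<theta> \<in> O(\<lambda>j. 1 / y j)"
  proof -
    have "(\<lambda>j. ln (real j + 2) powr (- 1)) = (\<lambda>j. 1 / y j)"
      by (simp add: y_def powr_minus_divide fun_eq_iff)
    then show ?thesis using landau_o.big_trans[OF theta_bigo log_power_bigo] \<alpha> by simp
  qed
  ultimately have "(\<lambda>j. X j * \<theta> j) \<in> O(\<lambda>j. 1 * (1 / y j))" by (rule landau_o.big.mult)
  then have X\<theta>: "(\<lambda>j. X j * \<theta> j) \<in> O(\<lambda>j. 1 / y j)" by simp
  have "(\<lambda>j. (X j - Z j) + X j * \<theta> j) \<in> O(\<lambda>j. 1 / y j)" by (rule sum_in_bigo[OF XZ X\<theta>])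
  moreover have "\<forall>\<^sub>F j in sequentially. (X j - Z j) + X j * \<theta> j =
      l j powr (- p) / (c * p powr (- q) * (inverse (real j + 1) * y j powr q)) - Z j"
    using ev u_eq
  proof eventually_elim
    case (elim j)
    have X: "X j = p powr q * ln (l j) powr q / y j powr q"
      using elim c y0[of j] by (simp add: X_def powr_mult powr_divide)
    have "l j powr (- p) * real (j + 1) = l j powr (- p) * (c * l j powr p * ln (l j) powr q * (1 + \<theta> j))"
      using elim by presburger
    also have "\<dots> = c * ln (l j) powr q * (1 + \<theta> j)" using elim by (simp add: powr_minus field_simps)
    finally have "l j powr (- p) = c * ln (l j) powr q * (1 + \<theta> j) * inverse (real j + 1)"
      by (simp add: field_simps)
    then have "l j powr (- p) / (c * p powr (- q) * (inverse (real j + 1) * y j powr q)) =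
        c * ln (l j) powr q * (1 + \<theta> j) * inverse (real j + 1) / (c * inverse (p powr q) * (inverse (real j + 1) * y j powr q))"
      by (simp only: powr_minus)
    also have "\<dots> = X j * (1 + \<theta> j)" unfolding X using c y0[of j] by (simp add: divide_simps)
    finally have "l j powr (- p) / (c * p powr (- q) * (inverse (real j + 1) * y j powr q)) = X j * (1 + \<theta> j)" .
    then show ?case by (simp add: algebra_simps)
  qed
  ultimately show ?thesis unfolding Z_def by (rule landau_o.big.in_cong[THEN iffD1, rotated])
qed

end

lemma weyl_function_at_top:
  fixes c p q \<alpha> :: real and \<epsilon> :: "real \<Rightarrow> real"
  assumes c: "c > 0" "p > 0" "q \<ge> 0" "\<alpha> > 0" and \<epsilon>: "\<epsilon> \<in> O(\<lambda>x. ln x powr (- \<alpha>))"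
  shows "filterlim (\<lambda>x. c * x powr p * ln x powr q * (1 + \<epsilon> x)) at_top at_top"
proof -
  note Finf = weyl_main_term_at_top[OF c(1-3)]
  have "((\<lambda>x. ln x powr (- \<alpha>)) \<longlongrightarrow> 0) at_top" using c(4) by real_asymp
  from tendsto_zero_if_bigo[OF \<epsilon> this] have "((\<lambda>x. 1 + \<epsilon> x) \<longlongrightarrow> 1 + 0) at_top" by (intro tendsto_intros)
  from filterlim_tendsto_pos_mult_at_top[OF this _ Finf] show ?thesis by (simp add: mult.commute)
qed

lemma eventually_le_imp_all_le:
  fixes f r :: "nat \<Rightarrow> real"
  assumes "f \<in> O(r)" "\<And>j. r j > 0"
  obtains M where "M > 0" "\<And>j. \<bar>f j\<bar> \<le> M * r j"
proof -
  obtain K where K: "K > 0" "\<forall>\<^sub>F j in sequentially. norm (f j) \<le> K * norm (r j)"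
    using landau_o.bigE[OF assms(1)] by auto
  then obtain N where N: "\<And>j. j \<ge> N \<Longrightarrow> \<bar>f j\<bar> \<le> K * r j"
    unfolding eventually_sequentially using assms(2) by (auto simp: abs_of_pos)
  define M where "M = K + (\<Sum>j<N. \<bar>f j\<bar> / r j)"
  have nn: "(\<Sum>j<N. \<bar>f j\<bar> / r j) \<ge> 0" using assms(2) by (intro sum_nonneg divide_nonneg_pos) auto
  have "\<bar>f j\<bar> \<le> M * r j" for j
  proof (cases "j < N")
    case True
    have "\<bar>f j\<bar> / r j \<le> (\<Sum>j<N. \<bar>f j\<bar> / r j)"
      using True assms(2) by (intro member_le_sum) (auto intro: divide_nonneg_pos)
    then have "\<bar>f j\<bar> / r j \<le> M" using K(1) by (simp add: M_def)
    then show ?thesis using assms(2)[of j] by (simp add: field_simps)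
  next
    case False
    then have "\<bar>f j\<bar> \<le> K * r j" using N by simp
    also have "\<dots> \<le> M * r j" using nn assms(2)[of j] by (simp add: M_def mult_right_mono)
    finally show ?thesis .
  qed
  then show ?thesis using K(1) nn by (intro that[of M]) (auto simp: M_def)
qed

text \<open>
  The function \<open>g\<^sub>1\<close> is given in terms of \<open>t\<close> and \<open>log t\<close>; passing to \<open>t + 1\<close> and \<open>log(t + 2)\<close> changes it by
  a relative error that the \<open>O\<close>-term absorbs.
\<close>

lemma comparison_weight_asymptotics:
  fixes q :: real and g\<^sub>1 \<delta> :: "real \<Rightarrow> real"
  assumes q: "q > 0" and \<delta>: "\<delta> \<in> O(\<lambda>t. inverse (ln t))"
    and g1: "\<forall>\<^sub>F t in at_top. g\<^sub>1 t = 1 / t * ln t powr q * (1 - q\<^sup>2 * (ln (ln t) / ln t) + \<delta> t)"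
  shows "(\<lambda>j. g\<^sub>1 (real j) / (inverse (real j + 1) * ln (real j + 2) powr q) -
      (1 - q\<^sup>2 * (ln (ln (real j + 2)) / ln (real j + 2)))) \<in> O(\<lambda>j. 1 / ln (real j + 2))"
proof -
  define A where "A t = (1 / t * ln t powr q) / (inverse (t + 1) * ln (t + 2) powr q)" for t :: real
  define B where "B t = 1 - q\<^sup>2 * (ln (ln t) / ln t) + \<delta> t" for t
  define Z where "Z t = 1 - q\<^sup>2 * (ln (ln (t + 2)) / ln (t + 2))" for t :: real
  have A: "(\<lambda>t. A t - 1) \<in> O(\<lambda>t. 1 / ln (t + 2))" unfolding A_def by (rule weight_shift(1)[OF q])
  have "((\<lambda>t::real. inverse (ln t)) \<longlongrightarrow> 0) at_top" by real_asymp
  note \<delta>lim = tendsto_zero_if_bigo[OF \<delta> this]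
  have "((\<lambda>t::real. ln (ln t) / ln t) \<longlongrightarrow> 0) at_top" by real_asymp
  then have "(B \<longlongrightarrow> 1 - q\<^sup>2 * 0 + 0) at_top" unfolding B_def by (intro tendsto_intros \<delta>lim)
  then have "B \<in> O[at_top](\<lambda>_. 1)" by (intro bigoI_tendsto[where c = "1 - q\<^sup>2 * 0 + 0"]) auto
  from landau_o.big.mult[OF A this] have AB: "(\<lambda>t. (A t - 1) * B t) \<in> O(\<lambda>t. 1 / ln (t + 2))" by simp
  have "(\<lambda>t::real. inverse (ln t)) \<in> O(\<lambda>t. 1 / ln (t + 2))" by real_asymp
  note \<delta>' = landau_o.big_trans[OF \<delta> this]
  have "(\<lambda>t. q\<^sup>2 * (ln (ln t) / ln t - ln (ln (t + 2)) / ln (t + 2))) \<in> O(\<lambda>t. 1 / ln (t + 2))"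
    using weight_shift(2)[OF q] q by simp
  from sum_in_bigo(2)[OF \<delta>' this] have BZ: "(\<lambda>t. B t - Z t) \<in> O(\<lambda>t. 1 / ln (t + 2))"
    by (rule landau_o.big.in_cong[THEN iffD1, rotated])
      (auto intro!: always_eventually simp: B_def Z_def algebra_simps)
  have "(\<lambda>t. (A t - 1) * B t + (B t - Z t)) \<in> O(\<lambda>t. 1 / ln (t + 2))" by (rule sum_in_bigo(1)[OF AB BZ])
  moreover have "\<forall>\<^sub>F t in at_top. (A t - 1) * B t + (B t - Z t) = g\<^sub>1 t / (inverse (t + 1) * ln (t + 2) powr q) - Z t"
    using g1
  proof eventually_elim
    case (elim t)
    have "g\<^sub>1 t / (inverse (t + 1) * ln (t + 2) powr q) = A t * B t" by (simp add: elim A_def B_def)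
    then show ?case by (simp add: algebra_simps)
  qed
  ultimately have "(\<lambda>t. g\<^sub>1 t / (inverse (t + 1) * ln (t + 2) powr q) - Z t) \<in> O(\<lambda>t. 1 / ln (t + 2))"
    by (rule landau_o.big.in_cong[THEN iffD1, rotated])
  from landau_o.big.compose[OF this filterlim_real_sequentially] show ?thesis unfolding Z_def .
qed

section \<open>Traces of the negative power\<close>

text \<open>
  Let \<open>S\<close>, \<open>X\<close> be the partial sums of \<open>g\<close> and of \<open>\<kappa> g - a\<close>, and \<open>T\<close> those of the increments of
  \<open>(log(n + 2))\<^sup>q\<close>.  Comparing terms, \<open>S\<close> dominates every multiple of \<open>X\<close>, and \<open>X\<close> every multiple of \<open>T\<close>,
  while \<open>n g(n) = O(T)\<close>.  So a combination of \<open>S\<close> and \<open>X\<close> that is \<open>O(n g(n))\<close> is trivial.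
\<close>

lemma log_sums_independent:
  fixes q \<kappa> :: real and a :: "nat \<Rightarrow> real"
  defines "g \<equiv> \<lambda>j::nat. inverse (real j + 1) * ln (real j + 2) powr q"
    and "y \<equiv> \<lambda>j::nat. ln (real j + 2)"
  assumes q: "q > 0" and \<kappa>: "\<kappa> > 0"
    and a: "(\<lambda>j. a j / (\<kappa> * g j) - (1 - q\<^sup>2 * (ln (y j) / y j))) \<in> O(\<lambda>j. 1 / y j)"
    and le: "\<And>n. cmod (b * complex_of_real (\<Sum>j<n. g j) + c * (\<Sum>j<n. complex_of_real (a j))) \<le> K * (real n * g n)"
  shows "b = 0 \<and> c = 0"
proof -
  have y0: "y j > 0" for j by (simp add: y_def)
  have g0: "g j > 0" for j by (simp add: g_def)
  have yinf: "filterlim y at_top sequentially" unfolding y_def by real_asymp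
  define x where "x j = \<kappa> * g j - a j" for j
  define t where "t j = ln (real j + 3) powr q - ln (real j + 2) powr q" for j :: nat
  define T where "T n = (\<Sum>j<n. t j)" for n
  define X where "X n = (\<Sum>j<n. x j)" for n
  define S where "S n = (\<Sum>j<n. g j)" for n
  have t0: "t j > 0" for j unfolding t_def by (rule weight_increment_pos[OF q])
  have T_eq: "T n = ln (real n + 2) powr q - ln 2 powr q" for n
  proof (induction n)
    case (Suc n)
    then show ?case by (simp add: T_def t_def add.commute)
  qed (simp add: T_def)
  have Tinf: "filterlim T at_top sequentially" unfolding T_eq[abs_def] using q by real_asymp
  obtain L where L: "L > 0" "\<forall>\<^sub>F j in sequentially.
      norm (a j / (\<kappa> * g j) - (1 - q\<^sup>2 * (ln (y j) / y j))) \<le> L * norm (1 / y j)"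
    using landau_o.bigE[OF a] by auto
  have lny: "filterlim (\<lambda>j. ln (y j)) at_top sequentially" by (rule filterlim_compose[OF ln_at_top yinf])
  have xlow: "\<forall>\<^sub>F j in sequentially. x j \<ge> \<kappa> * q\<^sup>2 / 2 * (g j * (ln (y j) / y j))"
  proof -
    have "\<forall>\<^sub>F j in sequentially. ln (y j) \<ge> 2 * L / q\<^sup>2" using lny unfolding filterlim_at_top by blast
    with L(2) show ?thesis
    proof eventually_elim
      case (elim j)
      have "a j / (\<kappa> * g j) \<le> 1 - q\<^sup>2 * (ln (y j) / y j) + L / y j" using elim(1) y0[of j] by simp
      moreover have "L / y j \<le> q\<^sup>2 / 2 * (ln (y j) / y j)"
      proof -
        have "L \<le> q\<^sup>2 / 2 * ln (y j)" using elim(2) q by (simp add: field_simps)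
        then show ?thesis using y0[of j] by (simp add: field_simps)
      qed
      moreover have "1 - q\<^sup>2 * z + q\<^sup>2 / 2 * z = 1 - q\<^sup>2 / 2 * z" for z by (simp add: field_simps)
      ultimately have "a j / (\<kappa> * g j) \<le> 1 - q\<^sup>2 / 2 * (ln (y j) / y j)"
        by (metis (no_types, lifting) add_left_mono order_trans)
      then have "a j \<le> (1 - q\<^sup>2 / 2 * (ln (y j) / y j)) * (\<kappa> * g j)"
        using \<kappa> g0[of j] by (simp add: pos_divide_le_eq)
      then show ?case by (simp add: x_def algebra_simps)
    qed
  qed
  have xt: "\<forall>\<^sub>F j in sequentially. x j \<ge> M * t j" for M
  proof -
    have "\<forall>\<^sub>F j in sequentially. M \<le> \<kappa> * q\<^sup>2 / 2 * (g j * (ln (y j) / y j)) / t j"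
      using weight_increment[OF q, of "\<kappa> * q\<^sup>2 / 2"] \<kappa> q unfolding filterlim_at_top g_def y_def t_def by simp
    with xlow show ?thesis
    proof eventually_elim
      case (elim j)
      have "M * t j \<le> \<kappa> * q\<^sup>2 / 2 * (g j * (ln (y j) / y j))"
        using elim(2) unfolding pos_le_divide_eq[OF t0] .
      with elim(1) show ?case by linarith
    qed
  qed
  have XT: "\<forall>\<^sub>F n in sequentially. X n \<ge> M * T n" for M
    using stolz_dominate[OF xt] Tinf unfolding X_def T_def by blast
  have Xinf: "filterlim X at_top sequentially"
    using XT[of 1] by (intro filterlim_at_top_mono[OF Tinf]) simp
  have xg: "\<forall>\<^sub>F j in sequentially. g j \<ge> M * x j" for M
  proof -
    have "((\<lambda>v::real. 1 / v) \<longlongrightarrow> 0) at_top" "((\<lambda>v::real. ln v / v) \<longlongrightarrow> 0) at_top" by real_asymp+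
    from this[THEN filterlim_compose, OF yinf]
    have l1: "(\<lambda>j. 1 / y j) \<longlonglongrightarrow> 0" and l2: "(\<lambda>j. ln (y j) / y j) \<longlonglongrightarrow> 0" .
    have "(\<lambda>j. q\<^sup>2 * (ln (y j) / y j) - (a j / (\<kappa> * g j) - (1 - q\<^sup>2 * (ln (y j) / y j)))) \<longlonglongrightarrow> q\<^sup>2 * 0 - 0"
      by (intro tendsto_diff tendsto_mult tendsto_const l2 tendsto_zero_if_bigo[OF a l1])
    then have "(\<lambda>j. 1 - a j / (\<kappa> * g j)) \<longlonglongrightarrow> 0" by simp
    then have "(\<lambda>j. M * (\<kappa> * (1 - a j / (\<kappa> * g j)))) \<longlonglongrightarrow> M * (\<kappa> * 0)" by (intro tendsto_intros)
    then have "\<forall>\<^sub>F j in sequentially. M * (\<kappa> * (1 - a j / (\<kappa> * g j))) < 1" by (intro order_tendstoD(2)) auto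
    then show ?thesis
    proof eventually_elim
      case (elim j)
      have "M * x j = M * (\<kappa> * (1 - a j / (\<kappa> * g j))) * g j"
        using \<kappa> g0[of j] by (simp add: x_def field_simps)
      also have "\<dots> \<le> 1 * g j" using elim g0[of j] by (intro mult_right_mono) auto
      finally show ?case by simp
    qed
  qed
  have SX: "\<forall>\<^sub>F n in sequentially. S n \<ge> M * X n" for M
    using stolz_dominate[OF xg] Xinf unfolding X_def S_def by blast
  have w: "\<forall>\<^sub>F n in sequentially. \<bar>K\<bar> * (real n * g n) \<le> 2 * \<bar>K\<bar> * T n"
  proof -
    have "\<forall>\<^sub>F n in sequentially. T n \<ge> ln 2 powr q" using Tinf unfolding filterlim_at_top by blast
    then show ?thesis
    proof eventually_elim
      case (elim n)
      have "real n * inverse (real n + 1) \<le> 1" by (simp add: field_simps)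
      then have "real n * inverse (real n + 1) * ln (real n + 2) powr q \<le> 1 * ln (real n + 2) powr q"
        by (rule mult_right_mono) simp
      then have "real n * g n \<le> ln (real n + 2) powr q" by (simp only: g_def mult.assoc mult_1_left)
      then have "real n * g n \<le> 2 * T n" using elim T_eq[of n] by linarith
      then have "\<bar>K\<bar> * (real n * g n) \<le> \<bar>K\<bar> * (2 * T n)" by (rule mult_left_mono) simp
      then show ?case by simp
    qed
  qed
  define B where "B = b + c * complex_of_real \<kappa>"
  have eq: "b * complex_of_real (\<Sum>j<n. g j) + c * (\<Sum>j<n. complex_of_real (a j)) =
      B * complex_of_real (S n) - c * complex_of_real (X n)" for n
  proof -
    have "X n = \<kappa> * S n - (\<Sum>j<n. a j)" by (simp add: X_def S_def x_def sum_subtractf sum_distrib_left)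
    then have s: "(\<Sum>j<n. complex_of_real (a j)) = complex_of_real (\<kappa> * S n - X n)"
      by (simp flip: of_real_sum)
    show ?thesis unfolding s B_def S_def[symmetric] by (simp add: algebra_simps)
  qed
  have main: "\<forall>\<^sub>F n in sequentially. cmod (B * complex_of_real (S n) - c * complex_of_real (X n)) \<le> 2 * \<bar>K\<bar> * T n"
    using w
  proof eventually_elim
    case (elim n)
    have "K * (real n * g n) \<le> \<bar>K\<bar> * (real n * g n)" using g0[of n] by (intro mult_right_mono) auto
    with elim le[of n] show ?case unfolding eq by linarith
  qed
  have pos: "\<forall>\<^sub>F n in sequentially. T n > 0 \<and> X n > 0"
    using filterlim_at_top_dense[THEN iffD1, OF Tinf, rule_format, of 0]
      filterlim_at_top_dense[THEN iffD1, OF Xinf, rule_format, of 0] by eventually_elim simp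
  have B0: "B = 0"
  proof (rule ccontr)
    assume B: "B \<noteq> 0"
    define M where "M = (cmod c + 2 * \<bar>K\<bar> + 1) / cmod B"
    have "\<forall>\<^sub>F n::nat in sequentially. False"
      using main pos SX[of M] XT[of 1]
    proof eventually_elim
      case (elim n)
      have S0: "S n \<ge> 0" using g0 unfolding S_def by (intro sum_nonneg) (simp add: less_imp_le)
      have "cmod (B * complex_of_real (S n)) \<le>
          cmod (B * complex_of_real (S n) - c * complex_of_real (X n)) + cmod (c * complex_of_real (X n))"
        using norm_triangle_ineq[of "B * complex_of_real (S n) - c * complex_of_real (X n)" "c * complex_of_real (X n)"]
        by simp
      then have "cmod B * S n \<le> 2 * \<bar>K\<bar> * T n + cmod c * X n"
        using elim S0 by (simp add: norm_mult)
      also have "\<dots> \<le> 2 * \<bar>K\<bar> * X n + cmod c * X n" using elim by (intro add_right_mono mult_left_mono) auto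
      also have "\<dots> < (cmod c + 2 * \<bar>K\<bar> + 1) * X n" using elim by (simp add: algebra_simps)
      also have "\<dots> = cmod B * (M * X n)" using B by (simp add: M_def)
      also have "\<dots> \<le> cmod B * S n" using elim by (intro mult_left_mono) auto
      finally show ?case by simp
    qed
    then show False by simp
  qed
  have "c = 0"
  proof (rule ccontr)
    assume c: "c \<noteq> 0"
    have "\<forall>\<^sub>F n::nat in sequentially. False"
      using main pos XT[of "(2 * \<bar>K\<bar> + 1) / cmod c"]
    proof eventually_elim
      case (elim n)
      have "cmod c * X n \<le> 2 * \<bar>K\<bar> * T n" using elim B0 by (simp add: norm_mult)
      also have "\<dots> < (2 * \<bar>K\<bar> + 1) * T n" using elim by (simp add: algebra_simps)
      also have "\<dots> = cmod c * ((2 * \<bar>K\<bar> + 1) / cmod c * T n)" using c by simp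
      also have "\<dots> \<le> cmod c * X n" using elim by (intro mult_left_mono) auto
      finally show ?case by simp
    qed
    then show False by simp
  qed
  with B0 show ?thesis by (simp add: B_def)
qed

lemma lorentz_function_log:
  assumes q: "q \<ge> 0"
  obtains C where "lorentz_function (\<lambda>t. inverse (t + 1) * ln (t + 2) powr q) C"
proof -
  obtain C where C: "\<And>i j::nat. j \<le> i \<Longrightarrow>
     inverse (real i + 1) * ln (real i + 2) powr q \<le> C * (inverse (real j + 1) * ln (real j + 2) powr q)"
    using weight_quasi_decreasing[OF q] by blast
  have pos: "inverse (real j + 1) * ln (real j + 2) powr q > 0" for j :: nat by simp
  have up: "z * (inverse (real j + 1) * ln (real j + 2) powr q) \<le>
      max C 2 * (inverse (real j + 1) * ln (real j + 2) powr q)" if "z \<le> max C 2" for z and j :: nat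
    using that pos[of j] by (intro mult_right_mono) auto
  have "lorentz_function (\<lambda>t. inverse (t + 1) * ln (t + 2) powr q) (max C 2)"
  proof (unfold_locales, goal_cases)
    case (1 j)
    show ?case by (rule pos)
  next
    case 2
    show ?case by (rule weight_tendsto[OF q])
  next
    case (3 j i)
    show ?case using order.trans[OF C[OF 3] up[of C]] by simp
  next
    case (4 j)
    show ?case using order.trans[OF weight_halving[OF q] up[of 2]] by simp
  qed
  then show ?thesis by (rule that)
qed

lemma lorentz_function_inverse: obtains C where "lorentz_function (\<lambda>t. inverse (t + 1)) C"
proof -
  obtain C where "lorentz_function (\<lambda>t. inverse (t + 1) * ln (t + 2) powr 0) C"
    using lorentz_function_log[of 0] by auto
  then have "lorentz_function (\<lambda>t. inverse (t + 1)) C" by (simp add: lorentz_function_def)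
  then show ?thesis by (rule that)
qed

text \<open>
  Every \<open>g\<^sub>1\<close>-normalized trace has the value \<open>\<kappa>\<close>: it is \<open>1\<close> on the diagonal operator with entries \<open>g\<^sub>1(j)\<close>
  along a basis, hence also along \<open>u\<close>, and the potential \<open>h\<close> makes the deviation \<open>d\<close> of the entries from \<open>\<kappa> g\<^sub>1(j)\<close>
  have trace zero.
\<close>

lemma (in lorentz_function) hypermeasurable_diag_op:
  fixes u :: "nat \<Rightarrow> 'a::complex_hilbert" and a :: "nat \<Rightarrow> real" and \<kappa> :: real and g\<^sub>1 :: "real \<Rightarrow> real"
  defines "d \<equiv> \<lambda>j. a j - \<kappa> * g\<^sub>1 (real j)"
  assumes sep: "separable_UNIV TYPE('a)" and u: "orthonormal_on UNIV u"
    and WL: "weak_lorentz g\<^sub>1 = (weak_lorentz g :: ('a \<Rightarrow> 'a) set)"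
    and g1: "\<And>j. \<bar>g\<^sub>1 (real j)\<bar> \<le> L * g (real j)" and a: "\<And>j. \<bar>a j\<bar> \<le> M * g (real j)"
    and h: "h 0 \<ge> 0" "\<And>j. j \<ge> 1 \<Longrightarrow> real (j + 1) * \<bar>d j\<bar> \<le> h j - h (j div 2)"
    and hg: "\<And>j. h j + 2 * \<bar>d 0\<bar> \<le> K * (real (j + 1) * g (real j))"
  shows "hypermeasurable g\<^sub>1 (diag_op (\<lambda>j. complex_of_real (a j)) u u)"
  unfolding hypermeasurable_def
proof (intro conjI allI impI)
  have a': "cmod (complex_of_real (a j)) \<le> M * g (real j)" for j using a[of j] by simp
  have g1': "cmod (complex_of_real (g\<^sub>1 (real j))) \<le> L * g (real j)" for j using g1[of j] by simp
  show "diag_op (\<lambda>j. complex_of_real (a j)) u u \<in> weak_lorentz g\<^sub>1"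
    unfolding WL by (rule diag_op_in_weak_lorentz[OF u u a'])
  obtain \<xi> :: "nat \<Rightarrow> 'a" where \<xi>: "orthonormal_basis \<xi>" using orthonormal_basis_exists[OF sep u] by blast
  note o\<xi> = orthonormal_basis_orthonormal[OF \<xi>]
  have val: "\<phi> (diag_op (\<lambda>j. complex_of_real (a j)) u u) = complex_of_real \<kappa>"
    if n: "normalized_trace g\<^sub>1 \<phi>" for \<phi> :: "('a \<Rightarrow> 'a) \<Rightarrow> complex"
  proof -
    have \<phi>: "trace_on g \<phi>" using n unfolding normalized_trace_def trace_on_def WL by (rule conjunct1)
    let ?G = "\<lambda>j. complex_of_real (g\<^sub>1 (real j))"
    note gb = coeff_bounded(1)[where a = ?G, OF g1']
    have "bounded_clinear (diag_op ?G \<xi> \<xi>)"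
      by (rule bounded_clinear_diag_op[where a = ?G, OF o\<xi> o\<xi> gb])
    moreover have "diag_op ?G \<xi> \<xi> (\<xi> j) = g\<^sub>1 (real j) *\<^sub>R \<xi> j" for j
      unfolding diag_op_basis[where a = ?G, OF o\<xi> o\<xi> gb] by (rule scaleC_of_real)
    ultimately have one: "\<phi> (diag_op ?G \<xi> \<xi>) = 1" using n \<xi> unfolding normalized_trace_def by blast
    have "\<phi> (diag_op ?G u u) = \<phi> (diag_op ?G \<xi> \<xi>)"
      by (rule trace_diag_op_transport[OF \<phi> u o\<xi>]) (rule g1')
    then have Gu: "\<phi> (diag_op (\<lambda>j. complex_of_real \<kappa> * ?G j) u u) = complex_of_real \<kappa>"
      using trace_diag_op_scale[where a = ?G, OF \<phi> u g1', of "complex_of_real \<kappa>"] one by simp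
    have zero: "\<phi> (diag_op (\<lambda>j. complex_of_real (d j)) u u) = 0"
      by (rule trace_diag_op_zero[where h = h and K = K, OF \<phi> u h(1)]) (use h(2) hg in simp_all)
    have dK: "cmod (complex_of_real (d j)) \<le> (M + \<bar>\<kappa>\<bar> * L) * g (real j)" for j
    proof -
      have "\<bar>d j\<bar> \<le> \<bar>a j\<bar> + \<bar>\<kappa>\<bar> * \<bar>g\<^sub>1 (real j)\<bar>"
        using abs_triangle_ineq4[of "a j" "\<kappa> * g\<^sub>1 (real j)"] by (simp add: d_def abs_mult)
      also have "\<dots> \<le> M * g (real j) + \<bar>\<kappa>\<bar> * (L * g (real j))"
        by (intro add_mono a mult_left_mono g1) auto
      finally show ?thesis by (simp add: distrib_right mult.assoc)
    qed
    have GK: "cmod (complex_of_real \<kappa> * ?G j) \<le> (\<bar>\<kappa>\<bar> * L) * g (real j)" for j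
      using mult_left_mono[OF g1[of j], of "\<bar>\<kappa>\<bar>"] by (simp add: norm_mult mult.assoc)
    have "(\<lambda>j. complex_of_real (a j)) = (\<lambda>j. complex_of_real \<kappa> * ?G j + complex_of_real (d j))"
      by (simp add: d_def)
    then show ?thesis
      using trace_diag_op_add[where a = "\<lambda>j. complex_of_real \<kappa> * ?G j" and b = "\<lambda>j. complex_of_real (d j)", OF \<phi> u GK dK]
        Gu zero by simp
  qed
  show "\<phi> (diag_op (\<lambda>j. complex_of_real (a j)) u u) = \<psi> (diag_op (\<lambda>j. complex_of_real (a j)) u u)"
    if "normalized_trace g\<^sub>1 \<phi> \<and> normalized_trace g\<^sub>1 \<psi>" for \<phi> \<psi>
    using val[of \<phi>] val[of \<psi>] that by simp
qed

lemma discrete_finite_selfadjointI: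
  fixes D :: "'a::complex_hilbert set"
  assumes "selfadjoint_operator D A" "spectrum D A \<subseteq> \<real>\<^sub>\<ge>\<^sub>0"
    and iso0: "0 isolated_in (insert 0 (spectrum D A))"
    and iso: "\<forall>z \<in> spectrum D A - {0}. z isolated_in (spectrum D A) \<and> eigenvalue_finite_mult D A z"
  shows "discrete_finite_selfadjoint D A"
proof -
  interpret selfadjoint D A by unfold_locales (fact assms(1))
  show ?thesis
  proof (unfold_locales, goal_cases)
    case 1
    show ?case by (fact assms(2))
  next
    case (2 t)
    have dist: "dist (complex_of_real t) (complex_of_real s) = \<bar>s - t\<bar>" for s
      by (simp add: dist_norm norm_minus_commute flip: of_real_diff)
    have "\<exists>\<delta>>0. \<forall>y\<in>spectrum D A. dist (complex_of_real t) y < \<delta> \<longrightarrow> y = complex_of_real t"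
    proof (cases "t = 0")
      case True
      then show ?thesis using iso0 unfolding isolated_in_dist_Ex_iff by auto
    next
      case False
      then have "complex_of_real t \<in> spectrum D A - {0}" using 2 by simp
      then have "complex_of_real t isolated_in spectrum D A" using iso by blast
      then show ?thesis unfolding isolated_in_dist_Ex_iff by (rule conjunct2)
    qed
    then obtain \<delta> where \<delta>: "\<delta> > 0" "\<And>y. y \<in> spectrum D A \<Longrightarrow> dist (complex_of_real t) y < \<delta> \<Longrightarrow> y = complex_of_real t"
      by blast
    show ?case
    proof (intro exI[of _ \<delta>] conjI allI impI notI)
      fix s assume s: "0 < \<bar>s - t\<bar> \<and> \<bar>s - t\<bar> < \<delta>" and "complex_of_real s \<in> spectrum D A"
      then have "complex_of_real s = complex_of_real t" using \<delta>(2)[of "complex_of_real s"] dist by simp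
      then show False using s by simp
    qed (rule \<delta>(1))
  next
    case (3 t)
    show ?case
    proof (cases "complex_of_real t \<in> spectrum D A")
      case True
      then have "eigenvalue_finite_mult D A (complex_of_real t)" using iso 3 by auto
      then show ?thesis unfolding eigenvalue_finite_mult_def by blast
    next
      case False
      then have "eigenspace D A (complex_of_real t) \<subseteq> {0}" using eigenvalue_in_spectrum by blast
      moreover have "0 \<in> eigenspace D A (complex_of_real t)"
        using csubspace_eigenspace complex_vector.subspace_0 by blast
      ultimately show ?thesis by (intro exI[of _ "{}"]) auto
    qed
  qed
qed

theorem lemma7:
  fixes D :: "'a::complex_hilbert set" and A :: "'a \<Rightarrow> 'a"
    and c p q \<alpha> :: real and \<epsilon> :: "real \<Rightarrow> real"
  assumes "separable_UNIV TYPE('a)"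
    and "selfadjoint_operator D A"
    and "spectrum D A \<subseteq> \<real>\<^sub>\<ge>\<^sub>0"
    and "0 isolated_in (insert 0 (spectrum D A))"
    and "\<forall>z \<in> spectrum D A - {0}.
           z isolated_in (spectrum D A) \<and> eigenvalue_finite_mult D A z"
    and "c > 0" and "p > 0" and "q \<ge> 0" and "\<alpha> \<ge> 1"
    and "\<epsilon> \<in> O(\<lambda>x. ln x powr (- \<alpha>))"
    and "\<forall>\<^sub>F x in at_top. real (counting_function D A x) =
           c * x powr p * ln x powr q * (1 + \<epsilon> x)"
  shows
    "(q = 0 \<and> \<alpha> > 1 \<longrightarrow>
        hypermeasurable (\<lambda>t. inverse (t + 1)) (neg_power D A p)) \<and>
     (q > 0 \<and> \<alpha> = 1 \<longrightarrow>
        neg_power D A p \<in> weak_lorentz (\<lambda>t. inverse (t + 1) * ln (t + 2) powr q) \<and>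
        \<not> hypermeasurable (\<lambda>t. inverse (t + 1) * ln (t + 2) powr q) (neg_power D A p) \<and>
        (\<forall>g\<^sub>1 \<delta>. RV_minus_one g\<^sub>1 \<and> \<delta> \<in> O(\<lambda>t. inverse (ln t)) \<and>
           (\<forall>\<^sub>F t in at_top. g\<^sub>1 t =
              1 / t * ln t powr q * (1 - q\<^sup>2 * (ln (ln t) / ln t) + \<delta> t)) \<longrightarrow>
           hypermeasurable g\<^sub>1 (neg_power D A p)))"
proof -
  have \<alpha>0: "\<alpha> > 0" using assms(9) by simp
  interpret discrete_finite_selfadjoint D A
    by (rule discrete_finite_selfadjointI[OF assms(2-5)])
  obtain m where m: "enumerates m (\<lambda>s. cdim (E s))"
    and pe: "\<And>j. pos_eigenvalue D A j = (if m j = 0 then \<infinity> else ereal (1 / m j))"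
    using pos_eigenvalue_enumeration by blast
  have m_nonneg: "m j \<ge> 0" for j using m by (simp add: enumerates_def)
  have m_dec: "m j \<le> m i" if "i \<le> j" for i j using m that by (simp add: enumerates_def decseq_def)
  have count: "counting_function D A x = card {j. m j \<noteq> 0 \<and> 1 / m j < x}" for x
    unfolding counting_function_def pe by (rule arg_cong[of _ _ card]) auto
  \<comment> \<open>with finitely many positive eigenvalues the counting function would be bounded\<close>
  have m_pos: "m j > 0" for j
  proof (rule ccontr)
    assume "\<not> m j > 0"
    then have "m j = 0" using m_nonneg[of j] by simp
    then have "m i = 0" if "i \<ge> j" for i using m_dec[OF that] m_nonneg[of i] by simp
    then have "{i. m i \<noteq> 0 \<and> 1 / m i < x} \<subseteq> {..<j}" for x by (auto simp: not_le[symmetric])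
    then have "card {i. m i \<noteq> 0 \<and> 1 / m i < x} \<le> j" for x using card_mono[of "{..<j}"] by fastforce
    then have "real (counting_function D A x) \<le> real j" for x unfolding count by simp
    moreover have "\<forall>\<^sub>F x in at_top. c * x powr p * ln x powr q * (1 + \<epsilon> x) > real j"
      using filterlim_at_top_dense[THEN iffD1, OF weyl_function_at_top[OF assms(6-8) \<alpha>0 assms(10)]] by blast
    with assms(11) have "\<forall>\<^sub>F x in at_top. real (counting_function D A x) > real j"
      by eventually_elim simp
    ultimately have "\<forall>\<^sub>F x::real in at_top. False" by (simp add: not_less[symmetric])
    then show False by simp
  qed
  define l where "l j = 1 / m j" for j
  have l: "mono l" "\<And>j. l j > 0" using m_pos m_dec by (auto simp: l_def mono_def frac_le)
  have N: "\<forall>\<^sub>F x in at_top. real (card {j. l j < x}) = c * x powr p * ln x powr q * (1 + \<epsilon> x)"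
    using assms(11) unfolding count l_def using m_pos by (simp add: less_imp_neq[symmetric])
  note linf = counting_inversion(1)[OF l assms(6-8) \<alpha>0 assms(10) N]
  obtain K where K: "\<forall>\<^sub>F j in sequentially.
      \<bar>real (j + 1) / (c * l j powr p * ln (l j) powr q) - 1\<bar> \<le> K * ln (l j) powr (- \<alpha>)"
    using counting_inversion(2)[OF l assms(6-8) \<alpha>0 assms(10) N] by blast
  define a where "a j = l j powr (- p)" for j
  obtain e where e: "orthonormal_on UNIV e"
    and np0: "neg_power D A p = diag_op (\<lambda>j. complex_of_real (m j powr p)) e e"
    using neg_power_diag_op[OF m m_pos assms(7)] by blast
  have "m j powr p = a j" for j using m_pos[of j] by (simp add: a_def l_def powr_minus powr_divide)
  then have np: "neg_power D A p = diag_op (\<lambda>j. complex_of_real (a j)) e e" using np0 by simp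
  have part1: "hypermeasurable (\<lambda>t. inverse (t + 1)) (neg_power D A p)" if q: "q = 0" and \<alpha>: "\<alpha> > 1"
  proof -
    obtain C where "lorentz_function (\<lambda>t. inverse (t + 1)) C" by (rule lorentz_function_inverse)
    then interpret lorentz_function "\<lambda>t. inverse (t + 1)" C .
    \<comment> \<open>the deviation from \<open>c/(j + 1)\<close> is \<open>O((log(j + 2))\<^sup>-\<^sup>\<alpha>/(j + 1))\<close>, which has a bounded potential as \<open>\<alpha> > 1\<close>\<close>
    define s where "s = \<alpha> - 1"
    have s: "s > 0" "- s - 1 = - \<alpha>" using \<alpha> by (auto simp: s_def)
    define d where "d j = a j - c * inverse (real j + 1)" for j
    have d_eq: "real (j + 1) * d j = l j powr (- p) * real (j + 1) - c" for j
      by (simp add: d_def a_def field_simps)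
    have pp: "ln (real j + 2) powr (- \<alpha>) > 0" for j :: nat by simp
    obtain M where M0: "M > 0" "\<And>j. \<bar>l j powr (- p) * real (j + 1) - c\<bar> \<le> M * ln (real j + 2) powr (- \<alpha>)"
      by (rule eventually_le_imp_all_le[OF eigenvalue_power_asymptotics_pure[OF linf assms(6-8) \<alpha>0 K q] pp]) (rule that)
    note M = M0[folded d_eq]
    obtain k where k: "k > 0" "\<And>j. j \<ge> 1 \<Longrightarrow>
        k * ln (real j + 2) powr (- s - 1) \<le> ln (real (j div 2) + 2) powr (- s) - ln (real j + 2) powr (- s)"
      using potential_negative[OF s(1)] by blast
    define h where "h j = M / k * (ln 2 powr (- s) - ln (real j + 2) powr (- s))" for j :: nat
    have ab: "\<bar>a j\<bar> \<le> (M * ln 2 powr (- \<alpha>) + c) * inverse (real j + 1)" for j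
    proof -
      have "ln (real j + 2) powr (- \<alpha>) \<le> ln 2 powr (- \<alpha>)" using \<alpha>0 by (intro powr_mono2') auto
      then have "M * ln (real j + 2) powr (- \<alpha>) \<le> M * ln 2 powr (- \<alpha>)" using M(1) by simp
      then have "\<bar>real (j + 1) * d j\<bar> \<le> M * ln 2 powr (- \<alpha>)" using M(2)[of j] by linarith
      then have "real (j + 1) * a j \<le> M * ln 2 powr (- \<alpha>) + c" unfolding d_eq by (simp add: a_def mult.commute)
      then show ?thesis by (simp add: a_def field_simps)
    qed
    show ?thesis unfolding np
    proof (rule hypermeasurable_diag_op[where L = 1 and M = "M * ln 2 powr (- \<alpha>) + c" and \<kappa> = c and h = h
          and K = "M / k * ln 2 powr (- s) + 2 * \<bar>d 0\<bar>"])
      show "separable_UNIV TYPE('a)" by (fact assms(1))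
      show "orthonormal_on UNIV e" by (fact e)
      show "\<bar>a j\<bar> \<le> (M * ln 2 powr (- \<alpha>) + c) * inverse (real j + 1)" for j by (rule ab)
      show "0 \<le> h 0" by (simp add: h_def)
      show "real (j + 1) * \<bar>a j - c * inverse (real j + 1)\<bar> \<le> h j - h (j div 2)" if j: "j \<ge> 1" for j
      proof -
        have "real (j + 1) * \<bar>d j\<bar> \<le> M * ln (real j + 2) powr (- \<alpha>)" using M(2)[of j] by (simp add: abs_mult)
        also have "\<dots> = M / k * (k * ln (real j + 2) powr (- s - 1))" using k(1) s(2) by simp
        also have "\<dots> \<le> M / k * (ln (real (j div 2) + 2) powr (- s) - ln (real j + 2) powr (- s))"
          using k(2)[OF j] k(1) M(1) by (intro mult_left_mono) auto
        also have "\<dots> = h j - h (j div 2)" by (simp add: h_def algebra_simps)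
        finally show ?thesis by (simp add: d_def)
      qed
      show "h j + 2 * \<bar>a 0 - c * inverse (real 0 + 1)\<bar> \<le>
          (M / k * ln 2 powr (- s) + 2 * \<bar>d 0\<bar>) * (real (j + 1) * inverse (real j + 1))" for j
      proof -
        have "h j \<le> M / k * (ln 2 powr (- s))" unfolding h_def using M(1) k(1) by (intro mult_left_mono) auto
        moreover have "real (j + 1) * inverse (real j + 1) = 1" by (simp add: field_simps)
        ultimately show ?thesis by (simp add: d_def)
      qed
    qed simp_all
  qed
  have part2: "neg_power D A p \<in> weak_lorentz (\<lambda>t. inverse (t + 1) * ln (t + 2) powr q) \<and>
        \<not> hypermeasurable (\<lambda>t. inverse (t + 1) * ln (t + 2) powr q) (neg_power D A p) \<and>
        (\<forall>g\<^sub>1 \<delta>. RV_minus_one g\<^sub>1 \<and> \<delta> \<in> O(\<lambda>t. inverse (ln t)) \<and>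
           (\<forall>\<^sub>F t in at_top. g\<^sub>1 t =
              1 / t * ln t powr q * (1 - q\<^sup>2 * (ln (ln t) / ln t) + \<delta> t)) \<longrightarrow>
           hypermeasurable g\<^sub>1 (neg_power D A p))" if q: "q > 0" and \<alpha>: "\<alpha> = 1"
  proof -
    let ?g = "\<lambda>t::real. inverse (t + 1) * ln (t + 2) powr q"
    let ?y = "\<lambda>j::nat. ln (real j + 2)"
    obtain C where "lorentz_function ?g C" using lorentz_function_log[OF assms(8)] by blast
    then interpret lorentz_function ?g C .
    define \<kappa> where "\<kappa> = c * p powr (- q)"
    have \<kappa>: "\<kappa> > 0" using assms(6,7) by (simp add: \<kappa>_def)
    have y0: "?y j > 0" for j by simp
    have as: "(\<lambda>j. a j / (\<kappa> * ?g (real j)) - (1 - q\<^sup>2 * (ln (?y j) / ?y j))) \<in> O(\<lambda>j. 1 / ?y j)"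
      using eigenvalue_power_asymptotics_log[OF linf assms(6-8) \<alpha>0 K q \<alpha>] unfolding a_def \<kappa>_def .
    have l1: "(\<lambda>j. 1 / ?y j) \<longlonglongrightarrow> 0" by real_asymp
    have lz: "(\<lambda>j. 1 - q\<^sup>2 * (ln (?y j) / ?y j)) \<longlonglongrightarrow> 1" by real_asymp
    have ratio_bound: "\<exists>M>0. \<forall>j. \<bar>b j\<bar> \<le> M * ?g (real j)"
      if b: "(\<lambda>j. b j / ?g (real j)) \<longlonglongrightarrow> v" for b :: "nat \<Rightarrow> real" and v
    proof -
      have "b \<in> O(\<lambda>j. ?g (real j))"
        using g_pos by (intro bigoI_tendsto[OF b] always_eventually allI) (simp add: less_imp_neq[symmetric])
      from eventually_le_imp_all_le[OF this g_pos] show ?thesis by metis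
    qed
    have alim: "(\<lambda>j. a j / ?g (real j)) \<longlonglongrightarrow> \<kappa>"
    proof -
      have "(\<lambda>j. \<kappa> * ((a j / (\<kappa> * ?g (real j)) - (1 - q\<^sup>2 * (ln (?y j) / ?y j))) + (1 - q\<^sup>2 * (ln (?y j) / ?y j))))
          \<longlonglongrightarrow> \<kappa> * (0 + 1)"
        by (intro tendsto_mult tendsto_const tendsto_add tendsto_zero_if_bigo[OF as l1] lz)
      then show ?thesis using \<kappa> by simp
    qed
    obtain M where M: "M > 0" "\<And>j. \<bar>a j\<bar> \<le> M * ?g (real j)" using ratio_bound[OF alim] by blast
    have aM: "cmod (complex_of_real (a j)) \<le> M * ?g (real j)" for j using M(2)[of j] by simp
    have mem: "neg_power D A p \<in> weak_lorentz ?g" unfolding np by (rule diag_op_in_weak_lorentz[OF e e aM])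
    obtain \<xi> :: "nat \<Rightarrow> 'a" where \<xi>: "orthonormal_basis \<xi>" using orthonormal_basis_exists[OF assms(1) e] by blast
    \<comment> \<open>already two different values contradict hypermeasurability\<close>
    have ex: "\<exists>\<phi> :: ('a \<Rightarrow> 'a) \<Rightarrow> complex. normalized_trace ?g \<phi> \<and> \<phi> (neg_power D A p) = v" for v
      unfolding np
    proof (rule normalized_trace_exists[OF \<xi> e aM])
      fix b c' K
      assume "\<And>n. cmod (b * complex_of_real (\<Sum>j<n. ?g (real j)) + c' * (\<Sum>j<n. complex_of_real (a j))) \<le> K * (real n * ?g (real n))"
      then show "b = 0 \<and> c' = 0" by (rule log_sums_independent[OF q \<kappa> as])
    qed
    have not: "\<not> hypermeasurable ?g (neg_power D A p)"
    proof
      assume hm: "hypermeasurable ?g (neg_power D A p)"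
      obtain \<phi> :: "('a \<Rightarrow> 'a) \<Rightarrow> complex" where \<phi>: "normalized_trace ?g \<phi>" "\<phi> (neg_power D A p) = 0" using ex by blast
      obtain \<psi> :: "('a \<Rightarrow> 'a) \<Rightarrow> complex" where \<psi>: "normalized_trace ?g \<psi>" "\<psi> (neg_power D A p) = 1" using ex by blast
      have "\<phi> (neg_power D A p) = \<psi> (neg_power D A p)" using hm \<phi>(1) \<psi>(1) unfolding hypermeasurable_def by blast
      then show False using \<phi>(2) \<psi>(2) by simp
    qed
    have hyp: "hypermeasurable g\<^sub>1 (neg_power D A p)" if \<delta>: "\<delta> \<in> O(\<lambda>t. inverse (ln t))"
      and g1: "\<forall>\<^sub>F t in at_top. g\<^sub>1 t = 1 / t * ln t powr q * (1 - q\<^sup>2 * (ln (ln t) / ln t) + \<delta> t)"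
      for g\<^sub>1 \<delta> :: "real \<Rightarrow> real"
    proof -
      note gas = comparison_weight_asymptotics[OF q \<delta> g1]
      have glim: "(\<lambda>j. g\<^sub>1 (real j) / ?g (real j)) \<longlonglongrightarrow> 1"
        using tendsto_add[OF tendsto_zero_if_bigo[OF gas l1] lz] by simp
      obtain L where L: "L > 0" "\<And>j. \<bar>g\<^sub>1 (real j)\<bar> \<le> L * ?g (real j)" using ratio_bound[OF glim] by blast
      have "(\<lambda>j. g\<^sub>1 (real j)) \<in> \<Theta>(\<lambda>j. ?g (real j))"
      proof (rule bigthetaI)
        show "(\<lambda>j. g\<^sub>1 (real j)) \<in> O(\<lambda>j. ?g (real j))"
          using L(2) g_pos by (intro bigoI[of _ L] always_eventually allI) (simp add: abs_of_pos)
        have "\<forall>\<^sub>F j in sequentially. g\<^sub>1 (real j) / ?g (real j) > 1 / 2" by (rule order_tendstoD(1)[OF glim]) simp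
        then have "\<forall>\<^sub>F j in sequentially. norm (?g (real j)) \<le> 2 * norm (g\<^sub>1 (real j))"
        proof eventually_elim
          case (elim j)
          have "1 / 2 * ?g (real j) < g\<^sub>1 (real j)" using elim g_pos[of j] by (simp only: pos_less_divide_eq)
          then show ?case using g_pos[of j] by simp
        qed
        then show "(\<lambda>j. g\<^sub>1 (real j)) \<in> \<Omega>(\<lambda>j. ?g (real j))"
          unfolding bigomega_iff_bigo by (rule bigoI)
      qed
      then have "O(\<lambda>j. g\<^sub>1 (real j)) = O(\<lambda>j. ?g (real j))" by (rule landau_o.big.cong_bigtheta)
      then have WL: "weak_lorentz g\<^sub>1 = (weak_lorentz ?g :: ('a \<Rightarrow> 'a) set)" by (simp add: weak_lorentz_def)
      define d where "d j = a j - \<kappa> * g\<^sub>1 (real j)" for j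
      have cancel: "\<kappa> * (J * G) * ((A / (\<kappa> * G) - z) - (H / G - z)) = J * (A - \<kappa> * H)"
        if "G > 0" for J G A H z :: real
        using \<kappa> that by (simp add: field_simps)
      \<comment> \<open>both \<open>a\<^sub>j / (\<kappa> g(j))\<close> and \<open>g\<^sub>1(j) / g(j)\<close> are \<open>1 - q\<^sup>2 (log y)/y + O(1/y)\<close>\<close>
      have dO: "(\<lambda>j. real (j + 1) * d j) \<in> O(\<lambda>j. ?y j powr (q - 1))"
      proof -
        have m1: "(\<lambda>j. \<kappa> * (real (j + 1) * ?g (real j)) * ((a j / (\<kappa> * ?g (real j)) - (1 - q\<^sup>2 * (ln (?y j) / ?y j))) -
            (g\<^sub>1 (real j) / ?g (real j) - (1 - q\<^sup>2 * (ln (?y j) / ?y j))))) \<in>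
            O(\<lambda>j. \<kappa> * (real (j + 1) * ?g (real j)) * (1 / ?y j))"
          by (intro landau_o.big.mult_left sum_in_bigo as gas)
        have m2: "\<kappa> * (real (j + 1) * ?g (real j)) * ((a j / (\<kappa> * ?g (real j)) - (1 - q\<^sup>2 * (ln (?y j) / ?y j))) -
            (g\<^sub>1 (real j) / ?g (real j) - (1 - q\<^sup>2 * (ln (?y j) / ?y j)))) = real (j + 1) * d j" for j
          unfolding d_def by (rule cancel[OF g_pos])
        have m3: "\<kappa> * (real (j + 1) * ?g (real j)) * (1 / ?y j) = \<kappa> * ?y j powr (q - 1)" for j
        proof -
          have "real (j + 1) * ?g (real j) = ?y j powr q" by (simp add: field_simps)
          then show ?thesis using y0[of j] by (simp only: powr_diff) simp
        qed
        have "(\<lambda>j. real (j + 1) * d j) \<in> O(\<lambda>j. \<kappa> * ?y j powr (q - 1))"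
          using m1 unfolding m2 m3 .
        then show ?thesis using \<kappa> by (subst (asm) landau_o.big.cmult) auto
      qed
      obtain B where B: "B > 0" "\<And>j. \<bar>real (j + 1) * d j\<bar> \<le> B * ?y j powr (q - 1)"
      proof (rule eventually_le_imp_all_le[OF dO])
        show "?y j powr (q - 1) > 0" for j using y0[of j] by simp
      qed (rule that)
      obtain k where k: "k > 0" "\<And>j. j \<ge> 1 \<Longrightarrow>
          k * ?y j powr (q - 1) \<le> ?y j powr q - ?y (j div 2) powr q"
        using potential_positive[OF q] by blast
      define h where "h j = B / k * ?y j powr q" for j
      show ?thesis unfolding np
      proof (rule hypermeasurable_diag_op[where \<kappa> = \<kappa> and h = h and K = "B / k + 2 * \<bar>d 0\<bar> / ln 2 powr q",
            OF assms(1) e WL L(2) M(2)])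
        show "0 \<le> h 0" using B(1) k(1) by (simp add: h_def)
        show "real (j + 1) * \<bar>a j - \<kappa> * g\<^sub>1 (real j)\<bar> \<le> h j - h (j div 2)" if j: "j \<ge> 1" for j
        proof -
          have "real (j + 1) * \<bar>d j\<bar> \<le> B * ?y j powr (q - 1)" using B(2)[of j] by (simp add: abs_mult)
          also have "\<dots> = B / k * (k * ?y j powr (q - 1))" using k(1) by simp
          also have "\<dots> \<le> B / k * (?y j powr q - ?y (j div 2) powr q)"
            using k(2)[OF j] k(1) B(1) by (intro mult_left_mono) auto
          also have "\<dots> = h j - h (j div 2)" by (simp add: h_def algebra_simps)
          finally show ?thesis by (simp add: d_def)
        qed
        show "h j + 2 * \<bar>a 0 - \<kappa> * g\<^sub>1 (real 0)\<bar> \<le>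
            (B / k + 2 * \<bar>d 0\<bar> / ln 2 powr q) * (real (j + 1) * ?g (real j))" for j
        proof -
          have eq: "real (j + 1) * ?g (real j) = ?y j powr q" by (simp add: field_simps)
          have "ln 2 powr q \<le> ?y j powr q" using q by (intro powr_mono2) auto
          then have "2 * \<bar>d 0\<bar> / ln 2 powr q * ln 2 powr q \<le> 2 * \<bar>d 0\<bar> / ln 2 powr q * ?y j powr q"
            by (intro mult_left_mono) auto
          then show ?thesis unfolding eq by (simp add: h_def d_def distrib_right)
        qed
      qed
    qed
    show ?thesis using mem not hyp by blast
  qed
  show ?thesis using part1 part2 by blast
qed

end
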